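(* If $G$ is a group of order at most $54$, then $\mathcal{N}_G=0$.
   Context: For a finite group $G$, two elements $g,h\in G$ are $\mathbb{R}$-$\mathrm{Aut}(G)$-conjugate if $g$ is in the $\mathrm{Aut}(G)$-orbit of $h$ or of $h^{-1}$; they are $\mathbb{Q}$-$\mathrm{Aut}(G)$-conjugate if the cyclic subgroups $\langle g\rangle$ and $\langle h\rangle$ are in the same $\mathrm{Aut}(G)$-orbit. Define $$\mathcal{N}_G = \#\{\mathbb{R}\text{-}\mathrm{Aut}(G)\text{-conjugacy classes in } G\} - \#\{\mathbb{Q}\text{-}\mathrm{Aut}(G)\text{-conjugacy classes in } G\}.$$ *)

theory Defs
  imports "HOL-Algebra.Group_Action" "HOL-Algebra.Generated_Groups"
begin

abbreviation Aut_orbit :: "('a, 'b) monoid_scheme \<Rightarrow> 'a \<Rightarrow> 'a set"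
  where "Aut_orbit G \<equiv> orbit (AutoGroup G) (\<lambda>\<phi> x. \<phi> x)"

abbreviation Aut_orbit_set :: "('a, 'b) monoid_scheme \<Rightarrow> 'a set \<Rightarrow> 'a set set"
  where "Aut_orbit_set G \<equiv> orbit (AutoGroup G) (\<lambda>\<phi> H. \<phi> ` H)"

definition R_Aut_conj :: "('a, 'b) monoid_scheme \<Rightarrow> ('a \<times> 'a) set"
  where "R_Aut_conj G = {(g, h). g \<in> carrier G \<and> h \<in> carrier G \<and>
           (g \<in> Aut_orbit G h \<or> g \<in> Aut_orbit G (inv\<^bsub>G\<^esub> h))}"

definition Q_Aut_conj :: "('a, 'b) monoid_scheme \<Rightarrow> ('a \<times> 'a) set"
  where "Q_Aut_conj G = {(g, h). g \<in> carrier G \<and> h \<in> carrier G \<and>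
           generate G {g} \<in> Aut_orbit_set G (generate G {h})}"

text \<open>The difference is taken in the integers, since subtraction of natural numbers truncates.\<close>

definition Aut_class_defect :: "('a, 'b) monoid_scheme \<Rightarrow> int"
  where "Aut_class_defect G =
           int (card (carrier G // R_Aut_conj G)) - int (card (carrier G // Q_Aut_conj G))"

lemma mem_Aut_orbit_iff: "x \<in> Aut_orbit G y \<longleftrightarrow> (\<exists>\<phi>\<in>auto G. x = \<phi> y)"
  by (auto simp: orbit_def AutoGroup_def)

lemma mem_Aut_orbit_set_iff: "H \<in> Aut_orbit_set G K \<longleftrightarrow> (\<exists>\<phi>\<in>auto G. H = \<phi> ` K)"
  by (auto simp: orbit_def AutoGroup_def)

context group
begin

lemma auto_inverse:
  assumes "\<phi> \<in> auto G"
  obtains \<psi> where "\<psi> \<in> auto G" "\<And>x. x \<in> carrier G \<Longrightarrow> \<psi> (\<phi> x) = x"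
proof
  show "restrict (inv_into (carrier G) \<phi>) (carrier G) \<in> auto G"
    using assms by (simp add: auto_def restrict_inv_into_Bij restrict_inv_into_hom del: restrict_apply)
  show "restrict (inv_into (carrier G) \<phi>) (carrier G) (\<phi> x) = x" if "x \<in> carrier G" for x
    using assms that by (auto simp: auto_def Bij_def bij_betw_def)
qed

lemma auto_compose:
  assumes "\<phi> \<in> auto G" "\<psi> \<in> auto G"
  obtains \<chi> where "\<chi> \<in> auto G" "\<And>x. x \<in> carrier G \<Longrightarrow> \<chi> x = \<phi> (\<psi> x)"
proof
  show "compose (carrier G) \<phi> \<psi> \<in> auto G"
    using assms by (auto simp: auto_def compose_Bij hom_compose Bij_imp_funcset)
  show "compose (carrier G) \<phi> \<psi> x = \<phi> (\<psi> x)" if "x \<in> carrier G" for x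
    using that by (simp add: compose_def)
qed

lemma auto_closed: "\<phi> \<in> auto G \<Longrightarrow> x \<in> carrier G \<Longrightarrow> \<phi> x \<in> carrier G"
  by (auto simp: auto_def hom_def)

lemma auto_inv: "\<phi> \<in> auto G \<Longrightarrow> x \<in> carrier G \<Longrightarrow> \<phi> (inv x) = inv (\<phi> x)"
  by (rule group_hom.hom_inv)
     (auto simp: auto_def group_hom_def group_hom_axioms_def is_group)

lemma equiv_R_Aut_conj: "equiv (carrier G) (R_Aut_conj G)"
proof -
  have iff: "(g, h) \<in> R_Aut_conj G \<longleftrightarrow> g \<in> carrier G \<and> h \<in> carrier G \<and>
      (\<exists>\<phi>\<in>auto G. g = \<phi> h \<or> g = inv (\<phi> h))" for g h
    by (auto simp: R_Aut_conj_def mem_Aut_orbit_iff auto_inv)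
  have car: "g \<in> carrier G \<and> h \<in> carrier G" if "(g, h) \<in> R_Aut_conj G" for g h
    using that by (simp add: R_Aut_conj_def)
  show ?thesis
  proof (rule equivI)
    show "R_Aut_conj G \<subseteq> carrier G \<times> carrier G"
      by (auto simp: R_Aut_conj_def)
    show "refl_on (carrier G) (R_Aut_conj G)"
    proof (rule refl_onI)
      fix g assume g: "g \<in> carrier G"
      then have "g = (\<lambda>x\<in>carrier G. x) g" by simp
      with g id_in_auto show "(g, g) \<in> R_Aut_conj G"
        unfolding iff by blast
    qed
    show "sym (R_Aut_conj G)"
    proof (rule symI)
      fix g h assume gh: "(g, h) \<in> R_Aut_conj G"
      then obtain \<phi> where \<phi>: "\<phi> \<in> auto G" "g = \<phi> h \<or> g = inv (\<phi> h)"
        by (auto simp: iff)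
      obtain \<psi> where \<psi>: "\<psi> \<in> auto G" "\<And>x. x \<in> carrier G \<Longrightarrow> \<psi> (\<phi> x) = x"
        using auto_inverse[OF \<phi>(1)] by blast
      have "h = \<psi> g \<or> h = inv (\<psi> g)"
        using car[OF gh] \<phi> \<psi> by (auto simp: auto_inv auto_closed)
      with gh \<psi>(1) show "(h, g) \<in> R_Aut_conj G" by (auto simp: iff)
    qed
    show "trans (R_Aut_conj G)"
    proof (rule transI)
      fix g h k assume gh: "(g, h) \<in> R_Aut_conj G" and hk: "(h, k) \<in> R_Aut_conj G"
      then obtain \<phi> \<psi> where \<phi>: "\<phi> \<in> auto G" "g = \<phi> h \<or> g = inv (\<phi> h)"
        and \<psi>: "\<psi> \<in> auto G" "h = \<psi> k \<or> h = inv (\<psi> k)"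
        by (auto simp: iff)
      obtain \<chi> where \<chi>: "\<chi> \<in> auto G" "\<And>x. x \<in> carrier G \<Longrightarrow> \<chi> x = \<phi> (\<psi> x)"
        using auto_compose[OF \<phi>(1) \<psi>(1)] by blast
      have "g = \<chi> k \<or> g = inv (\<chi> k)"
        using car[OF hk] \<phi> \<psi> \<chi>(2) by (auto simp: auto_inv auto_closed)
      with gh hk \<chi>(1) show "(g, k) \<in> R_Aut_conj G" by (auto simp: iff)
    qed
  qed
qed

lemma equiv_Q_Aut_conj: "equiv (carrier G) (Q_Aut_conj G)"
proof -
  have iff: "(g, h) \<in> Q_Aut_conj G \<longleftrightarrow> g \<in> carrier G \<and> h \<in> carrier G \<and>
      (\<exists>\<phi>\<in>auto G. generate G {g} = \<phi> ` generate G {h})" for g h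
    by (auto simp: Q_Aut_conj_def mem_Aut_orbit_set_iff)
  have sub: "generate G {g} \<subseteq> carrier G" if "g \<in> carrier G" for g
    using that by (intro generate_incl) auto
  show ?thesis
  proof (rule equivI)
    show "Q_Aut_conj G \<subseteq> carrier G \<times> carrier G"
      by (auto simp: Q_Aut_conj_def)
    show "refl_on (carrier G) (Q_Aut_conj G)"
    proof (rule refl_onI)
      fix g assume g: "g \<in> carrier G"
      have "(\<lambda>x\<in>carrier G. x) ` generate G {g} = id ` generate G {g}"
        using sub[OF g] by (intro image_cong) auto
      with g id_in_auto show "(g, g) \<in> Q_Aut_conj G"
        unfolding iff by (metis image_id id_apply)
    qed
    show "sym (Q_Aut_conj G)"
    proof (rule symI)
      fix g h assume gh: "(g, h) \<in> Q_Aut_conj G"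
      then obtain \<phi> where \<phi>: "\<phi> \<in> auto G" "generate G {g} = \<phi> ` generate G {h}"
        by (auto simp: iff)
      obtain \<psi> where \<psi>: "\<psi> \<in> auto G" "\<And>x. x \<in> carrier G \<Longrightarrow> \<psi> (\<phi> x) = x"
        using auto_inverse[OF \<phi>(1)] by blast
      have "\<psi> ` generate G {g} = (\<lambda>x. x) ` generate G {h}"
        unfolding \<phi>(2) image_image using gh sub \<psi>(2) by (intro image_cong) (auto simp: iff)
      with gh \<psi>(1) show "(h, g) \<in> Q_Aut_conj G" by (auto simp: iff)
    qed
    show "trans (Q_Aut_conj G)"
    proof (rule transI)
      fix g h k assume gh: "(g, h) \<in> Q_Aut_conj G" and hk: "(h, k) \<in> Q_Aut_conj G"
      then obtain \<phi> \<psi> where \<phi>: "\<phi> \<in> auto G" "generate G {g} = \<phi> ` generate G {h}"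
        and \<psi>: "\<psi> \<in> auto G" "generate G {h} = \<psi> ` generate G {k}"
        by (auto simp: iff)
      obtain \<chi> where \<chi>: "\<chi> \<in> auto G" "\<And>x. x \<in> carrier G \<Longrightarrow> \<chi> x = \<phi> (\<psi> x)"
        using auto_compose[OF \<phi>(1) \<psi>(1)] by blast
      have "generate G {g} = \<chi> ` generate G {k}"
        unfolding \<phi>(2) \<psi>(2) image_image
        using hk sub \<chi>(2) by (intro image_cong) (auto simp: iff subset_iff)
      with gh hk \<chi>(1) show "(g, k) \<in> Q_Aut_conj G" by (auto simp: iff)
    qed
  qed
qed

end

end

(*
  The defect vanishes as soon as, for every g of order n and every k prime to n, some automorphism
  maps g to g^k or g^-k.  The main tool is a crossed homomorphism d into an abelian normal subgroup A
  of index m (the cocycle that shows that m annihilates H^2(G/A, A)): taken with respect to a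
  transversal permuted by g, it satisfies d a = a^m on A and d g = g^m, even if g lies outside A.
  Hence x |-> d(x)^j x is an automorphism with g |-> g^(1 + j m), and g has the wanted property
  whenever gcd m n is 1, 2, 3, 4 or 6, because then every unit modulo gcd m n is 1 or -1.

  For C = <g> of index m, pigeonhole on the cosets of C shows that a power of g with a small exponent
  generates a normal subgroup, which serves as A unless (n, m) is one of
  (8,4), (12,4), (5,5), (10,5), (5,6), (8,6), (9,6), (5,7), (7,7), (5,8), (5,9), (5,10).
  In these cases the number of cosets of C fixed by C controls the normaliser of C, and one finds a
  better A, an inner automorphism, or an automorphism that multiplies the elements outside a subgroup
  of index two by a central involution.
*)

theory Submission
  imports Defs "HOL-Number_Theory.Residues" "HOL-Algebra.Multiplicative_Group" "HOL-Algebra.Zassenhaus" "HOL-Algebra.Sylow"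
begin

section \<open>Crossed homomorphisms into abelian normal subgroups\<close>

text \<open>The bound is sharp. In the nonabelian group of order 55 every automorphism acts
  trivially on the quotient of order 5, so an element g of order 5 generates the same subgroup as
  g^2 without being R-conjugate to it; this is the pair (n, m) = (5, 11). Hence the argument must
  use the size of the group, and every pair (n, m) below the bound has to be settled.

  The choice of A pulls in two directions: a small subgroup is easily abelian and normal, but its
  index then shares more with n. Modulo n the exponents 1 + j m reach only residues that are 1
  modulo gcd m n; the moduli 1, 2, 3, 4, 6 suffice because R-conjugacy identifies g with its
  inverse. Injectivity of the map asks in addition that 1 + j m be prime to |A|, which a change of j
  by a multiple of n can arrange.

  The normaliser is controlled by one congruence: if n is a power of a prime p, its index f over C
  divides m and f = m modulo p. An order 12 is no prime power, so there the congruence is applied to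
  the subgroup of order 3 of C instead, which makes order 48 the longest case.\<close>

definition (in group) crossed_hom :: "'a set \<Rightarrow> ('a \<Rightarrow> 'a) \<Rightarrow> bool"
  where "crossed_hom A d \<longleftrightarrow> d \<in> carrier G \<rightarrow> A \<and>
    (\<forall>x\<in>carrier G. \<forall>y\<in>carrier G. d (x \<otimes> y) = d x \<otimes> (x \<otimes> d y \<otimes> inv x))"

context group
begin

lemma inv_mult_cancel_left [simp]:
  "x \<in> carrier G \<Longrightarrow> y \<in> carrier G \<Longrightarrow> inv x \<otimes> (x \<otimes> y) = y"
  by (simp flip: m_assoc)

lemma mult_inv_cancel_left [simp]:
  "x \<in> carrier G \<Longrightarrow> y \<in> carrier G \<Longrightarrow> x \<otimes> (inv x \<otimes> y) = y"
  by (simp flip: m_assoc)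

lemma conj_mult:
  assumes "x \<in> carrier G" "a \<in> carrier G" "b \<in> carrier G"
  shows "x \<otimes> (a \<otimes> b) \<otimes> inv x = (x \<otimes> a \<otimes> inv x) \<otimes> (x \<otimes> b \<otimes> inv x)"
  using assms by (simp add: m_assoc inv_solve_left)

lemma conj_pow:
  fixes n :: nat
  assumes "x \<in> carrier G" "a \<in> carrier G"
  shows "x \<otimes> a [^] n \<otimes> inv x = (x \<otimes> a \<otimes> inv x) [^] n"
  using assms by (induction n) (auto simp: conj_mult)

lemma finprod_conj:
  assumes A: "A \<lhd> G" "comm_group (G\<lparr>carrier := A\<rparr>)" and x: "x \<in> carrier G"
    and I: "finite I" and f: "f \<in> I \<rightarrow> A"
  shows "x \<otimes> finprod (G\<lparr>carrier := A\<rparr>) f I \<otimes> inv x = finprod (G\<lparr>carrier := A\<rparr>) (\<lambda>i. x \<otimes> f i \<otimes> inv x) I"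
proof -
  interpret A: comm_group "G\<lparr>carrier := A\<rparr>" by fact
  interpret N: normal A G by fact
  show ?thesis using I f
  proof (induction I)
    case empty
    then show ?case using x by simp
  next
    case (insert i I)
    have "finprod (G\<lparr>carrier := A\<rparr>) f I \<in> A" 
      using A.finprod_closed[of f I] insert by auto
    moreover have "(\<lambda>i. x \<otimes> f i \<otimes> inv x) \<in> I \<rightarrow> A" "x \<otimes> f i \<otimes> inv x \<in> A"
      using insert.prems x by (auto intro: N.inv_op_closed2)
    ultimately show ?case
      using insert x by (subst A.finprod_insert A.finprod_insert) (auto simp: conj_mult Pi_iff)
  qed
qed

text \<open>Write \<open>x \<otimes> \<rho> p = \<alpha> x p \<otimes> \<rho> (\<beta> x p)\<close>
  and let \<open>d x\<close> be the product of all \<open>\<alpha> x p\<close>. Expanding the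
  product of \<open>x \<otimes> y\<close> with \<open>\<rho> p\<close> in two ways expresses
  \<open>\<alpha> (x \<otimes> y) p\<close> by \<open>\<alpha> x (\<beta> y p)\<close> and the
  conjugate of \<open>\<alpha> y p\<close> under \<open>x\<close>. As \<open>\<beta> y\<close>
  permutes \<open>I\<close>, the product over \<open>p\<close> is the crossed identity. The last
  conclusion makes the coefficients computable for a concrete \<open>x\<close>.\<close>

lemma crossed_hom_transversal:
  fixes \<rho> :: "'i \<Rightarrow> 'a"
  assumes A: "A \<lhd> G" "comm_group (G\<lparr>carrier := A\<rparr>)"
    and I: "finite I" and \<rho>: "\<rho> \<in> I \<rightarrow> carrier G"
    and bij: "bij_betw (\<lambda>(a, p). a \<otimes> \<rho> p) (A \<times> I) (carrier G)"
  obtains d \<alpha> where "crossed_hom A d"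
    "\<And>x. x \<in> carrier G \<Longrightarrow> d x = finprod (G\<lparr>carrier := A\<rparr>) (\<alpha> x) I"
    "\<And>x p a q. x \<in> carrier G \<Longrightarrow> p \<in> I \<Longrightarrow> a \<in> A \<Longrightarrow> q \<in> I \<Longrightarrow> x \<otimes> \<rho> p = a \<otimes> \<rho> q \<Longrightarrow> \<alpha> x p = a"
proof -
  interpret A: comm_group "G\<lparr>carrier := A\<rparr>" by fact
  interpret N: normal A G by fact
  have ex: "\<exists>a q. a \<in> A \<and> q \<in> I \<and> x \<otimes> \<rho> p = a \<otimes> \<rho> q" if "x \<in> carrier G" "p \<in> I" for x p
  proof -
    have "x \<otimes> \<rho> p \<in> (\<lambda>(a, p). a \<otimes> \<rho> p) ` (A \<times> I)"
      using bij \<rho> that by (auto simp: bij_betw_def)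
    then show ?thesis by auto
  qed
  then obtain \<alpha> \<beta> where ab: "\<And>x p. x \<in> carrier G \<Longrightarrow> p \<in> I \<Longrightarrow> \<alpha> x p \<in> A \<and> \<beta> x p \<in> I \<and> x \<otimes> \<rho> p = \<alpha> x p \<otimes> \<rho> (\<beta> x p)"
    by metis
  have uniq: "a = b \<and> p = q" if "a \<otimes> \<rho> p = b \<otimes> \<rho> q" "a \<in> A" "b \<in> A" "p \<in> I" "q \<in> I" for a b p q
    using that bij by (auto simp: bij_betw_def inj_on_def)
  define d where "d x = finprod (G\<lparr>carrier := A\<rparr>) (\<alpha> x) I" for x
  have \<alpha>: "\<alpha> x \<in> I \<rightarrow> A" if "x \<in> carrier G" for x using ab that by auto
  have dA: "d x \<in> A" if "x \<in> carrier G" for x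
    unfolding d_def using A.finprod_closed[of "\<alpha> x" I] \<alpha>[OF that] by simp
  have "d (x \<otimes> y) = d x \<otimes> (x \<otimes> d y \<otimes> inv x)" if x: "x \<in> carrier G" and y: "y \<in> carrier G" for x y
  proof -
    have \<beta>I: "\<beta> y \<in> I \<rightarrow> I" using ab y by auto
    have inj: "inj_on (\<beta> y) I"
    proof (rule inj_onI)
      fix p q assume pq: "p \<in> I" "q \<in> I" "\<beta> y p = \<beta> y q"
      have c[simp]: "\<alpha> y p \<in> carrier G" "\<alpha> y q \<in> carrier G" "\<rho> p \<in> carrier G" "\<rho> q \<in> carrier G" "\<rho> (\<beta> y q) \<in> carrier G"
        using ab[OF y] pq \<rho> N.subset by auto
      have "inv (\<alpha> y p) \<otimes> (y \<otimes> \<rho> p) = inv (\<alpha> y q) \<otimes> (y \<otimes> \<rho> q)"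
        using ab[OF y pq(1)] ab[OF y pq(2)] pq(3) by (simp flip: m_assoc)
      \<comment> \<open>Indices with the same image have representatives that differ by a conjugate
        of an element of \<open>A\<close>; the factor \<open>\<one>\<close> gives this the shape
        required by \<open>uniq\<close>.\<close>
      then have e: "(inv y \<otimes> (\<alpha> y q \<otimes> inv (\<alpha> y p)) \<otimes> y) \<otimes> \<rho> p = \<one> \<otimes> \<rho> q"
        using y by (simp add: m_assoc inv_solve_left) (metis c inv_closed inv_mult_cancel_left m_closed y)
      show "p = q"
        by (rule uniq[OF e, THEN conjunct2]) (use ab[OF y] pq y in \<open>auto intro!: N.inv_op_closed1\<close>)
    qed
    then have im: "\<beta> y ` I = I" using \<beta>I I by (simp add: endo_inj_surj image_subset_iff_funcset)
    have eq: "\<alpha> (x \<otimes> y) p = \<alpha> x (\<beta> y p) \<otimes> (x \<otimes> \<alpha> y p \<otimes> inv x)" if p: "p \<in> I" for p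
    proof -
      have 1: "\<alpha> y p \<in> A" "\<beta> y p \<in> I" "y \<otimes> \<rho> p = \<alpha> y p \<otimes> \<rho> (\<beta> y p)" using ab[OF y p] by auto
      have 2: "\<alpha> x (\<beta> y p) \<in> A" "\<beta> x (\<beta> y p) \<in> I" "x \<otimes> \<rho> (\<beta> y p) = \<alpha> x (\<beta> y p) \<otimes> \<rho> (\<beta> x (\<beta> y p))"
        using ab[OF x 1(2)] by auto
      have 3: "\<alpha> (x \<otimes> y) p \<in> A" "\<beta> (x \<otimes> y) p \<in> I" "(x \<otimes> y) \<otimes> \<rho> p = \<alpha> (x \<otimes> y) p \<otimes> \<rho> (\<beta> (x \<otimes> y) p)"
        using ab[of "x \<otimes> y"] x y p by auto
      have c[simp]: "\<rho> p \<in> carrier G" "\<alpha> y p \<in> carrier G" "\<alpha> x (\<beta> y p) \<in> carrier G" "\<rho> (\<beta> y p) \<in> carrier G" "\<rho> (\<beta> x (\<beta> y p)) \<in> carrier G"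
        using 1 2 3 p \<rho> N.subset by auto
      have "(x \<otimes> y) \<otimes> \<rho> p = (x \<otimes> \<alpha> y p \<otimes> inv x) \<otimes> (x \<otimes> \<rho> (\<beta> y p))"
        using x y 1(3) by (simp add: m_assoc inv_solve_left)
      also have "\<dots> = ((x \<otimes> \<alpha> y p \<otimes> inv x) \<otimes> \<alpha> x (\<beta> y p)) \<otimes> \<rho> (\<beta> x (\<beta> y p))"
        using x unfolding 2(3) by (simp add: m_assoc)
      finally have "\<alpha> (x \<otimes> y) p = (x \<otimes> \<alpha> y p \<otimes> inv x) \<otimes> \<alpha> x (\<beta> y p)"
        unfolding 3(3) using uniq 1 2 3 x by (simp add: N.inv_op_closed2)
      also have "\<dots> = \<alpha> x (\<beta> y p) \<otimes> (x \<otimes> \<alpha> y p \<otimes> inv x)"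
        using A.m_comm 1 2 x by (simp add: N.inv_op_closed2)
      finally show ?thesis .
    qed
    have f1: "(\<lambda>p. \<alpha> x (\<beta> y p)) \<in> I \<rightarrow> A" using \<alpha>[OF x] \<beta>I by auto
    have f2: "(\<lambda>p. x \<otimes> \<alpha> y p \<otimes> inv x) \<in> I \<rightarrow> A" using \<alpha>[OF y] x by (auto intro!: N.inv_op_closed2)
    have "d (x \<otimes> y) = finprod (G\<lparr>carrier := A\<rparr>) (\<lambda>p. \<alpha> x (\<beta> y p) \<otimes> (x \<otimes> \<alpha> y p \<otimes> inv x)) I"
      unfolding d_def by (rule A.finprod_cong') (use f1 f2 eq in \<open>auto simp: Pi_iff\<close>)
    also have "\<dots> = finprod (G\<lparr>carrier := A\<rparr>) (\<lambda>p. \<alpha> x (\<beta> y p)) I \<otimes> finprod (G\<lparr>carrier := A\<rparr>) (\<lambda>p. x \<otimes> \<alpha> y p \<otimes> inv x) I"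
      using A.finprod_multf[of "\<lambda>p. \<alpha> x (\<beta> y p)" I "\<lambda>p. x \<otimes> \<alpha> y p \<otimes> inv x"] f1 f2 by simp
    also have "finprod (G\<lparr>carrier := A\<rparr>) (\<lambda>p. \<alpha> x (\<beta> y p)) I = d x"
      unfolding d_def using A.finprod_reindex[of "\<alpha> x" "\<beta> y" I] inj im \<alpha>[OF x] by simp
    also have "finprod (G\<lparr>carrier := A\<rparr>) (\<lambda>p. x \<otimes> \<alpha> y p \<otimes> inv x) I = x \<otimes> d y \<otimes> inv x"
      unfolding d_def using finprod_conj[OF A x I \<alpha>[OF y]] by simp
    finally show ?thesis .
  qed
  with dA have "crossed_hom A d" by (auto simp: crossed_hom_def)
  moreover have "\<alpha> x p = a" if "x \<in> carrier G" "p \<in> I" "a \<in> A" "q \<in> I" "x \<otimes> \<rho> p = a \<otimes> \<rho> q" for x p a q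
    using ab[OF that(1,2)] uniq that by metis
  ultimately show ?thesis using that[of d \<alpha>] d_def by blast
qed

text \<open>The orbits of left multiplication by \<open>g\<close> on the cosets of \<open>A\<close>
  correspond to the cosets of \<open>A <#> generate G {g}\<close>, and each has length
  \<open>r\<close>, the order of the image of \<open>g\<close> in the quotient by \<open>A\<close>.
  Representatives \<open>g [^] i \<otimes> \<sigma> T\<close> along an orbit make \<open>g\<close>
  the step from i to i + 1, with a correction \<open>g [^] r\<close> only where the orbit closes
  up.\<close>

lemma transversal_stepped_by:
  assumes A: "A \<lhd> G" and fin: "finite (carrier G)" and g: "g \<in> carrier G"
  obtains r :: nat and \<rho> :: "nat \<times> 'a set \<Rightarrow> 'a" and S :: "'a set set"
  where "0 < r" "finite S" "g [^] r \<in> A" "\<rho> \<in> {..<r} \<times> S \<rightarrow> carrier G"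
    "bij_betw (\<lambda>(a, p). a \<otimes> \<rho> p) (A \<times> ({..<r} \<times> S)) (carrier G)"
    "\<And>i T. Suc i < r \<Longrightarrow> T \<in> S \<Longrightarrow> g \<otimes> \<rho> (i, T) = \<rho> (Suc i, T)"
    "\<And>i T. Suc i = r \<Longrightarrow> T \<in> S \<Longrightarrow> g \<otimes> \<rho> (i, T) = g [^] r \<otimes> \<rho> (0, T)"
proof -
  interpret N: normal A G by fact
  define r where "r = (LEAST r::nat. 0 < r \<and> g [^] r \<in> A)"
  have ex: "\<exists>r::nat. 0 < r \<and> g [^] r \<in> A"
    using ord_ge_1[OF fin g] pow_ord_eq_1[OF g] N.one_closed by (metis less_le_trans zero_less_one)
  have r: "0 < r" "g [^] r \<in> A"
    using LeastI_ex[OF ex] by (auto simp: r_def)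
  have min: "i = 0" if "i < r" "g [^] i \<in> A" for i
    using not_less_Least[of i "\<lambda>r. 0 < r \<and> g [^] r \<in> A"] that by (auto simp: r_def)
  define H where "H = A <#> generate G {g}"
  have H: "subgroup H G"
    unfolding H_def using mult_norm_subgroup[OF A generate_is_subgroup] g by auto
  have H_mem: "h \<in> H \<longleftrightarrow> (\<exists>a\<in>A. \<exists>i<r. h = a \<otimes> g [^] i)" for h
  proof
    assume "h \<in> H"
    then obtain a k where a: "a \<in> A" and h: "h = a \<otimes> g [^] (k::int)"
      by (auto simp: H_def set_mult_def generate_pow[OF g])
    define i where "i = nat (k mod int r)"
    have "k = int r * (k div int r) + int i" using r(1) by (simp add: i_def)
    then have "g [^] k = (g [^] r) [^] (k div int r) \<otimes> g [^] i"
      using g by (metis int_pow_int int_pow_mult int_pow_pow)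
    moreover have "(g [^] r) [^] (k div int r) \<in> A"
      using r(2) N.subgroup_axioms subgroup_int_pow_closed by blast
    moreover have "i < r" using r(1) by (simp add: i_def nat_less_iff)
    ultimately have "h = (a \<otimes> (g [^] r) [^] (k div int r)) \<otimes> g [^] i \<and> a \<otimes> (g [^] r) [^] (k div int r) \<in> A"
      using h a g by (simp add: m_assoc)
    then show "\<exists>a\<in>A. \<exists>i<r. h = a \<otimes> g [^] i" using \<open>i < r\<close> by blast
  next
    assume "\<exists>a\<in>A. \<exists>i<r. h = a \<otimes> g [^] i"
    moreover have "g [^] (i::nat) \<in> generate G {g}" for i
      unfolding generate_pow[OF g] by (metis (mono_tags, lifting) UNIV_I int_pow_int mem_Collect_eq)
    ultimately show "h \<in> H" by (auto simp: H_def set_mult_def)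
  qed
  define S where "S = rcosets H"
  define \<sigma> where "\<sigma> T = (SOME x. x \<in> T)" for T :: "'a set"
  have \<sigma>: "\<sigma> T \<in> T" if "T \<in> S" for T
    unfolding \<sigma>_def using subgroup.rcosets_non_empty[OF H] that by (metis S_def some_in_eq)
  have \<sigma>c[simp]: "\<sigma> T \<in> carrier G" if "T \<in> S" for T
    using \<sigma>[OF that] that subgroup.rcosets_carrier[OF H group_axioms] by (auto simp: S_def)
  define \<rho> where "\<rho> = (\<lambda>(i::nat, T). g [^] i \<otimes> \<sigma> T)"
  have T_eq: "T = H #> \<sigma> T" if "T \<in> S" for T
  proof -
    obtain y where "y \<in> carrier G" "T = H #> y" using \<open>T \<in> S\<close> by (auto simp: S_def RCOSETS_def)
    then show ?thesis using repr_independence[OF _ _ H, of "\<sigma> T" y] \<sigma>[OF that] by simp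
  qed
  have "inj_on (\<lambda>(a, p). a \<otimes> \<rho> p) (A \<times> ({..<r} \<times> S))"
  proof (rule inj_onI, clarsimp simp: \<rho>_def)
    fix a i T b j T'
    assume as: "a \<in> A" "i < r" "T \<in> S" "b \<in> A" "j < r" "T' \<in> S"
      and eq: "a \<otimes> (g [^] i \<otimes> \<sigma> T) = b \<otimes> (g [^] j \<otimes> \<sigma> T')"
    have c: "a \<in> carrier G" "b \<in> carrier G" using as N.subset by auto
    have m: "c \<otimes> (g [^] l \<otimes> \<sigma> V) \<in> V" if "c \<in> A" "l < r" "V \<in> S" for c l V
    proof -
      have "c \<otimes> g [^] l \<in> H" using that H_mem by blast
      moreover have "c \<otimes> (g [^] l \<otimes> \<sigma> V) = (c \<otimes> g [^] l) \<otimes> \<sigma> V" using that g N.subset by (simp add: m_assoc subset_iff)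
      ultimately show ?thesis using T_eq[OF that(3)] by (auto simp: r_coset_def)
    qed
    have T: "T = T'"
    proof (rule ccontr)
      assume "T \<noteq> T'"
      then have "T \<inter> T' = {}" using rcos_disjoint[OF H] as by (auto simp: S_def pairwise_def disjnt_def)
      moreover have "a \<otimes> (g [^] i \<otimes> \<sigma> T) \<in> T" "a \<otimes> (g [^] i \<otimes> \<sigma> T) \<in> T'"
        using m[OF as(1-3)] m[OF as(4-6)] eq by auto
      ultimately show False by blast
    qed
    have e: "a \<otimes> g [^] i = b \<otimes> g [^] j"
      using eq as g c unfolding T by (simp flip: m_assoc)
    \<comment> \<open>Two representatives of one orbit in the same coset of \<open>A\<close> would
      put a power of \<open>g\<close> with exponent below \<open>r\<close> into
      \<open>A\<close>.\<close>
    have le: "i = j" if "i \<le> j" "j < r" "a \<otimes> g [^] i = b \<otimes> g [^] j" "a \<in> A" "b \<in> A" for i j a b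
    proof -
      have c: "a \<in> carrier G" "b \<in> carrier G" using that N.subset by auto
      have "g [^] j = g [^] (j - i) \<otimes> g [^] i" using that g by (simp add: nat_pow_mult)
      then have "a = b \<otimes> g [^] (j - i)" using that g c by (simp flip: m_assoc)
      then have "g [^] (j - i) = inv b \<otimes> a" using g c by simp
      then have "g [^] (j - i) \<in> A" using that by simp
      then show ?thesis using min[of "j - i"] that by linarith
    qed
    have "i = j" using le[of i j a b] le[of j i b a] e as by (metis nle_le)
    then show "a = b \<and> i = j \<and> T = T'" using e g c T by simp
  qed
  moreover have "(\<lambda>(a, p). a \<otimes> \<rho> p) ` (A \<times> ({..<r} \<times> S)) = carrier G"
  proof (intro equalityI subsetI)
    fix x assume x: "x \<in> carrier G"
    define T where "T = H #> x"
    have T: "T \<in> S" using x by (auto simp: T_def S_def RCOSETS_def)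
    have "x \<in> H #> \<sigma> T" using T_eq[OF T] x H by (metis T_def rcos_self)
    then obtain h where "h \<in> H" "x = h \<otimes> \<sigma> T" by (auto simp: r_coset_def)
    then obtain a i where "a \<in> A" "i < r" "x = a \<otimes> g [^] i \<otimes> \<sigma> T" by (auto simp: H_mem)
    then have "x = a \<otimes> \<rho> (i, T) \<and> a \<in> A \<and> i < r" using g T N.subset by (auto simp: \<rho>_def m_assoc)
    then show "x \<in> (\<lambda>(a, p). a \<otimes> \<rho> p) ` (A \<times> ({..<r} \<times> S))"
      using T by (auto simp: image_iff)
  qed (use g N.subset in \<open>auto simp: \<rho>_def\<close>)
  ultimately have bij: "bij_betw (\<lambda>(a, p). a \<otimes> \<rho> p) (A \<times> ({..<r} \<times> S)) (carrier G)"
    by (simp add: bij_betw_def)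
  show ?thesis
  proof (rule that[OF r(1) _ r(2) _ bij])
    show "finite S" using fin by (simp add: S_def RCOSETS_def)
    show "\<rho> \<in> {..<r} \<times> S \<rightarrow> carrier G" using g by (auto simp: \<rho>_def)
    have step: "g \<otimes> \<rho> (i, T) = g [^] Suc i \<otimes> \<sigma> T" if "T \<in> S" for i T
      using g that unfolding \<rho>_def nat_pow_Suc2[OF g] by (simp add: m_assoc)
    show "g \<otimes> \<rho> (i, T) = \<rho> (Suc i, T)" if "T \<in> S" for i T
      using step[OF that] by (simp add: \<rho>_def)
    show "g \<otimes> \<rho> (i, T) = g [^] r \<otimes> \<rho> (0, T)" if "Suc i = r" "T \<in> S" for i T
      using step[OF that(2)] g that by (simp add: \<rho>_def flip: that(1))
  qed
qed

text \<open>For \<open>a\<close> in \<open>A\<close> each of the \<open>m\<close> coefficients is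
  \<open>a\<close> itself. For \<open>g\<close> the coefficients along an orbit are 1 except for
  \<open>g [^] r\<close> at the closing step, so each of the \<open>card S\<close> orbits
  contributes \<open>g [^] r\<close>, and \<open>r * card S = m\<close>.\<close>

lemma crossed_hom_power:
  assumes A: "A \<lhd> G" and comm: "\<And>a b. a \<in> A \<Longrightarrow> b \<in> A \<Longrightarrow> a \<otimes> b = b \<otimes> a"
    and fin: "finite (carrier G)" and g: "g \<in> carrier G" and m: "order G = m * card A"
  obtains d where "crossed_hom A d" "\<And>a. a \<in> A \<Longrightarrow> d a = a [^] m" "d g = g [^] m"
proof -
  interpret N: normal A G by fact
  have cA: "comm_group (G\<lparr>carrier := A\<rparr>)"
    by (rule group.group_comm_groupI) (use comm N.subgroup_axioms subgroup_imp_group in auto)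
  interpret A: comm_group "G\<lparr>carrier := A\<rparr>" by fact
  obtain r :: nat and \<rho> :: "nat \<times> 'a set \<Rightarrow> 'a" and S where r: "0 < r" "finite S" "g [^] r \<in> A" "\<rho> \<in> {..<r} \<times> S \<rightarrow> carrier G"
    "bij_betw (\<lambda>(a, p). a \<otimes> \<rho> p) (A \<times> ({..<r} \<times> S)) (carrier G)"
    "\<And>i T. Suc i < r \<Longrightarrow> T \<in> S \<Longrightarrow> g \<otimes> \<rho> (i, T) = \<rho> (Suc i, T)"
    "\<And>i T. Suc i = r \<Longrightarrow> T \<in> S \<Longrightarrow> g \<otimes> \<rho> (i, T) = g [^] r \<otimes> \<rho> (0, T)"
    by (rule transversal_stepped_by[OF A fin g]) (rule that)
  define I where "I = {..<r} \<times> S"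
  have I: "finite I" using r(2) by (simp add: I_def)
  have "0 < card A" using finite_subset[OF N.subset fin] N.subgroup_axioms subgroup.one_closed by (auto simp: card_gt_0_iff)
  moreover have "order G = card A * card I"
    using bij_betw_same_card[OF r(5)] by (simp add: order_def I_def card_cartesian_product)
  ultimately have mI: "card I = m" using m by (simp add: mult.commute)
  then have mr: "r * card S = m" by (simp add: I_def card_cartesian_product)
  obtain d \<alpha> where d: "crossed_hom A d"
    "\<And>x. x \<in> carrier G \<Longrightarrow> d x = finprod (G\<lparr>carrier := A\<rparr>) (\<alpha> x) I"
    "\<And>x p a q. x \<in> carrier G \<Longrightarrow> p \<in> I \<Longrightarrow> a \<in> A \<Longrightarrow> q \<in> I \<Longrightarrow> x \<otimes> \<rho> p = a \<otimes> \<rho> q \<Longrightarrow> \<alpha> x p = a"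
    by (rule crossed_hom_transversal[OF A cA I r(4)[folded I_def] r(5)[folded I_def]]) (rule that)
  have "d a = a [^] m" if a: "a \<in> A" for a
  proof -
    have ac: "a \<in> carrier G" using a N.subset by auto
    have "d a = finprod (G\<lparr>carrier := A\<rparr>) (\<lambda>_. a) I"
      unfolding d(2)[OF ac] by (rule A.finprod_cong') (use d(3)[OF ac _ a] a in auto)
    also have "\<dots> = a [^] m" using A.finprod_const[of a I] a by (simp add: mI flip: nat_pow_consistent)
    finally show ?thesis .
  qed
  moreover have "d g = g [^] m"
  proof -
    have 1: "\<alpha> g (i, T) = \<one>" if "Suc i < r" "T \<in> S" for i T
      by (rule d(3)[OF g, of _ _ "(Suc i, T)"]) (use that r(4) r(6)[OF that] in \<open>auto simp: I_def Pi_iff\<close>)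
    have 2: "\<alpha> g (i, T) = g [^] r" if "Suc i = r" "T \<in> S" for i T
      by (rule d(3)[OF g, of _ _ "(0, T)"]) (use that r(1,3) r(7)[OF that] in \<open>auto simp: I_def\<close>)
    have "d g = finprod (G\<lparr>carrier := A\<rparr>) (\<lambda>_. g [^] r) ({r - 1} \<times> S)"
      unfolding d(2)[OF g]
    proof (rule A.finprod_mono_neutral_cong_right)
      show "\<alpha> g \<in> I \<rightarrow> carrier (G\<lparr>carrier := A\<rparr>)"
      proof
        fix p assume "p \<in> I"
        then obtain i T where p: "p = (i, T)" "i < r" "T \<in> S" by (auto simp: I_def)
        then show "\<alpha> g p \<in> carrier (G\<lparr>carrier := A\<rparr>)"
          using 1[of i T] 2[of i T] r(3) by (cases "Suc i = r") auto
      qed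
      show "\<alpha> g p = \<one>\<^bsub>G\<lparr>carrier := A\<rparr>\<^esub>" if "p \<in> I - {r - 1} \<times> S" for p
      proof -
        obtain i T where "p = (i, T)" "Suc i < r" "T \<in> S"
          using \<open>p \<in> I - {r - 1} \<times> S\<close> r(1) by (cases p) (auto simp: I_def)
        then show ?thesis using 1 by simp
      qed
      show "\<alpha> g p = g [^] r" if "p \<in> {r - 1} \<times> S" for p
        using that 2 r(1) by auto
    qed (use I r(1) in \<open>auto simp: I_def\<close>)
    also have "\<dots> = (g [^] r) [^] card S"
      using A.finprod_const[of "g [^] r" "{r - 1} \<times> S"] r(3) by (simp add: card_cartesian_product flip: nat_pow_consistent)
    also have "\<dots> = g [^] m" using g mr by (simp add: nat_pow_pow)
    finally show ?thesis .
  qed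
  ultimately show ?thesis using that d(1) by blast
qed

text \<open>\<open>auto\<close> consists of extensional maps, hence the \<open>restrict\<close>;
  finiteness upgrades injectivity to bijectivity.\<close>

lemma restrict_mem_auto:
  assumes fin: "finite (carrier G)" and \<phi>: "\<phi> \<in> carrier G \<rightarrow> carrier G"
    and mult: "\<And>x y. x \<in> carrier G \<Longrightarrow> y \<in> carrier G \<Longrightarrow> \<phi> (x \<otimes> y) = \<phi> x \<otimes> \<phi> y"
    and ker: "\<And>x. x \<in> carrier G \<Longrightarrow> \<phi> x = \<one> \<Longrightarrow> x = \<one>"
  shows "restrict \<phi> (carrier G) \<in> auto G"
proof -
  interpret h: group_hom G G \<phi>
    by unfold_locales (use \<phi> mult in \<open>auto simp: hom_def\<close>)
  have "inj_on \<phi> (carrier G)"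
    using ker by (subst h.inj_on_one_iff) auto
  then have "bij_betw \<phi> (carrier G) (carrier G)"
    using \<phi> fin by (simp add: bij_betw_def endo_inj_surj image_subset_iff_funcset)
  then have "bij_betw (restrict \<phi> (carrier G)) (carrier G) (carrier G)"
    by (simp cong: bij_betw_cong)
  then show ?thesis
    using \<phi> mult by (auto simp: auto_def Bij_def hom_def)
qed

text \<open>The crossed identity makes \<open>d x [^] j \<otimes> x\<close> multiplicative in
  \<open>x\<close>. A kernel element is the inverse of \<open>d x [^] j\<close>, so it lies in
  \<open>A\<close>, where the map raises to the power \<open>1 + j * m\<close>; coprimality to
  \<open>card A\<close> makes it trivial.\<close>

lemma auto_power_exists:
  assumes A: "A \<lhd> G" and comm: "\<And>a b. a \<in> A \<Longrightarrow> b \<in> A \<Longrightarrow> a \<otimes> b = b \<otimes> a"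
    and fin: "finite (carrier G)" and g: "g \<in> carrier G" and m: "order G = m * card A"
    and cop: "coprime (1 + j * m) (card A)"
  shows "\<exists>\<phi>\<in>auto G. \<phi> g = g [^] (1 + j * m)"
proof -
  interpret N: normal A G by fact
  obtain d where d: "crossed_hom A d" "\<And>a. a \<in> A \<Longrightarrow> d a = a [^] m" "d g = g [^] m"
    using crossed_hom_power[OF A comm fin g m] by blast
  have dA: "d x \<in> A" if "x \<in> carrier G" for x using d(1) that by (auto simp: crossed_hom_def)
  then have dc[simp]: "d x \<in> carrier G" if "x \<in> carrier G" for x using that N.subset by auto
  define \<phi> where "\<phi> x = d x [^] j \<otimes> x" for x
  have e: "\<phi> x = x [^] (1 + j * m)" if "d x = x [^] m" "x \<in> carrier G" for x
    using that by (simp add: \<phi>_def nat_pow_pow mult.commute)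
  have "restrict \<phi> (carrier G) \<in> auto G"
  proof (rule restrict_mem_auto[OF fin])
    show "\<phi> \<in> carrier G \<rightarrow> carrier G" by (auto simp: \<phi>_def)
    show "\<phi> (x \<otimes> y) = \<phi> x \<otimes> \<phi> y" if x: "x \<in> carrier G" and y: "y \<in> carrier G" for x y
    proof -
      have xA: "x \<otimes> d y \<otimes> inv x \<in> A" using dA[OF y] x by (rule N.inv_op_closed2[rotated])
      have "\<phi> (x \<otimes> y) = (d x \<otimes> (x \<otimes> d y \<otimes> inv x)) [^] j \<otimes> (x \<otimes> y)"
        using d(1) x y by (simp add: \<phi>_def crossed_hom_def)
      also have "(d x \<otimes> (x \<otimes> d y \<otimes> inv x)) [^] j = d x [^] j \<otimes> (x \<otimes> d y \<otimes> inv x) [^] j"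
        using x y dA[OF x] xA by (intro pow_mult_distrib comm) auto
      also have "(x \<otimes> d y \<otimes> inv x) [^] j = x \<otimes> d y [^] j \<otimes> inv x"
        using x y by (simp add: conj_pow)
      finally show ?thesis using x y by (simp add: \<phi>_def m_assoc)
    qed
    show "x = \<one>" if x: "x \<in> carrier G" and 1: "\<phi> x = \<one>" for x
    proof -
      have "x = inv (d x [^] j)" using 1 x by (metis \<phi>_def dc inv_comm inv_equality nat_pow_closed)
      then have xA: "x \<in> A" using dA[OF x] by (metis N.m_inv_closed N.subgroup_axioms int_pow_int subgroup_int_pow_closed)
      then have "x [^] (1 + j * m) = \<one>" using e d(2) x 1 by simp
      then have "ord x dvd 1 + j * m" using x pow_eq_id by blast
      moreover have "ord x dvd card A"
      proof -
        have "x [^] card A = \<one>"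
          using group.pow_order_eq_1[OF subgroup_imp_group[OF N.subgroup_axioms], of x] xA
          by (simp add: order_def flip: nat_pow_consistent)
        then show ?thesis using x pow_eq_id by blast
      qed
      ultimately have "ord x = 1" using cop by (metis coprime_common_divisor_nat)
      then show ?thesis using x ord_eq_1 by blast
    qed
  qed
  moreover have "restrict \<phi> (carrier G) g = g [^] (1 + j * m)" using e[OF d(3) g] g by simp
  ultimately show ?thesis by blast
qed

end

section \<open>Exponents of the form \<open>1 + j * m\<close> with prescribed residue and
  coprimality\<close>

text \<open>A prime factor of \<open>c\<close> that divides \<open>a\<close> divides neither
  \<open>b\<close> nor \<open>l\<close>; one that does not divide \<open>a\<close> divides
  \<open>l\<close>. In both cases it misses \<open>a + l * b\<close>. This elementary choice
  replaces an appeal to primes in arithmetic progressions.\<close>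

lemma exists_coprime_shift:
  fixes a b c :: nat
  assumes "coprime a b" "c > 0"
  shows "\<exists>l. coprime (a + l * b) c"
proof
  define l where "l = \<Prod>{p \<in> prime_factors c. \<not> p dvd a}"
  show "coprime (a + l * b) c"
  proof (rule ccontr)
    assume "\<not> coprime (a + l * b) c"
    then have "gcd (a + l * b) c \<noteq> 1" by (simp add: coprime_iff_gcd_eq_1)
    then obtain q where "prime q" "q dvd gcd (a + l * b) c" using prime_factor_nat by blast
    then have q: "prime q" "q dvd a + l * b" "q dvd c" by auto
    have fin: "finite {p \<in> prime_factors c. \<not> p dvd a}" by simp
    have l: "q dvd l \<longleftrightarrow> \<not> q dvd a"
    proof
      assume "q dvd l"
      then obtain p where "p \<in> prime_factors c" "\<not> p dvd a" "q dvd p"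
        unfolding l_def using prime_dvd_prod_iff[OF fin q(1), of "\<lambda>p. p"] by auto
      then show "\<not> q dvd a" using q(1) by (metis in_prime_factors_imp_prime primes_dvd_imp_eq)
    next
      assume "\<not> q dvd a"
      then have "q \<in> {p \<in> prime_factors c. \<not> p dvd a}" using q assms(2) by (simp add: in_prime_factors_iff)
      then show "q dvd l" unfolding l_def using dvd_prodI[OF fin, of q "\<lambda>p. p"] by simp
    qed
    have "\<not> (q dvd a \<and> q dvd b)" using assms(1) q(1) by (metis coprime_common_divisor_nat not_prime_1)
    moreover have "q dvd l * b \<longleftrightarrow> q dvd l \<or> q dvd b" using q(1) by (rule prime_dvd_mult_iff)
    ultimately show False
      using q(2) l by (cases "q dvd a") (auto simp: dvd_add_right_iff dvd_add_left_iff)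
  qed
qed

text \<open>A solution \<open>e\<close> of the congruence is coprime to \<open>n\<close> because
  \<open>k\<close> is, and to \<open>m\<close> by its form. Shifting it by multiples of
  \<open>m * n\<close> therefore achieves coprimality to \<open>c\<close> and preserves both its
  residue modulo \<open>n\<close> and its form.\<close>

lemma exists_coprime_cong:
  fixes k m n c :: nat
  assumes "coprime k n" "[k = 1] (mod gcd m n)" "m > 0" "n > 0" "c > 0"
  shows "\<exists>j. [1 + j * m = k] (mod n) \<and> coprime (1 + j * m) c"
proof -
  \<comment> \<open>Adding \<open>n\<close> makes the representative positive, so
    \<open>k1 - 1\<close> does not truncate.\<close>
  define k1 where "k1 = k + n"
  have k1: "k1 > 0" "[k1 = k] (mod n)"
    using assms by (auto simp: k1_def cong_def)
  then have "coprime k1 n" using assms(1) by (metis cong_imp_coprime cong_sym)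
  have "[k1 = 1] (mod gcd m n)"
    using cong_trans[OF cong_dvd_modulus_nat[OF k1(2), of "gcd m n"] assms(2)] by simp
  then have "gcd m n dvd k1 - 1" using k1(1) by (simp add: cong_altdef_nat)
  then obtain t where t: "k1 - 1 = gcd m n * t" by blast
  obtain x where x: "[m * x = gcd m n] (mod n)" using cong_solve_nat assms(3) by blast
  define e where "e = 1 + (x * t) * m"
  have "[m * x * t = gcd m n * t] (mod n)" using x by (rule cong_scalar_right)
  then have "[1 + m * x * t = 1 + (k1 - 1)] (mod n)" unfolding t by (rule cong_add[OF cong_refl])
  then have en: "[e = k1] (mod n)" using k1(1) by (simp add: e_def ac_simps)
  then have "coprime e n" using \<open>coprime k1 n\<close> by (metis cong_imp_coprime cong_sym)
  moreover have "coprime e m" unfolding e_def by (metis coprime_1_left gcd_add_mult coprime_iff_gcd_eq_1 add.commute gcd.commute)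
  ultimately have "coprime e (m * n)" by simp
  then obtain l where l: "coprime (e + l * (m * n)) c" using exists_coprime_shift assms(5) by blast
  have eq: "e + l * (m * n) = 1 + (x * t + l * n) * m" by (simp add: e_def algebra_simps)
  have "[e + l * (m * n) = e] (mod n)" by (simp add: cong_def flip: mult.assoc)
  then have "[1 + (x * t + l * n) * m = k] (mod n)"
    unfolding eq using en k1(2) cong_trans by blast
  then show ?thesis using l eq by metis
qed

section \<open>Reduction of the theorem to single elements\<close>

context group
begin

definition power_good :: "'a \<Rightarrow> bool"
  where "power_good g \<longleftrightarrow> (\<forall>k::nat. coprime k (ord g) \<longrightarrow> (\<exists>\<phi>\<in>auto G. \<phi> g = g [^] k \<or> \<phi> g = inv (g [^] k)))"

text \<open>The two relations coincide, so nothing has to be counted. If \<open>\<phi>\<close> takes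
  the cyclic group of \<open>h\<close> to that of \<open>g\<close>, then \<open>g\<close> is a power
  of \<open>\<phi> h\<close> with exponent prime to its order; the automorphism that goodness
  supplies for \<open>\<phi> h\<close>, composed with \<open>\<phi>\<close>, takes \<open>h\<close>
  or its inverse to \<open>g\<close>.\<close>

lemma Aut_class_defect_zeroI:
  assumes fin: "finite (carrier G)" and good: "\<And>g. g \<in> carrier G \<Longrightarrow> power_good g"
  shows "Aut_class_defect G = 0"
proof -
  have gen_img: "\<phi> ` generate G {h} = generate G {\<phi> h}" if "\<phi> \<in> auto G" "h \<in> carrier G" for \<phi> h
  proof -
    interpret h: group_hom G G \<phi>
      using that by unfold_locales (auto simp: auto_def)
    show ?thesis using h.generate_img[of "{h}"] that by simp
  qed
  have gen_inv: "generate G {inv h} = generate G {h}" if "h \<in> carrier G" for h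
  proof
    have "inv h \<in> generate G {h}" "h \<in> generate G {inv h}"
      using generate.inv[of h "{h}" G] generate.inv[of "inv h" "{inv h}" G] that by auto
    then show "generate G {inv h} \<subseteq> generate G {h}" "generate G {h} \<subseteq> generate G {inv h}"
      using generate_subgroup_incl generate_is_subgroup that by auto
  qed
  have "(\<exists>\<phi>\<in>auto G. g = \<phi> h) \<or> (\<exists>\<phi>\<in>auto G. g = \<phi> (inv h)) \<longleftrightarrow>
      (\<exists>\<phi>\<in>auto G. generate G {g} = \<phi> ` generate G {h})"
    if gh: "g \<in> carrier G" "h \<in> carrier G" for g h
  proof
    assume "(\<exists>\<phi>\<in>auto G. g = \<phi> h) \<or> (\<exists>\<phi>\<in>auto G. g = \<phi> (inv h))"
    then obtain \<phi> where "\<phi> \<in> auto G" "g = \<phi> h \<or> g = inv (\<phi> h)" using gh by (auto simp: auto_inv)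
    then show "\<exists>\<phi>\<in>auto G. generate G {g} = \<phi> ` generate G {h}"
      using gh gen_img gen_inv by (metis auto_closed)
  next
    assume "\<exists>\<phi>\<in>auto G. generate G {g} = \<phi> ` generate G {h}"
    then obtain \<phi> where \<phi>: "\<phi> \<in> auto G" and "generate G {g} = \<phi> ` generate G {h}" by blast
    then have eq: "generate G {g} = generate G {\<phi> h}" using gen_img[OF \<phi> gh(2)] by simp
    define x where "x = \<phi> h"
    have x: "x \<in> carrier G" using gh \<phi> auto_closed by (simp add: x_def)
    have "g \<in> generate G {x}" using generate.incl[of g "{g}" G] eq by (simp add: x_def)
    then obtain k :: nat where k: "g = x [^] k"
      using generate_pow_on_finite_carrier[OF fin x] by auto
    have "ord (x [^] k) = ord x"
      using eq gh x generate_pow_card[OF gh(1)] generate_pow_card[OF x] k by (simp add: x_def)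
    then have "coprime k (ord x)"
      using ord_ge_1[OF fin x] ord_pow_gen[OF x, of k]
      by (auto simp: coprime_iff_gcd_eq_1 gcd.commute div_eq_dividend_iff split: if_splits)
    then obtain \<psi> where \<psi>: "\<psi> \<in> auto G" "\<psi> x = x [^] k \<or> \<psi> x = inv (x [^] k)"
      using good[OF x] by (auto simp: power_good_def)
    obtain \<chi> where "\<chi> \<in> auto G" "\<And>y. y \<in> carrier G \<Longrightarrow> \<chi> y = \<psi> (\<phi> y)"
      using auto_compose[OF \<psi>(1) \<phi>] by blast
    then have "g = \<chi> h \<or> g = \<chi> (inv h)" using \<psi> gh k x \<phi> by (auto simp: x_def auto_inv auto_closed)
    then show "(\<exists>\<phi>\<in>auto G. g = \<phi> h) \<or> (\<exists>\<phi>\<in>auto G. g = \<phi> (inv h))"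
      using \<open>\<chi> \<in> auto G\<close> by blast
  qed
  then have "R_Aut_conj G = Q_Aut_conj G"
    unfolding R_Aut_conj_def Q_Aut_conj_def mem_Aut_orbit_iff mem_Aut_orbit_set_iff
    by (simp cong: conj_cong)
  then show ?thesis by (simp add: Aut_class_defect_def)
qed

lemma pow_eq_of_cong:
  fixes i j :: nat
  assumes "[i = j] (mod ord x)" "x \<in> carrier G"
  shows "x [^] i = x [^] j"
proof -
  have "[int j = int i] (mod int (ord x))" using assms(1) by (simp add: cong_int_iff cong_sym)
  then have "x [^] int i = x [^] int j" using assms(2) by (simp add: int_pow_eq cong_iff_dvd_diff)
  then show ?thesis by (simp add: int_pow_int)
qed

text \<open>An exponent prime to \<open>ord g\<close> is attained by an automorphism as soon as it
  is 1 modulo \<open>gcd m (ord g)\<close>. The five values in \<open>idx\<close> are the moduli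
  whose only units are 1 and -1, so k or -k qualifies.\<close>

lemma power_good_of_index:
  assumes A: "A \<lhd> G" and comm: "\<And>a b. a \<in> A \<Longrightarrow> b \<in> A \<Longrightarrow> a \<otimes> b = b \<otimes> a"
    and fin: "finite (carrier G)" and g: "g \<in> carrier G" and m: "order G = m * card A"
    and idx: "gcd m (ord g) \<in> {1, 2, 3, 4, 6}"
  shows "power_good g"
  unfolding power_good_def
proof (intro allI impI)
  fix k :: nat assume k: "coprime k (ord g)"
  define n where "n = ord g"
  have n: "n > 0" using ord_ge_1[OF fin g] by (simp add: n_def)
  have "order G > 0" using fin by (simp add: order_gt_0_iff_finite)
  then have pos: "m > 0" "card A > 0" using m by auto
  have hit: "\<exists>\<phi>\<in>auto G. \<phi> g = g [^] k'" if "coprime k' n" "[k' = 1] (mod gcd m n)" for k' :: nat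
  proof -
    obtain j where j: "[1 + j * m = k'] (mod n)" "coprime (1 + j * m) (card A)"
      using exists_coprime_cong[OF \<open>coprime k' n\<close> \<open>[k' = 1] (mod gcd m n)\<close> pos(1) n pos(2)] by blast
    moreover have "g [^] (1 + j * m) = g [^] k'"
      using j(1) g pow_eq_of_cong[of "1 + j * m" k' g] by (simp only: n_def)
    ultimately show ?thesis using auto_power_exists[OF A comm fin g m j(2)] by auto
  qed
  \<comment> \<open>\<open>k'\<close> represents -k modulo \<open>n\<close>; the subtraction does
    not truncate because \<open>n\<close> is positive.\<close>
  define k' where "k' = n * k - k"
  have kk: "k' + k = n * k" using n by (simp add: k'_def)
  have inv: "g [^] k' = inv (g [^] k)"
  proof -
    have "g [^] k' \<otimes> g [^] k = \<one>" using g kk by (simp add: nat_pow_mult) (simp add: n_def flip: nat_pow_pow)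
    then show ?thesis using g by (simp add: inv_equality)
  qed
  have k'n: "coprime k' n"
  proof (rule coprimeI)
    fix d assume "d dvd k'" "d dvd n"
    then have "d dvd k" using kk by (metis dvd_add_right_iff dvd_mult2)
    then show "is_unit d" using \<open>d dvd n\<close> k by (metis coprime_common_divisor n_def)
  qed
  have "[k = 1] (mod gcd m n) \<or> [k' = 1] (mod gcd m n)"
  proof -
    define d where "d = gcd m n"
    have "coprime k d" using k by (metis coprime_divisors d_def dvd_refl gcd_dvd2 n_def)
    have "d dvd k' + k" unfolding kk by (simp add: d_def)
    have np: "\<not> p dvd k" if "p dvd d" "p \<noteq> 1" for p
      using \<open>coprime k d\<close> that by (metis coprime_common_divisor_nat)
    have "d \<in> {1, 2, 3, 4, 6}" using idx by (simp add: d_def n_def)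
    then have "k mod d = 1 mod d \<or> k' mod d = 1 mod d"
      using \<open>d dvd k' + k\<close> np[of 2] np[of 3] by (elim insertE emptyE; simp; presburger)
    then show ?thesis by (simp add: cong_def d_def)
  qed
  then show "\<exists>\<phi>\<in>auto G. \<phi> g = g [^] k \<or> \<phi> g = inv (g [^] k)"
    using hit[of k] hit[of k'] k k'n inv by (auto simp: n_def)
qed

end

section \<open>Cyclic subgroups and their normalisers\<close>

text \<open>The cycles of \<open>f\<close> have length dividing \<open>p ^ k\<close>, so those of
  moved points have length divisible by \<open>p\<close>. The induction removes the cycle
  \<open>Y\<close> of one moved point; its complement is again invariant.\<close>

lemma card_fixpoints_cong:
  assumes "finite X" "f ` X \<subseteq> X" "\<And>x. x \<in> X \<Longrightarrow> (f ^^ (p ^ k)) x = x" "prime p"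
  shows "[card {x \<in> X. f x = x} = card X] (mod p)"
  using assms(1-3)
proof (induction X rule: finite_psubset_induct)
  case (psubset X)
  show ?case
  proof (cases "\<forall>x\<in>X. f x = x")
    case True
    then have "{x \<in> X. f x = x} = X" by auto
    then show ?thesis by simp
  next
    case False
    then obtain x where x: "x \<in> X" "f x \<noteq> x" by blast
    have pk: "p ^ k > 0" using assms(4) prime_gt_0_nat by simp
    define d where "d = (LEAST d. 0 < d \<and> (f ^^ d) x = x)"
    have d: "0 < d" "(f ^^ d) x = x"
      using LeastI[of "\<lambda>d. 0 < d \<and> (f ^^ d) x = x" "p ^ k"] psubset.prems(2)[OF x(1)] pk by (auto simp: d_def)
    have min: "\<not> (0 < i \<and> (f ^^ i) x = x)" if "i < d" for i
      using not_less_Least that unfolding d_def by blast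
    \<comment> \<open>Travelling round a cycle of length \<open>d\<close>: after i + j steps, d - i
      more steps end where j steps end.\<close>
    have shift: "(f ^^ (d - i)) ((f ^^ (i + j)) x) = (f ^^ j) x" if "i \<le> d" for i j
    proof -
      have "(f ^^ (d - i)) ((f ^^ (i + j)) x) = (f ^^ (j + d)) x"
        using that by (simp flip: funpow_add[THEN fun_cong, unfolded o_apply]) (simp add: add.commute)
      then show ?thesis using d(2) by (simp add: funpow_add)
    qed
    define Y where "Y = (\<lambda>i. (f ^^ i) x) ` {..<d}"
    have "inj_on (\<lambda>i. (f ^^ i) x) {..<d}"
    proof (rule inj_onI)
      have "False" if "i < j" "j < d" "(f ^^ i) x = (f ^^ j) x" for i j
      proof -
        have "(f ^^ (d - j)) ((f ^^ i) x) = x" using shift[of j 0] that by simp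
        then have "(f ^^ (d - j + i)) x = x" by (simp add: funpow_add)
        then show False using min[of "d - j + i"] that(1,2) by linarith
      qed
      then show "i = j" if "i \<in> {..<d}" "j \<in> {..<d}" "(f ^^ i) x = (f ^^ j) x" for i j
        using that by (metis lessThan_iff nat_neq_iff)
    qed
    then have cY: "card Y = d" by (simp add: Y_def card_image)
    have fY: "f y \<in> Y" if "y \<in> Y" for y
    proof -
      obtain i where i: "i < d" "y = (f ^^ i) x" using \<open>y \<in> Y\<close> by (auto simp: Y_def)
      then have fy: "f y = (f ^^ Suc i) x" by simp
      show ?thesis
      proof (cases "Suc i = d")
        case True
        have "f y = (f ^^ 0) x" by (simp add: fy[unfolded True] d(2))
        then show ?thesis unfolding Y_def using d(1) by blast
      next
        case False
        then show ?thesis unfolding Y_def using fy i(1) by (metis imageI lessThan_iff Suc_lessI)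
      qed
    qed
    then have fnY: "(f ^^ i) y \<in> Y" if "y \<in> Y" for i y using that by (induction i) auto
    have xX: "(f ^^ i) x \<in> X" for i using psubset.prems(1) x(1) by (induction i) auto
    then have YX: "Y \<subseteq> X" by (auto simp: Y_def)
    have inv: "f ` (X - Y) \<subseteq> X - Y"
    proof clarsimp
      fix y assume y: "y \<in> X" "y \<notin> Y"
      have "f y \<notin> Y"
      proof
        assume "f y \<in> Y"
        \<comment> \<open>\<open>p ^ k - 1\<close> iterations invert \<open>f\<close> on
          \<open>X\<close>, so a point sent into \<open>Y\<close> was already in
          \<open>Y\<close>.\<close>
        then have "(f ^^ (p ^ k - 1)) (f y) \<in> Y" by (rule fnY)
        moreover have "(f ^^ (p ^ k - 1)) (f y) = y"
          using psubset.prems(2)[OF y(1)] pk by (metis Suc_diff_1 funpow_Suc_right o_apply)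
        ultimately show False using y by simp
      qed
      moreover have "f y \<in> X" using psubset.prems(1) y(1) by blast
      ultimately show "f y \<in> X \<and> f y \<notin> Y" by blast
    qed
    have "d dvd p ^ k"
    proof -
      have it: "(f ^^ (d * q)) x = x" for q by (induction q) (simp_all add: funpow_add d(2))
      have "(f ^^ (p ^ k mod d + d * (p ^ k div d))) x = x" using psubset.prems(2)[OF x(1)] by simp
      then have "(f ^^ (p ^ k mod d)) x = x" using it by (simp only: funpow_add o_apply)
      then have "p ^ k mod d = 0" using min[of "p ^ k mod d"] d(1) by simp
      then show ?thesis by auto
    qed
    then obtain i where "d = p ^ i" using divides_primepow_nat[OF assms(4)] by blast
    moreover have "d \<noteq> 1" using d(2) x(2) by auto
    ultimately have pd: "p dvd d" by (metis dvd_power power_0 gr0I)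
    have "Y \<noteq> {}" using d(1) by (auto simp: Y_def)
    then have "X - Y \<subset> X" using YX by auto
    then have IH: "[card {y \<in> X - Y. f y = y} = card (X - Y)] (mod p)"
      using psubset.IH[of "X - Y"] inv psubset.prems(2) by auto
    have "f y \<noteq> y" if "y \<in> Y" for y
    proof
      assume fy: "f y = y"
      obtain i where i: "i < d" "y = (f ^^ i) x" using \<open>y \<in> Y\<close> by (auto simp: Y_def)
      then have "f x = x" using shift[of i 0] shift[of i 1] fy by simp
      then show False using x by simp
    qed
    then have "{y \<in> X - Y. f y = y} = {y \<in> X. f y = y}" by auto
    moreover have "card X = card (X - Y) + d"
      using YX psubset.hyps cY by (metis card_Diff_subset card_mono finite_subset le_add_diff_inverse2)
    moreover have "[card (X - Y) + 0 = card (X - Y) + d] (mod p)"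
      using pd by (intro cong_add cong_refl) (simp add: cong_def)
    ultimately show ?thesis using IH by (simp add: cong_trans)
  qed
qed

locale finite_group = group +
  assumes fin: "finite (carrier G)"
begin

text \<open>This is the normaliser of \<open>generate G {g}\<close>: a condition on the generator
  passes to all its powers, and finiteness turns inclusion of the conjugate subgroup into
  equality.\<close>

definition cyclic_normalizer :: "'a \<Rightarrow> 'a set"
  where "cyclic_normalizer g = {x \<in> carrier G. x \<otimes> g \<otimes> inv x \<in> generate G {g}}"

lemma mem_generate_iff: "g \<in> carrier G \<Longrightarrow> x \<in> generate G {g} \<longleftrightarrow> (\<exists>i::nat. x = g [^] i)"
  using generate_pow_on_finite_carrier[OF fin] by auto

lemma subgroup_generate: "g \<in> carrier G \<Longrightarrow> subgroup (generate G {g}) G"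
  by (rule generate_is_subgroup) simp

lemma generate_pow_closed: "g \<in> carrier G \<Longrightarrow> x \<in> generate G {g} \<Longrightarrow> x [^] (i::nat) \<in> generate G {g}"
  by (auto simp: mem_generate_iff nat_pow_pow)

lemma generate_comm: "g \<in> carrier G \<Longrightarrow> x \<in> generate G {g} \<Longrightarrow> y \<in> generate G {g} \<Longrightarrow> x \<otimes> y = y \<otimes> x"
  by (auto simp: mem_generate_iff nat_pow_mult add.commute)

lemma ord_pos: "g \<in> carrier G \<Longrightarrow> ord g > 0"
  using ord_ge_1[OF fin] by (simp add: Suc_le_eq)

lemma subgroupI_finite:
  assumes "H \<subseteq> carrier G" "H \<noteq> {}" and closed: "\<And>x y. x \<in> H \<Longrightarrow> y \<in> H \<Longrightarrow> x \<otimes> y \<in> H"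
  shows "subgroup H G"
proof (rule subgroupI)
  fix x assume x: "x \<in> H"
  then have xc: "x \<in> carrier G" using assms(1) by auto
  have pow: "x [^] Suc i \<in> H" for i by (induction i) (use x xc closed in auto)
  \<comment> \<open>The exponent is 2 ord x - 1; doubling the order keeps it positive even if
    \<open>ord x = 1\<close>.\<close>
  have "inv x = x [^] Suc (2 * ord x - 2)"
  proof -
    have "x \<otimes> x [^] Suc (2 * ord x - 2) = (x [^] ord x) [^] (2::nat)"
      using ord_pos[OF xc] xc
      by (simp only: nat_pow_pow nat_pow_Suc2[symmetric]) (rule arg_cong[of _ _ "([^]) x"], simp)
    then show ?thesis using xc by (metis inv_equality inv_comm nat_pow_closed nat_pow_one pow_ord_eq_1)
  qed
  then show "inv x \<in> H" using pow by metis
qed (use assms in auto)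

lemma generate_conj_closed:
  assumes "g \<in> carrier G" "x \<in> carrier G" "x \<otimes> g \<otimes> inv x \<in> generate G {g}" "y \<in> generate G {g}"
  shows "x \<otimes> y \<otimes> inv x \<in> generate G {g}"
  using assms(4) generate_pow_closed[OF assms(1,3)] by (auto simp: mem_generate_iff assms(1,2) conj_pow)

lemma subgroup_cyclic_normalizer:
  assumes g: "g \<in> carrier G"
  shows "subgroup (cyclic_normalizer g) G" "generate G {g} \<subseteq> cyclic_normalizer g"
proof -
  show gN: "generate G {g} \<subseteq> cyclic_normalizer g"
  proof
    fix y assume y: "y \<in> generate G {g}"
    have yc: "y \<in> carrier G" using y g subgroup_generate subgroup.mem_carrier by metis
    have "y \<otimes> g \<otimes> inv y = g" using generate_comm[OF g y generate.incl[of g]] g yc by (simp add: m_assoc)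
    then show "y \<in> cyclic_normalizer g" using yc by (simp add: cyclic_normalizer_def generate.incl)
  qed
  show "subgroup (cyclic_normalizer g) G"
  proof (rule subgroupI_finite)
    show "cyclic_normalizer g \<noteq> {}" using gN generate.incl[of g "{g}" G] by auto
    fix x y assume xy: "x \<in> cyclic_normalizer g" "y \<in> cyclic_normalizer g"
    then have c: "x \<in> carrier G" "y \<in> carrier G" by (auto simp: cyclic_normalizer_def)
    have "x \<otimes> (y \<otimes> g \<otimes> inv y) \<otimes> inv x \<in> generate G {g}"
      by (rule generate_conj_closed[OF g c(1)]) (use xy in \<open>auto simp: cyclic_normalizer_def\<close>)
    moreover have "x \<otimes> (y \<otimes> g \<otimes> inv y) \<otimes> inv x = (x \<otimes> y) \<otimes> g \<otimes> inv (x \<otimes> y)"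
      using c g by (simp add: m_assoc inv_mult_group)
    ultimately show "x \<otimes> y \<in> cyclic_normalizer g" using c by (simp add: cyclic_normalizer_def)
  qed (auto simp: cyclic_normalizer_def)
qed

lemma normal_generate_iff:
  assumes g: "g \<in> carrier G"
  shows "generate G {g} \<lhd> G \<longleftrightarrow> cyclic_normalizer g = carrier G"
proof
  assume "generate G {g} \<lhd> G"
  then show "cyclic_normalizer g = carrier G"
    using normal.inv_op_closed2[of "generate G {g}" G _ g] by (auto simp: cyclic_normalizer_def generate.incl)
next
  assume "cyclic_normalizer g = carrier G"
  then have "x \<otimes> g \<otimes> inv x \<in> generate G {g}" if "x \<in> carrier G" for x
    using that by (auto simp: cyclic_normalizer_def)
  then show "generate G {g} \<lhd> G"
    using generate_conj_closed[OF g] by (intro normal_invI subgroup_generate[OF g]) blast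
qed

lemma card_subgroup_pos: "subgroup H G \<Longrightarrow> card H > 0"
  using subgroup.subset subgroup.one_closed fin by (metis card_gt_0_iff empty_iff finite_subset)

lemma subgroup_eq_carrier: "subgroup H G \<Longrightarrow> card H = order G \<Longrightarrow> H = carrier G"
  using card_subset_eq[OF fin, of H] subgroup.subset[of H G] by (simp add: order_def)

lemma card_dvd_of_subgroup_le:
  assumes "subgroup H G" "subgroup K G" "H \<subseteq> K"
  shows "card H dvd card K"
proof -
  have "subgroup H (G\<lparr>carrier := K\<rparr>)" using assms by (simp add: subgroup_incl)
  then show ?thesis
    using group.lagrange[OF subgroup_imp_group[OF assms(2)], of H]
    by (intro dvdI[of _ _ "card (rcosets\<^bsub>G\<lparr>carrier := K\<rparr>\<^esub> H)"]) (simp add: order_def mult.commute)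
qed

text \<open>Right multiplication by \<open>g\<close> fixes the coset C x exactly if x g x^-1 lies in
  C, that is, if x normalises C. So the index f of C in its normaliser counts the fixed points, on m
  cosets, of a map whose \<open>p ^ k\<close>-th iterate is the identity.\<close>

lemma index_cyclic_normalizer_cong:
  assumes g: "g \<in> carrier G" and p: "prime p" and ord: "ord g = p ^ k" and m: "order G = m * ord g"
  obtains f where "card (cyclic_normalizer g) = f * ord g" "f dvd m" "[f = m] (mod p)"
proof -
  define C where "C = generate G {g}"
  define N where "N = cyclic_normalizer g"
  have C: "subgroup C G" "C \<subseteq> N" and N: "subgroup N G"
    using subgroup_generate[OF g] subgroup_cyclic_normalizer[OF g] by (auto simp: C_def N_def)
  have cC: "card C = ord g" using generate_pow_card[OF g] by (simp add: C_def)
  have Cc: "C \<subseteq> carrier G" using C(1) subgroup.subset by blast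
  define F where "F = {C #> x |x. x \<in> N}"
  have "card F * card C = card N"
  proof -
    have "subgroup C (G\<lparr>carrier := N\<rparr>)" using C N by (simp add: subgroup_incl)
    from group.lagrange[OF subgroup_imp_group[OF N] this]
    have "card (rcosets\<^bsub>G\<lparr>carrier := N\<rparr>\<^esub> C) * card C = card N" by (simp add: order_def)
    moreover have "rcosets\<^bsub>G\<lparr>carrier := N\<rparr>\<^esub> C = F" by (auto simp: F_def RCOSETS_def r_coset_def)
    ultimately show ?thesis by simp
  qed
  moreover have "card (rcosets C) = m"
    using lagrange[OF C(1)] m cC ord_pos[OF g] by simp
  moreover have "[card F = card (rcosets C)] (mod p)"
  proof -
    define f where "f T = T #> g" for T
    have fn: "(f ^^ i) T = T #> g [^] i" if "T \<in> rcosets C" for i T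
    proof (induction i)
      case 0
      then show ?case using that C(1) by (auto simp: RCOSETS_def coset_mult_one r_coset_subset_G Cc)
    next
      case (Suc i)
      then show ?case using that g by (auto simp: f_def RCOSETS_def coset_mult_assoc m_assoc Cc)
    qed
    have "F = {T \<in> rcosets C. f T = T}"
    proof -
      have "C #> x #> g = C #> x \<longleftrightarrow> x \<in> N" if x: "x \<in> carrier G" for x
      proof -
        have "C #> x #> g = C #> (x \<otimes> g)" using x g Cc by (simp add: coset_mult_assoc)
        also have "C #> (x \<otimes> g) = C #> x \<longleftrightarrow> x \<otimes> g \<otimes> inv x \<in> C"
          using x g C(1) by (metis Cc coset_mult_inv1 coset_mult_inv2 coset_join1 coset_join2 inv_closed m_closed coset_mult_one r_inv)
        finally show ?thesis using x by (simp add: N_def cyclic_normalizer_def C_def)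
      qed
      moreover have "N \<subseteq> carrier G" using N subgroup.subset by blast
      ultimately show ?thesis by (auto simp: F_def RCOSETS_def f_def)
    qed
    moreover have "[card {T \<in> rcosets C. f T = T} = card (rcosets C)] (mod p)"
    proof (rule card_fixpoints_cong[OF _ _ _ p])
      show "finite (rcosets C)" using fin by (simp add: RCOSETS_def)
      show "f ` (rcosets C) \<subseteq> rcosets C" using g Cc by (auto simp: f_def RCOSETS_def coset_mult_assoc)
      show "(f ^^ (p ^ k)) T = T" if "T \<in> rcosets C" for T
        using fn[OF that, of "p ^ k"] that g Cc by (auto simp: RCOSETS_def coset_mult_one r_coset_subset_G simp flip: ord)
    qed
    ultimately show ?thesis by simp
  qed
  moreover have "card F dvd m"
  proof -
    have "card N dvd order G" using lagrange[OF N] by (metis dvd_triv_right)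
    then have "card F * ord g dvd m * ord g" using calculation(1) cC m by simp
    then show ?thesis using ord_pos[OF g] by simp
  qed
  ultimately show ?thesis using that[of "card F"] cC by (simp add: N_def)
qed

text \<open>For \<open>x\<close> outside C the products g^i x c with i < m and c in C avoid C, so m
  |C| pairs have at most (m - 1) |C| values. Two colliding pairs must have different i, and
  \<open>r\<close> is the difference.\<close>

lemma exists_conj_pow_mem:
  assumes g: "g \<in> carrier G" and x: "x \<in> carrier G" and m: "order G = m * ord g" "m > 1"
  shows "\<exists>r\<in>{1..<m}. inv x \<otimes> g [^] r \<otimes> x \<in> generate G {g}"
proof (cases "x \<in> generate G {g}")
  case True
  then have "inv x \<otimes> g [^] (1::nat) \<otimes> x \<in> generate G {g}"
    using subgroup.m_closed[OF subgroup_generate[OF g]] subgroup.m_inv_closed[OF subgroup_generate[OF g]] g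
    by (simp add: generate.incl)
  then show ?thesis using m by (intro bexI[of _ 1]) auto
next
  case False
  define C where "C = generate G {g}"
  have C: "subgroup C G" "C \<subseteq> carrier G" "finite C" "card C = ord g"
    using subgroup_generate[OF g] subgroup.subset[OF subgroup_generate[OF g]] finite_subset[OF _ fin] generate_pow_card[OF g] by (auto simp: C_def)
  have gC: "g [^] i \<in> C" for i :: nat using g by (auto simp: C_def mem_generate_iff)
  interpret C: subgroup C G by fact
  define h where "h = (\<lambda>(i::nat, c). g [^] i \<otimes> x \<otimes> c)"
  have "h ` ({..<m} \<times> C) \<subseteq> carrier G - C"
  proof (clarsimp simp: h_def)
    fix i :: nat and c assume c: "c \<in> C"
    then have "c \<in> carrier G" using C by auto
    have "g [^] i \<otimes> x \<otimes> c \<notin> C"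
    proof
      assume gxc: "g [^] i \<otimes> x \<otimes> c \<in> C"
      then have "inv (g [^] i) \<otimes> (g [^] i \<otimes> x \<otimes> c) \<otimes> inv c \<in> C"
        using gC c by (intro C.m_closed[OF C.m_closed[OF _ gxc]]) simp_all
      then show False using False g x \<open>c \<in> carrier G\<close> by (simp add: m_assoc C_def)
    qed
    then show "g [^] i \<otimes> x \<otimes> c \<in> carrier G \<and> g [^] i \<otimes> x \<otimes> c \<notin> C" using g x \<open>c \<in> carrier G\<close> by simp
  qed
  then have "card (h ` ({..<m} \<times> C)) \<le> card (carrier G - C)" using fin by (intro card_mono) auto
  also have "\<dots> < card ({..<m} \<times> C)"
    using C m card_subgroup_pos[OF C(1)] by (simp add: card_Diff_subset card_cartesian_product flip: order_def)
  finally have "\<not> inj_on h ({..<m} \<times> C)" by (metis card_image less_irrefl)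
  then obtain i c j d where ij: "i < m" "j < m" "c \<in> C" "d \<in> C" "(i, c) \<noteq> (j, d)"
    "g [^] i \<otimes> x \<otimes> c = g [^] j \<otimes> x \<otimes> d" by (auto simp: inj_on_def h_def)
  have main: "\<exists>r\<in>{1..<m}. inv x \<otimes> g [^] r \<otimes> x \<in> C"
    if "i < j" "j < m" "c \<in> C" "d \<in> C" "g [^] i \<otimes> x \<otimes> c = g [^] j \<otimes> x \<otimes> d" for i j c d
  proof -
    have cd: "c \<in> carrier G" "d \<in> carrier G" using that C by auto
    have "g [^] j = g [^] i \<otimes> g [^] (j - i)" using that g by (simp add: nat_pow_mult)
    then have "g [^] i \<otimes> (x \<otimes> c) = g [^] i \<otimes> (g [^] (j - i) \<otimes> x \<otimes> d)" using that(5) g x cd by (simp add: m_assoc)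
    then have "x \<otimes> c = g [^] (j - i) \<otimes> x \<otimes> d" using g x cd by simp
    then have "inv x \<otimes> g [^] (j - i) \<otimes> x = c \<otimes> inv d"
      using g x cd by (metis inv_closed inv_mult_cancel_left inv_solve_right m_assoc m_closed nat_pow_closed)
    then have "inv x \<otimes> g [^] (j - i) \<otimes> x \<in> C" using that by (simp add: C.m_closed)
    then show ?thesis using that by (intro bexI[of _ "j - i"]) auto
  qed
  have "i \<noteq> j"
  proof
    assume "i = j"
    then have "c = d" using ij C g x by (auto simp: subset_iff)
    then show False using ij \<open>i = j\<close> by simp
  qed
  then show ?thesis using main[of i j c d] main[of j i d c] ij by (auto simp: C_def neq_iff)
qed

text \<open>A conjugate of \<open>g [^] q\<close> inside the cyclic group of \<open>g\<close> has
  the same order as \<open>g [^] q\<close>, so it lies in the only subgroup of that order. Hence it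
  is enough that conjugates land in the larger group.\<close>

lemma normal_generate_pow:
  assumes g: "g \<in> carrier G" and q: "q dvd ord g"
    and conj: "\<And>x. x \<in> carrier G \<Longrightarrow> inv x \<otimes> g [^] q \<otimes> x \<in> generate G {g}"
  shows "generate G {g [^] q} \<lhd> G" "card (generate G {g [^] q}) = ord g div q"
proof -
  have q0: "q > 0" using q ord_pos[OF g] by (auto intro: gr0I)
  then have og: "ord (g [^] q) = ord g div q" using ord_pow[OF g q] by simp
  then show "card (generate G {g [^] q}) = ord g div q" using generate_pow_card[of "g [^] q"] g by simp
  obtain s where s: "ord g = q * s" using q by blast
  show "generate G {g [^] q} \<lhd> G"
  proof (rule normal_invI[OF subgroup_generate])
    fix y h assume y: "y \<in> carrier G" and h: "h \<in> generate G {g [^] q}"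
    obtain i :: nat where i: "y \<otimes> g [^] q \<otimes> inv y = g [^] i"
      using conj[of "inv y"] y mem_generate_iff[OF g] by auto
    have "(g [^] i) [^] s = y \<otimes> (g [^] q) [^] s \<otimes> inv y" using i g y by (simp add: conj_pow)
    also have "\<dots> = \<one>" using g y s by (simp add: nat_pow_pow flip: s)
    finally have "q * s dvd i * s" using g s pow_eq_id[OF g] by (simp add: nat_pow_pow)
    then have "q dvd i" using s ord_pos[OF g] by auto
    then obtain t where "i = q * t" by blast
    then have "y \<otimes> g [^] q \<otimes> inv y = (g [^] q) [^] t" using i g by (simp add: nat_pow_pow)
    then have "y \<otimes> g [^] q \<otimes> inv y \<in> generate G {g [^] q}" using g by (auto simp: mem_generate_iff)
    then show "y \<otimes> h \<otimes> inv y \<in> generate G {g [^] q}" using generate_conj_closed[OF _ y _ h] g by simp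
  qed (use g in simp)
qed

lemma power_good_of_core:
  assumes g: "g \<in> carrier G" and q: "q dvd ord g" and m: "order G = m * ord g"
    and conj: "\<And>x. x \<in> carrier G \<Longrightarrow> inv x \<otimes> g [^] q \<otimes> x \<in> generate G {g}"
    and idx: "gcd (m * q) (ord g) \<in> {1, 2, 3, 4, 6}"
  shows "power_good g"
proof (rule power_good_of_index[OF _ _ fin g _ idx])
  show "generate G {g [^] q} \<lhd> G" using normal_generate_pow(1)[OF g q conj] .
  show "a \<otimes> b = b \<otimes> a" if "a \<in> generate G {g [^] q}" "b \<in> generate G {g [^] q}" for a b
    using generate_comm[of "g [^] q"] that g by simp
  show "order G = m * q * card (generate G {g [^] q})"
    using normal_generate_pow(2)[OF g q conj] m q by simp
qed

text \<open>The exponent r found by pigeonhole depends on the conjugating element. A common multiple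
  \<open>L\<close> of all r < m works for every conjugation, and by Bezout so does
  \<open>gcd L (ord g)\<close>, whose power of \<open>g\<close> generates a normal subgroup.\<close>

lemma power_good_of_lcm:
  assumes g: "g \<in> carrier G" and m: "order G = m * ord g" "m > 1"
    and L: "\<And>r. r \<in> {1..<m} \<Longrightarrow> r dvd L"
    and idx: "gcd (m * gcd L (ord g)) (ord g) \<in> {1, 2, 3, 4, 6}"
  shows "power_good g"
proof (rule power_good_of_core[OF g _ m(1) _ idx])
  fix x assume x: "x \<in> carrier G"
  obtain r where r: "r \<in> {1..<m}" "inv x \<otimes> g [^] r \<otimes> x \<in> generate G {g}"
    using exists_conj_pow_mem[OF g x m] by blast
  obtain s where s: "L = r * s" using L[OF r(1)] by blast
  obtain t where t: "[r * (s * t) = gcd L (ord g)] (mod ord g)"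
    using cong_solve_nat[of L "ord g"] s ord_pos[OF g] by (cases "L = 0") (auto simp: mult.assoc cong_0_iff)
  have "inv x \<otimes> g [^] gcd L (ord g) \<otimes> x = inv x \<otimes> (g [^] r) [^] (s * t) \<otimes> inv (inv x)"
    using pow_eq_of_cong[OF t g] g x by (simp add: nat_pow_pow)
  also have "\<dots> = (inv x \<otimes> g [^] r \<otimes> x) [^] (s * t)"
    using g x conj_pow[of "inv x" "g [^] r" "s * t"] by simp
  finally show "inv x \<otimes> g [^] gcd L (ord g) \<otimes> x \<in> generate G {g}"
    using generate_pow_closed[OF g r(2)] by simp
qed simp

lemma power_good_of_normal:
  assumes g: "g \<in> carrier G" and m: "order G = m * ord g" and "cyclic_normalizer g = carrier G"
    and idx: "gcd m (ord g) \<in> {1, 2, 3, 4, 6}"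
  shows "power_good g"
proof (rule power_good_of_index[OF _ _ fin g _ idx])
  show "generate G {g} \<lhd> G" using normal_generate_iff[OF g] assms(3) by simp
  show "order G = m * card (generate G {g})" using m generate_pow_card[OF g] by simp
qed (use generate_comm g in blast)

section \<open>Subgroups of index two and the automorphisms they provide\<close>

text \<open>By counting, the coset of \<open>inv x\<close> fills all of \<open>N - K\<close>, so
  \<open>y\<close> is \<open>inv x\<close> times an element of \<open>K\<close>.\<close>

lemma mult_mem_of_index_two:
  assumes K: "subgroup K G" and N: "subgroup N G" and "K \<subseteq> N" and card: "card N = 2 * card K"
    and x: "x \<in> N" "x \<notin> K" and y: "y \<in> N" "y \<notin> K"
  shows "x \<otimes> y \<in> K"
proof -
  interpret K: subgroup K G by fact
  interpret N: subgroup N G by fact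
  have xc: "x \<in> carrier G" and yc: "y \<in> carrier G" using x y N.subset by auto
  have finN: "finite N" using finite_subset[OF N.subset fin] .
  have sub: "(\<lambda>a. inv x \<otimes> a) ` K \<subseteq> N - K"
  proof
    fix b assume "b \<in> (\<lambda>a. inv x \<otimes> a) ` K"
    then obtain a where a: "a \<in> K" "b = inv x \<otimes> a" by blast
    have "b \<notin> K"
    proof
      assume "b \<in> K"
      then have "a \<otimes> inv b \<in> K" using a by simp
      moreover have "a \<otimes> inv b = x" using a xc K.subset by (auto simp: inv_mult_group)
      ultimately show False using x by simp
    qed
    moreover have "b \<in> N" using a x assms(3) by auto
    ultimately show "b \<in> N - K" by simp
  qed
  have "inj_on (\<lambda>a. inv x \<otimes> a) K" using xc K.subset by (intro inj_onI) auto
  then have "card ((\<lambda>a. inv x \<otimes> a) ` K) = card (N - K)"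
    using card assms(3) finN finite_subset[OF assms(3) finN] by (simp add: card_image card_Diff_subset)
  then have "(\<lambda>a. inv x \<otimes> a) ` K = N - K" using sub finN by (intro card_subset_eq) auto
  then obtain a where a: "a \<in> K" "y = inv x \<otimes> a" using y by blast
  then show ?thesis using xc by simp
qed

text \<open>For \<open>x\<close> outside \<open>K\<close> both \<open>x \<otimes> h\<close> and
  \<open>inv x\<close> lie outside \<open>K\<close>, so their product lies in
  \<open>K\<close>.\<close>

lemma conj_mem_of_index_two:
  assumes K: "subgroup K G" and N: "subgroup N G" and "K \<subseteq> N" and card: "card N = 2 * card K"
    and x: "x \<in> N" and h: "h \<in> K"
  shows "x \<otimes> h \<otimes> inv x \<in> K"
proof (cases "x \<in> K")
  case True
  then show ?thesis using h K by (simp add: subgroup.m_closed subgroup.m_inv_closed)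
next
  case False
  interpret K: subgroup K G by fact
  interpret N: subgroup N G by fact
  have xc: "x \<in> carrier G" using x N.subset by auto
  have "x \<otimes> h \<notin> K"
  proof
    assume "x \<otimes> h \<in> K"
    then have "(x \<otimes> h) \<otimes> inv h \<in> K" using h by simp
    then show False using False xc K.subset h by (simp add: m_assoc)
  qed
  moreover have "inv x \<notin> K" using False xc K.m_inv_closed by fastforce
  ultimately show ?thesis
    using mult_mem_of_index_two[OF K N assms(3) card, of "x \<otimes> h" "inv x"] x h assms(3) by auto
qed

lemma square_mem_of_index_two:
  assumes K: "subgroup K G" and N: "subgroup N G" and "K \<subseteq> N" and card: "card N = 2 * card K"
    and x: "x \<in> N"
  shows "x \<otimes> x \<in> K"
  using mult_mem_of_index_two[OF assms(1-4) x _ x] x K by (cases "x \<in> K") (auto simp: subgroup.m_closed)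

lemma normal_of_index_two:
  assumes M: "subgroup M G" and card: "order G = 2 * card M"
  shows "M \<lhd> G"
proof (rule normal_invI[OF M])
  have "card (carrier G) = 2 * card M" using card by (simp add: order_def)
  then show "x \<otimes> h \<otimes> inv x \<in> M" if "x \<in> carrier G" "h \<in> M" for x h
    using conj_mem_of_index_two[OF M subgroup_self subgroup.subset[OF M]] that by metis
qed

text \<open>The map is x |-> x z^chi(x), where chi has values 0 and 1 modulo 2 and kernel
  \<open>M\<close>. It is multiplicative since \<open>z\<close> is central with square 1, and its
  kernel is trivial since \<open>z\<close> lies in \<open>M\<close>. It serves where no suitable
  abelian normal subgroup is at hand.\<close>

lemma auto_mult_central_involution:
  assumes M: "subgroup M G" and card: "order G = 2 * card M"
    and z: "z \<in> M" "z \<otimes> z = \<one>" "\<And>x. x \<in> carrier G \<Longrightarrow> z \<otimes> x = x \<otimes> z"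
    and g: "g \<in> carrier G" "g \<notin> M"
  shows "\<exists>\<phi>\<in>auto G. \<phi> g = g \<otimes> z"
proof -
  interpret M: subgroup M G by fact
  have zc: "z \<in> carrier G" using z(1) M.subset by auto
  have zz: "z \<otimes> (z \<otimes> x) = x" if "x \<in> carrier G" for x using that zc z(2) by (simp flip: m_assoc)
  have two: "x \<otimes> y \<in> M" if "x \<in> carrier G" "y \<in> carrier G" "x \<notin> M" "y \<notin> M" for x y
    using mult_mem_of_index_two[OF M subgroup_self M.subset] card that by (simp add: order_def)
  define \<phi> where "\<phi> x = (if x \<in> M then x else x \<otimes> z)" for x
  have "restrict \<phi> (carrier G) \<in> auto G"
  proof (rule restrict_mem_auto[OF fin])
    show "\<phi> \<in> carrier G \<rightarrow> carrier G" using zc by (auto simp: \<phi>_def)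
    show "\<phi> (x \<otimes> y) = \<phi> x \<otimes> \<phi> y" if x: "x \<in> carrier G" and y: "y \<in> carrier G" for x y
    proof (cases "x \<in> M")
      case xM: True
      have iff: "x \<otimes> y \<in> M \<longleftrightarrow> y \<in> M"
      proof
        assume "x \<otimes> y \<in> M"
        then have "inv x \<otimes> (x \<otimes> y) \<in> M" using xM by simp
        then show "y \<in> M" using x y by simp
      qed (use xM in simp)
      then show ?thesis using xM x y zc by (simp add: \<phi>_def m_assoc)
    next
      case xM: False
      show ?thesis
      proof (cases "y \<in> M")
        case True
        have "x \<otimes> y \<notin> M"
        proof
          assume "x \<otimes> y \<in> M"
          then have "(x \<otimes> y) \<otimes> inv y \<in> M" using True by simp
          then show False using xM x y by (simp add: m_assoc)
        qed
        then show ?thesis using xM True x y zc z(3)[OF y] by (simp add: \<phi>_def m_assoc)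
      next
        case False
        have "x \<otimes> z \<otimes> (y \<otimes> z) = x \<otimes> y"
          using x y zc z(3)[OF y] zz by (metis m_assoc m_closed)
        then show ?thesis using two[OF x y xM False] xM False by (simp add: \<phi>_def)
      qed
    qed
    show "x = \<one>" if x: "x \<in> carrier G" "\<phi> x = \<one>" for x
    proof (cases "x \<in> M")
      case False
      then have "x \<otimes> z = \<one>" using x by (simp add: \<phi>_def)
      then have "x = inv z" using x zc by (simp add: inv_equality)
      then show ?thesis using False z(1) by simp
    qed (use x in \<open>simp add: \<phi>_def\<close>)
  qed
  moreover have "restrict \<phi> (carrier G) g = g \<otimes> z" using g by (simp add: \<phi>_def)
  ultimately show ?thesis by blast
qed

lemma auto_conj:
  assumes x: "x \<in> carrier G"
  shows "\<exists>\<phi>\<in>auto G. \<forall>y\<in>carrier G. \<phi> y = x \<otimes> y \<otimes> inv x"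
proof -
  have "restrict (\<lambda>y. x \<otimes> y \<otimes> inv x) (carrier G) \<in> auto G"
  proof (rule restrict_mem_auto[OF fin])
    show "y = \<one>" if "y \<in> carrier G" "x \<otimes> y \<otimes> inv x = \<one>" for y
      using that x conjugation_is_inj[OF x that(1) one_closed] by simp
  qed (use x in \<open>auto simp: conj_mult\<close>)
  then show ?thesis by (intro bexI) auto
qed

lemma finite_group_subgroup: "subgroup K G \<Longrightarrow> finite_group (G\<lparr>carrier := K\<rparr>)"
  using subgroup_imp_group[of K] finite_subset[OF subgroup.subset[of K G] fin]
  by (simp add: finite_group_def finite_group_axioms_def)

lemma ord_subgroup:
  assumes "subgroup K G" "x \<in> K"
  shows "group.ord (G\<lparr>carrier := K\<rparr>) x = ord x"
  using group.generate_pow_card[OF subgroup_imp_group[OF assms(1)], of x]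
    generate_pow_card[of x] assms subgroup.subset[OF assms(1)] by (auto simp: generate_consistent)

text \<open>The index congruence read in the group with carrier \<open>K\<close>; it will exclude
  certain subgroups of order 24 in groups of order 48.\<close>

lemma index_cyclic_normalizer_Int_cong:
  assumes K: "subgroup K G" and g: "g \<in> K" and p: "prime p" "ord g = p ^ k" and m: "card K = m * ord g"
  obtains f where "card (cyclic_normalizer g \<inter> K) = f * ord g" "f dvd m" "[f = m] (mod p)"
proof -
  interpret K: finite_group "G\<lparr>carrier := K\<rparr>" using finite_group_subgroup[OF K] .
  have ordK: "K.ord g = ord g" using ord_subgroup[OF K g] .
  have "K.cyclic_normalizer g = cyclic_normalizer g \<inter> K"
    using subgroup.subset[OF K] g
    by (auto simp: K.cyclic_normalizer_def cyclic_normalizer_def generate_consistent K m_inv_consistent)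
  moreover obtain f where "card (K.cyclic_normalizer g) = f * ord g" "f dvd m" "[f = m] (mod p)"
    by (rule K.index_cyclic_normalizer_cong[of g p k m, unfolded ordK]) (use g p m in \<open>auto simp: order_def\<close>)
  ultimately show ?thesis using that by metis
qed

lemma pow_eq_iff_cong: "x \<in> carrier G \<Longrightarrow> x [^] (i::nat) = x [^] (j::nat) \<longleftrightarrow> [i = j] (mod ord x)"
proof
  assume x: "x \<in> carrier G" and "x [^] i = x [^] j"
  then have "x [^] int i = x [^] int j" by (simp add: int_pow_int)
  then have "int (ord x) dvd int j - int i" using int_pow_eq[OF x] by blast
  then show "[i = j] (mod ord x)" by (metis cong_iff_dvd_diff cong_int_iff cong_sym)
qed (rule pow_eq_of_cong)

lemma conj_pow_exponent:
  fixes e k :: nat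
  assumes x: "x \<in> carrier G" and g: "g \<in> carrier G" and "x \<otimes> g \<otimes> inv x = g [^] e"
  shows "x [^] k \<otimes> g \<otimes> inv (x [^] k) = g [^] (e ^ k)"
proof (induction k)
  case (Suc k)
  have "x [^] Suc k \<otimes> g \<otimes> inv (x [^] Suc k) = x [^] k \<otimes> (x \<otimes> g \<otimes> inv x) \<otimes> inv (x [^] k)"
    using x g by (simp add: m_assoc inv_mult_group)
  also have "\<dots> = (x [^] k \<otimes> g \<otimes> inv (x [^] k)) [^] e"
    unfolding assms(3) using x g by (simp add: conj_pow)
  also have "\<dots> = g [^] (e ^ Suc k)" unfolding Suc using g by (simp add: nat_pow_pow mult.commute)
  finally show ?case .
qed (use g in simp)

text \<open>If \<open>x\<close> acts on the group of \<open>g\<close> by the exponent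
  \<open>e\<close>, then \<open>x [^] k\<close> acts by \<open>e ^ k\<close>. This turns knowledge
  about powers of \<open>x\<close> into a restriction on \<open>e\<close>.\<close>

lemma conj_exponent_cong:
  fixes e k :: nat
  assumes x: "x \<in> carrier G" and g: "g \<in> carrier G" and "x \<otimes> g \<otimes> inv x = g [^] e"
    and "x [^] k \<otimes> g = g \<otimes> x [^] k"
  shows "[e ^ k = 1] (mod ord g)"
proof -
  have "g [^] (e ^ k) = g [^] (1::nat)"
    using conj_pow_exponent[OF assms(1-3), of k] assms(4) x g by (simp add: m_assoc)
  then show ?thesis using pow_eq_iff_cong[OF g] by blast
qed

lemma commute_of_conj:
  assumes "x \<in> carrier G" "g \<in> carrier G" "x \<otimes> g \<otimes> inv x = g"
  shows "x \<otimes> g = g \<otimes> x"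
  using assms by (metis inv_closed inv_inv inv_solve_right' m_closed)

text \<open>For \<open>a\<close> outside \<open>H\<close> the centraliser of \<open>a\<close> in
  \<open>N\<close> contains \<open>H\<close> and \<open>a\<close>; it is strictly larger than
  \<open>H\<close>, and the prime index leaves only \<open>N\<close>.\<close>

lemma commute_of_central_index:
  assumes H: "subgroup H G" and N: "subgroup N G" and "H \<subseteq> N" and p: "prime p" "card N = p * card H"
    and central: "\<And>h x. h \<in> H \<Longrightarrow> x \<in> N \<Longrightarrow> h \<otimes> x = x \<otimes> h"
    and ab: "a \<in> N" "b \<in> N"
  shows "a \<otimes> b = b \<otimes> a"
proof (cases "a \<in> H")
  case False
  interpret N: subgroup N G by fact
  define Z where "Z = {x \<in> N. a \<otimes> x = x \<otimes> a}"
  have HZ: "H \<subseteq> Z"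
  proof
    fix h assume h: "h \<in> H"
    then show "h \<in> Z" using assms(3) central[OF h ab(1)] by (auto simp: Z_def)
  qed
  have Nc: "x \<in> carrier G" if "x \<in> N" for x using that N.subset by auto
  have Z: "subgroup Z G"
  proof (rule subgroupI_finite)
    show "Z \<subseteq> carrier G" using N.subset by (auto simp: Z_def)
    show "Z \<noteq> {}" using ab by (auto simp: Z_def)
    fix x y assume "x \<in> Z" "y \<in> Z"
    then have xy: "x \<in> N" "y \<in> N" "a \<otimes> x = x \<otimes> a" "a \<otimes> y = y \<otimes> a" by (auto simp: Z_def)
    then have "a \<otimes> (x \<otimes> y) = (x \<otimes> y) \<otimes> a" using Nc ab by (metis m_assoc)
    then show "x \<otimes> y \<in> Z" using xy by (simp add: Z_def)
  qed
  have "card H dvd card Z" using card_dvd_of_subgroup_le[OF H Z HZ] .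
  then obtain s where s: "card Z = card H * s" by blast
  have "card Z dvd card N" using card_dvd_of_subgroup_le[OF Z N] by (auto simp: Z_def)
  then have "s dvd p" using s p(2) card_subgroup_pos[OF H] by (simp add: mult.commute)
  moreover have "s \<noteq> 1"
  proof
    assume "s = 1"
    then have "H = Z" using HZ s finite_subset[OF subgroup.subset[OF Z] fin] by (simp add: card_subset_eq)
    then show False using False ab by (auto simp: Z_def)
  qed
  ultimately have "s = p" using p(1) prime_nat_iff by blast
  then have "Z = N" using s p(2) finite_subset[OF N.subset fin] by (intro card_subset_eq) (auto simp: Z_def)
  then show ?thesis using ab by (auto simp: Z_def)
next
  case True
  then show ?thesis using central ab by blast
qed

text \<open>The class equation is replaced by the index congruence: for \<open>a\<close> of order
  \<open>p\<close> it forces \<open>p dvd f\<close>, so the group of \<open>a\<close> is normal. An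
  element acts on it by an exponent e with e^(p^2) = 1 modulo p, and Fermat gives e^(p^2) = e, so e
  = 1 and \<open>a\<close> is central.\<close>

lemma commute_of_order_prime_square:
  assumes p: "prime p" and ord: "order G = p ^ 2" and ab: "a \<in> carrier G" "b \<in> carrier G"
  shows "a \<otimes> b = b \<otimes> a"
proof (cases "a = \<one>")
  case False
  have "ord a dvd p ^ 2" using ord_dvd_group_order[OF ab(1)] ord by simp
  then obtain i where i: "i \<le> 2" "ord a = p ^ i" using divides_primepow_nat[OF p] by blast
  have "i \<noteq> 0" using i False ord_eq_1[OF ab(1)] by (metis power_0)
  then consider "i = 2" | "i = 1" using i by linarith
  then show ?thesis
  proof cases
    case 1
    then have "generate G {a} = carrier G"
      using i ord generate_pow_card[OF ab(1)] subgroup_eq_carrier[OF subgroup_generate[OF ab(1)]] by simp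
    then show ?thesis using generate_comm[OF ab(1)] ab by simp
  next
    case 2
    then have oa: "ord a = p" using i by simp
    have p0: "p > 0" using p prime_gt_0_nat by blast
    obtain f where f: "card (cyclic_normalizer a) = f * ord a" "f dvd p" "[f = p] (mod p)"
      by (rule index_cyclic_normalizer_cong[OF ab(1) p i(2), of p]) (use ord oa in \<open>auto simp: power2_eq_square\<close>)
    have "p dvd f" using f(3) by (simp add: cong_def mod_eq_0_iff_dvd)
    then have "f = p" using f(2) by (simp add: dvd_antisym)
    then have N: "cyclic_normalizer a = carrier G"
      using f(1) oa ord subgroup_eq_carrier[OF subgroup_cyclic_normalizer(1)[OF ab(1)]] by (simp add: power2_eq_square)
    have central: "h \<otimes> x = x \<otimes> h" if h: "h \<in> generate G {a}" and x: "x \<in> carrier G" for h x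
    proof -
      have "x \<otimes> a \<otimes> inv x \<in> generate G {a}" using N x by (auto simp: cyclic_normalizer_def)
      then obtain e :: nat where e: "x \<otimes> a \<otimes> inv x = a [^] e" using mem_generate_iff[OF ab(1)] by blast
      have "x [^] (p * p) = \<one>" using pow_order_eq_1[OF x] ord by (simp add: power2_eq_square)
      then have c: "[e ^ (p * p) = 1] (mod p)"
        using conj_exponent_cong[OF x ab(1) e, of "p * p"] ab oa by simp
      have "\<not> p dvd e"
        using c p0 p by (metis cong_dvd_iff dvd_power dvd_trans dvd_refl is_unit_power_iff nat_0_less_mult_iff nat_dvd_1_iff_1 not_prime_1)
      then have "[e ^ (p - 1) = 1] (mod p)" using fermat_theorem[OF p] by blast
      then have "[(e ^ (p - 1)) ^ (p + 1) = 1 ^ (p + 1)] (mod p)" by (rule cong_pow)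
      then have "[e * (e ^ (p - 1)) ^ (p + 1) = e * 1] (mod p)" by (intro cong_mult cong_refl) simp
      moreover have "e * (e ^ (p - 1)) ^ (p + 1) = e ^ (p * p)"
      proof -
        \<comment> \<open>This splits e^(p^2) into e and a power of e^(p - 1), to which Fermat
          applies.\<close>
        have "1 + (p - 1) * (p + 1) = p * p" using p0 by (cases p) (auto simp: algebra_simps)
        then show ?thesis by (metis power_add power_mult power_one_right)
      qed
      ultimately have "[e = 1] (mod p)" using c by (metis cong_sym cong_trans mult_1_right)
      then have "x \<otimes> a \<otimes> inv x = a" using e pow_eq_of_cong[of e 1 a] oa ab by simp
      then have "x \<otimes> a = a \<otimes> x" using commute_of_conj x ab by blast
      then have xa: "a \<otimes> x = x \<otimes> a" by simp
      obtain j :: nat where j: "h = a [^] j" using h mem_generate_iff[OF ab(1)] by blast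
      show ?thesis unfolding j using group_commutes_pow[OF xa] ab x by simp
    qed
    show ?thesis
    proof (rule commute_of_central_index[OF subgroup_generate[OF ab(1)] subgroup_self _ p])
      show "generate G {a} \<subseteq> carrier G" using generate_incl ab by simp
      show "card (carrier G) = p * card (generate G {a})"
        using generate_pow_card[OF ab(1)] oa ord by (simp add: order_def power2_eq_square)
    qed (use central ab in auto)
  qed
qed (use ab in simp)

section \<open>The exceptional orders\<close>

text \<open>Exponents count modulo \<open>ord g\<close> and up to sign; \<open>[k + e = 0]\<close>
  expresses k = -e within the natural numbers.\<close>

lemma power_goodI:
  assumes "\<And>k. coprime k (ord g) \<Longrightarrow>
    \<exists>e. (\<exists>\<phi>\<in>auto G. \<phi> g = g [^] (e::nat)) \<and> ([k = e] (mod ord g) \<or> [k + e = 0] (mod ord g))"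
    and g: "g \<in> carrier G"
  shows "power_good g"
  unfolding power_good_def
proof (intro allI impI)
  fix k :: nat assume "coprime k (ord g)"
  then obtain e \<phi> where \<phi>: "\<phi> \<in> auto G" "\<phi> g = g [^] e" and e: "[k = e] (mod ord g) \<or> [k + e = 0] (mod ord g)"
    using assms(1) by blast
  from e have "g [^] e = g [^] k \<or> g [^] e = inv (g [^] k)"
  proof
    assume "[k + e = 0] (mod ord g)"
    then have "g [^] (k + e) = g [^] (0::nat)" using pow_eq_of_cong g by blast
    then have "g [^] e \<otimes> g [^] k = \<one>" using g by (simp add: nat_pow_mult add.commute)
    then show ?thesis using g inv_equality by (metis nat_pow_closed)
  next
    assume "[k = e] (mod ord g)"
    then show ?thesis using pow_eq_of_cong g by metis
  qed
  then show "\<exists>\<phi>\<in>auto G. \<phi> g = g [^] k \<or> \<phi> g = inv (g [^] k)"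
    using \<phi> by metis
qed

lemma auto_pow_one: "g \<in> carrier G \<Longrightarrow> \<exists>\<phi>\<in>auto G. \<phi> g = g [^] (1::nat)"
  using id_in_auto by (intro bexI[of _ "\<lambda>x\<in>carrier G. x"]) auto

text \<open>Up to sign the units modulo 8 form two classes, {1, 7} and {3, 5}; one automorphism in
  the second class suffices.\<close>

lemma power_good_order_8:
  fixes e :: nat
  assumes g: "g \<in> carrier G" and ord: "ord g = 8" and \<phi>: "\<exists>\<phi>\<in>auto G. \<phi> g = g [^] e"
    and e: "e mod 8 = 3 \<or> e mod 8 = 5"
  shows "power_good g"
proof (rule power_goodI[OF _ g])
  fix k assume "coprime k (ord g)"
  then have "coprime k (2 ^ 3)" using ord by simp
  then have "odd k" by (simp only: coprime_power_right_iff) simp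
  then have "k mod 8 = 1 \<or> k mod 8 = 3 \<or> k mod 8 = 5 \<or> k mod 8 = 7" by presburger
  then have "([k = 1] (mod 8) \<or> [k + 1 = 0] (mod 8)) \<or> ([k = e] (mod 8) \<or> [k + e = 0] (mod 8))"
    using e unfolding cong_def by presburger
  then show "\<exists>e. (\<exists>\<phi>\<in>auto G. \<phi> g = g [^] e) \<and> ([k = e] (mod ord g) \<or> [k + e = 0] (mod ord g))"
    using \<phi> auto_pow_one[OF g] unfolding ord by blast
qed

text \<open>Up to sign the units modulo 12 form two classes, {1, 11} and {5, 7}.\<close>

lemma power_good_order_12:
  assumes g: "g \<in> carrier G" and ord: "ord g = 12" and \<phi>: "\<exists>\<phi>\<in>auto G. \<phi> g = g [^] (7::nat)"
  shows "power_good g"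
proof (rule power_goodI[OF _ g])
  fix k assume "coprime k (ord g)"
  then have "coprime k (4 * 3)" using ord by simp
  then have "coprime k (2 ^ 2)" "coprime k 3" unfolding coprime_mult_right_iff by simp_all
  then have "odd k" "\<not> 3 dvd k"
    by (simp_all only: coprime_power_right_iff) (auto dest: coprime_common_divisor_nat[of k 3 3])
  then have "k mod 12 = 1 \<or> k mod 12 = 5 \<or> k mod 12 = 7 \<or> k mod 12 = 11" by presburger
  then have "([k = 1] (mod 12) \<or> [k + 1 = 0] (mod 12)) \<or> ([k = 7] (mod 12) \<or> [k + 7 = 0] (mod 12))"
    unfolding cong_def by presburger
  then show "\<exists>e. (\<exists>\<phi>\<in>auto G. \<phi> g = g [^] e) \<and> ([k = e] (mod ord g) \<or> [k + e = 0] (mod ord g))"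
    using \<phi> auto_pow_one[OF g] unfolding ord by blast
qed

text \<open>Up to sign the units modulo 9 form a cyclic group of order three with classes {1, 8},
  {4, 5} and {2, 7}; \<open>e\<close> and its square represent the two nontrivial ones.\<close>

lemma power_good_order_9:
  fixes e :: nat
  assumes g: "g \<in> carrier G" and ord: "ord g = 9"
    and \<phi>: "\<exists>\<phi>\<in>auto G. \<phi> g = g [^] e" "\<exists>\<phi>\<in>auto G. \<phi> g = g [^] (e ^ 2)"
    and e: "e mod 9 = 4 \<or> e mod 9 = 7"
  shows "power_good g"
proof (rule power_goodI[OF _ g])
  fix k assume "coprime k (ord g)"
  then have "coprime k (3 ^ 2)" using ord by simp
  then have "coprime k 3" by (simp only: coprime_power_right_iff) simp
  then have "\<not> 3 dvd k" by (auto dest: coprime_common_divisor_nat[of k 3 3])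
  then have k: "k mod 9 = 1 \<or> k mod 9 = 2 \<or> k mod 9 = 4 \<or> k mod 9 = 5 \<or> k mod 9 = 7 \<or> k mod 9 = 8" by presburger
  have "(e ^ 2) mod 9 = ((e mod 9) ^ 2) mod 9" by (simp add: power_mod)
  then have e2: "e mod 9 = 4 \<and> (e ^ 2) mod 9 = 7 \<or> e mod 9 = 7 \<and> (e ^ 2) mod 9 = 4" using e by auto
  define e' where "e' = e ^ 2"
  have "([k = 1] (mod 9) \<or> [k + 1 = 0] (mod 9)) \<or> ([k = e] (mod 9) \<or> [k + e = 0] (mod 9))
      \<or> ([k = e'] (mod 9) \<or> [k + e' = 0] (mod 9))"
    using k e2[folded e'_def] unfolding cong_def by presburger
  then show "\<exists>e. (\<exists>\<phi>\<in>auto G. \<phi> g = g [^] e) \<and> ([k = e] (mod ord g) \<or> [k + e = 0] (mod ord g))"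
    using \<phi> auto_pow_one[OF g] unfolding ord e'_def by blast
qed

lemma auto_pow_of_conj:
  fixes e :: nat
  assumes "x \<in> carrier G" "g \<in> carrier G" "x \<otimes> g \<otimes> inv x = g [^] e"
  shows "\<exists>\<phi>\<in>auto G. \<phi> g = g [^] e"
  using auto_conj[OF assms(1)] assms(2,3) by metis

lemma cyclic_normalizer_exponent:
  assumes "g \<in> carrier G" "x \<in> cyclic_normalizer g"
  obtains e :: nat where "x \<in> carrier G" "x \<otimes> g \<otimes> inv x = g [^] e"
  using assms mem_generate_iff[OF assms(1)] by (auto simp: cyclic_normalizer_def)

lemma generate_commute_of_commute:
  assumes g: "g \<in> carrier G" and x: "x \<in> carrier G" and "x \<otimes> g \<otimes> inv x = g" and h: "h \<in> generate G {g}"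
  shows "h \<otimes> x = x \<otimes> h"
proof -
  have "g \<otimes> x = x \<otimes> g" using commute_of_conj[OF x g assms(3)] by simp
  then show ?thesis using h group_commutes_pow[OF _ g x] by (auto simp: mem_generate_iff[OF g])
qed

text \<open>The last alternative is the dihedral or quaternion case; it makes \<open>generate G {g}\<close>
  characteristic in its normaliser, because it contains all elements of order 8.\<close>

lemma normalizer_order_8:
  assumes g: "g \<in> carrier G" and ord: "ord g = 8" and N: "card (cyclic_normalizer g) = 16"
  obtains "power_good g"
  | "\<And>a b. a \<in> cyclic_normalizer g \<Longrightarrow> b \<in> cyclic_normalizer g \<Longrightarrow> a \<otimes> b = b \<otimes> a"
  | "\<And>y. y \<in> cyclic_normalizer g \<Longrightarrow> y \<notin> generate G {g} \<Longrightarrow> y [^] (4::nat) = \<one>"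
proof -
  define C where "C = generate G {g}"
  define M where "M = cyclic_normalizer g"
  have C: "subgroup C G" "card C = 8" using subgroup_generate[OF g] generate_pow_card[OF g] ord by (simp_all add: C_def)
  have M: "subgroup M G" "C \<subseteq> M" "card M = 2 * card C"
    using subgroup_cyclic_normalizer[OF g] N C by (simp_all add: M_def C_def)
  have sq: "y \<otimes> y \<in> C" if "y \<in> M" for y using square_mem_of_index_two[OF C(1) M that] .
  have exp: "e mod 8 \<in> {1, 3, 5, 7}" if y: "y \<in> M" and e: "y \<otimes> g \<otimes> inv y = g [^] e" for y and e :: nat
  proof -
    have yc: "y \<in> carrier G" using y subgroup.subset[OF M(1)] by auto
    \<comment> \<open>Squares of elements of \<open>M\<close> lie in \<open>C\<close> and centralise
      \<open>g\<close>, so \<open>e\<close> is a square root of 1 modulo 8.\<close>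
    have "y [^] (2::nat) \<in> C" using sq[OF y] yc by (simp add: numeral_2_eq_2)
    then have "y [^] (2::nat) \<otimes> g = g \<otimes> y [^] (2::nat)"
      using generate_comm[OF g] by (simp add: C_def generate.incl)
    then have "[e ^ 2 = 1] (mod 8)" using conj_exponent_cong[OF yc g e] ord by simp
    then have "(e ^ 2) mod 8 = 1" by (simp add: cong_def)
    then have "odd (e ^ 2)" by presburger
    then have "odd e" by simp
    then show ?thesis by (simp; presburger)
  qed
  show ?thesis
  proof (cases "\<exists>y\<in>M. \<exists>e::nat. y \<otimes> g \<otimes> inv y = g [^] e \<and> (e mod 8 = 3 \<or> e mod 8 = 5)")
    case True
    then obtain y and e :: nat where "y \<in> M" "y \<otimes> g \<otimes> inv y = g [^] e" "e mod 8 = 3 \<or> e mod 8 = 5" by blast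
    \<comment> \<open>Exponents 3 and 5 are realised by inner automorphisms.\<close>
    then have "power_good g"
      using power_good_order_8[OF g ord auto_pow_of_conj[OF _ g]] subgroup.subset[OF M(1)] by blast
    then show ?thesis by (rule that(1))
  next
    case no35: False
    show ?thesis
    \<comment> \<open>One element outside \<open>C\<close> that centralises \<open>g\<close> makes
      \<open>C\<close> central in \<open>M\<close>, and then \<open>M\<close> is abelian.\<close>
    proof (cases "\<exists>y\<in>M - C. \<exists>e::nat. y \<otimes> g \<otimes> inv y = g [^] e \<and> e mod 8 = 1")
      case True
      then obtain y and e :: nat where y: "y \<in> M" "y \<notin> C" "y \<otimes> g \<otimes> inv y = g [^] e" "e mod 8 = 1" by blast
      have yc: "y \<in> carrier G" using y subgroup.subset[OF M(1)] by auto
      have "y \<otimes> g \<otimes> inv y = g" using y(3,4) pow_eq_of_cong[of e 1 g] ord g by (simp add: cong_def)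
      then have yC: "h \<otimes> y = y \<otimes> h" if "h \<in> C" for h
        using generate_commute_of_commute[OF g yc _] that by (simp add: C_def)
      have central: "h \<otimes> x = x \<otimes> h" if h: "h \<in> C" and x: "x \<in> M" for h x
      proof (cases "x \<in> C")
        case True
        then show ?thesis using generate_comm[OF g] h by (simp add: C_def)
      next
        case False
        have xc: "x \<in> carrier G" and hc: "h \<in> carrier G" using x h M C(1) subgroup.subset by blast+
        have "x \<otimes> y \<in> C" using mult_mem_of_index_two[OF C(1) M x False y(1,2)] .
        then have "h \<otimes> (x \<otimes> y) = (x \<otimes> y) \<otimes> h" using generate_comm[OF g] h by (simp add: C_def)
        then have "(h \<otimes> x) \<otimes> y = (x \<otimes> h) \<otimes> y" using xc hc yc yC[OF h] by (simp add: m_assoc)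
        then show ?thesis using xc hc yc by simp
      qed
      show ?thesis
        by (rule that(2)) (use commute_of_central_index[OF C(1) M(1,2) two_is_prime_nat M(3) central] in \<open>simp add: M_def\<close>)
    next
      case False
      have "y [^] (4::nat) = \<one>" if y: "y \<in> M" "y \<notin> C" for y
      proof -
        have yc: "y \<in> carrier G" using y subgroup.subset[OF M(1)] by auto
        obtain e :: nat where e: "y \<otimes> g \<otimes> inv y = g [^] e"
          using cyclic_normalizer_exponent[OF g, of y] y by (auto simp: M_def)
        then have "e mod 8 = 7" using exp[OF y(1) e] no35 False y by auto
        obtain i :: nat where i: "y \<otimes> y = g [^] i" using sq[OF y(1)] mem_generate_iff[OF g] by (auto simp: C_def)
        \<comment> \<open>Here \<open>y\<close> inverts \<open>g\<close>. It commutes with its own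
          square, a power of \<open>g\<close>, so that square is its own inverse.\<close>
        have "y \<otimes> y = y \<otimes> g [^] i \<otimes> inv y" using i yc by (simp flip: i add: m_assoc)
        also have "\<dots> = (g [^] e) [^] i" using conj_pow[OF yc g, of i] e by simp
        also have "\<dots> = g [^] (e * i)" using g by (simp add: nat_pow_pow)
        finally have "y \<otimes> y = g [^] (e * i)" .
        then have "y \<otimes> y \<otimes> (y \<otimes> y) = g [^] i \<otimes> g [^] (e * i)" using i by metis
        also have "\<dots> = g [^] (i + e * i)" using g by (rule nat_pow_mult)
        also have "\<dots> = \<one>"
        proof -
          have "(1 + e) mod 8 = 0" using \<open>e mod 8 = 7\<close> by presburger
          then have "8 dvd 1 + e" by presburger
          then have "8 dvd (1 + e) * i" by (rule dvd_mult2)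
          then have "ord g dvd i + e * i" using ord by (simp only: distrib_right mult_1)
          then show ?thesis using pow_eq_id[OF g] by blast
        qed
        finally show ?thesis using yc by (simp add: numeral_eq_Suc m_assoc)
      qed
      then show ?thesis by (intro that(3)) (auto simp: M_def C_def)
    qed
  qed
qed

text \<open>An abelian normaliser serves as A, of index 2 or 3. In the last alternative a conjugate
  of \<open>g\<close> stays in the normaliser and has order 8, so it lies in the group of
  \<open>g\<close>, which is thus normal.\<close>

lemma power_good_normal_normalizer_8:
  assumes g: "g \<in> carrier G" and ord: "ord g = 8" and N: "card (cyclic_normalizer g) = 16"
    and normal: "cyclic_normalizer g \<lhd> G" and m: "order G = m * 16" "m = 2 \<or> m = 3"
  shows "power_good g"
proof (cases rule: normalizer_order_8[OF g ord N])
  case 2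
  show ?thesis
    by (rule power_good_of_index[OF normal _ fin g, of m]) (use 2 m N ord in \<open>auto simp: gcd_non_0_nat\<close>)
next
  case 3
  have "cyclic_normalizer g = carrier G"
  proof
    show "carrier G \<subseteq> cyclic_normalizer g"
    proof
      fix x assume x: "x \<in> carrier G"
      have "g \<in> cyclic_normalizer g" using subgroup_cyclic_normalizer(2)[OF g] generate.incl[of g "{g}" G] by auto
      then have xN: "x \<otimes> g \<otimes> inv x \<in> cyclic_normalizer g" using normal.inv_op_closed2[OF normal x] by blast
      have "x \<otimes> g \<otimes> inv x \<in> generate G {g}"
      proof (rule ccontr)
        assume "x \<otimes> g \<otimes> inv x \<notin> generate G {g}"
        then have "(x \<otimes> g \<otimes> inv x) [^] (4::nat) = \<one>" using 3 xN by blast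
        then have "x \<otimes> g [^] (4::nat) \<otimes> inv x = x \<otimes> \<one> \<otimes> inv x" using conj_pow[OF x g] x by simp
        then have "g [^] (4::nat) = \<one>" using conjugation_is_inj[OF x _ one_closed] g by blast
        then show False using pow_eq_id[OF g] ord by simp
      qed
      then show "x \<in> cyclic_normalizer g" using x by (simp add: cyclic_normalizer_def)
    qed
  qed (auto simp: cyclic_normalizer_def)
  then show ?thesis
    by (intro power_good_of_normal[OF g, of "2 * m"]) (use m ord in \<open>auto simp: gcd_non_0_nat\<close>)
qed

lemma normal_whole: "carrier G \<lhd> G"
  by (rule normal_invI[OF subgroup_self]) simp

text \<open>The congruence makes f even; as it divides 4, the normaliser has index at most two and
  is itself normal.\<close>

lemma power_good_order_8_of_32:
  assumes g: "g \<in> carrier G" and ord: "ord g = 8" and G: "order G = 32"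
  shows "power_good g"
proof -
  obtain f where f: "card (cyclic_normalizer g) = f * ord g" "f dvd 4" "[f = 4] (mod 2)"
    by (rule index_cyclic_normalizer_cong[OF g two_is_prime_nat, of 3 4]) (use ord G in auto)
  have "f \<le> 4" "f \<noteq> 0" "f mod 2 = 0" using f(2,3) by (auto dest: dvd_imp_le simp: cong_def)
  then have "f = 2 \<or> f = 4" by presburger
  then consider "f = 2" | "f = 4" by blast
  then show ?thesis
  proof cases
    case 1
    then have "card (cyclic_normalizer g) = 16" using f ord by simp
    then show ?thesis
      using power_good_normal_normalizer_8[OF g ord _ normal_of_index_two[OF subgroup_cyclic_normalizer(1)[OF g]], of 2] G
      by simp
  next
    case 2
    then have "cyclic_normalizer g = carrier G"
      using f ord G subgroup_eq_carrier[OF subgroup_cyclic_normalizer(1)[OF g]] by simp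
    then show ?thesis using power_good_of_normal[OF g, of 4] G ord by simp
  qed
qed

text \<open>f is 3 or 6. If f = 3, N has order 27 and index two, and its elements act on C by
  exponents 1, 4 or 7. Either 4 or 7 occurs and gives inner automorphisms, or C is central of prime
  index in N and the abelian group N serves as A.\<close>

lemma power_good_order_9_of_54:
  assumes g: "g \<in> carrier G" and ord: "ord g = 9" and G: "order G = 54"
  shows "power_good g"
proof -
  define C where "C = generate G {g}"
  define N where "N = cyclic_normalizer g"
  have C: "subgroup C G" "card C = 9" using subgroup_generate[OF g] generate_pow_card[OF g] ord by (simp_all add: C_def)
  have N: "subgroup N G" "C \<subseteq> N" using subgroup_cyclic_normalizer[OF g] by (simp_all add: N_def C_def)
  have p3: "prime (3::nat)" by simp
  obtain f where f: "card N = f * ord g" "f dvd 6" "[f = 6] (mod 3)"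
    by (rule index_cyclic_normalizer_cong[OF g p3, of 2 6]) (use ord G in \<open>auto simp: N_def\<close>)
  have "f \<noteq> 0" using f(2) by (intro notI) simp
  moreover have "f \<le> 6" "f mod 3 = 0" using f(2,3) by (auto dest: dvd_imp_le simp: cong_def)
  ultimately have "f = 3 \<or> f = 6" by presburger
  then consider "f = 3" | "f = 6" by blast
  then show ?thesis
  proof cases
    case 1
    then have cN: "card N = 27" using f ord by simp
    have normal: "N \<lhd> G" using normal_of_index_two[OF N(1)] G cN by simp
    have exp: "e mod 9 \<in> {1, 4, 7}" if y: "y \<in> N" and e: "y \<otimes> g \<otimes> inv y = g [^] e" for y and e :: nat
    proof -
      have yc: "y \<in> carrier G" using y subgroup.subset[OF N(1)] by auto
      have "ord y dvd 27"
        using group.ord_dvd_group_order[OF subgroup_imp_group[OF N(1)], of y] y cN ord_subgroup[OF N(1) y]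
        by (simp add: order_def)
      then have "y [^] (27::nat) = \<one>" using pow_eq_id[OF yc] by blast
      then have "[e ^ 27 = 1] (mod 9)" using conj_exponent_cong[OF yc g e, of 27] ord g by simp
      then have *: "((e mod 9) ^ 27) mod 9 = 1" by (simp add: cong_def power_mod)
      have "e mod 9 < 9" by simp
      then have "e mod 9 \<in> {0, 1, 2, 3, 4, 5, 6, 7, 8}" by (simp; presburger)
      then show ?thesis using * by (elim insertE emptyE; simp)
    qed
    show ?thesis
    proof (cases "\<exists>y\<in>N. \<exists>e::nat. y \<otimes> g \<otimes> inv y = g [^] e \<and> (e mod 9 = 4 \<or> e mod 9 = 7)")
      case True
      then obtain y and e :: nat where y: "y \<in> N" "y \<otimes> g \<otimes> inv y = g [^] e" "e mod 9 = 4 \<or> e mod 9 = 7" by blast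
      have yc: "y \<in> carrier G" using y subgroup.subset[OF N(1)] by auto
      show ?thesis
        by (rule power_good_order_9[OF g ord auto_pow_of_conj[OF yc g y(2)] auto_pow_of_conj[OF _ g conj_pow_exponent[OF yc g y(2)]] y(3)])
          (use yc in simp)
    next
      case False
      have central: "h \<otimes> x = x \<otimes> h" if h: "h \<in> C" and x: "x \<in> N" for h x
      proof -
        obtain e :: nat where e: "x \<in> carrier G" "x \<otimes> g \<otimes> inv x = g [^] e"
          using cyclic_normalizer_exponent[OF g, of x] x by (auto simp: N_def)
        then have "e mod 9 = 1" using exp[OF x e(2)] False x by auto
        then have "x \<otimes> g \<otimes> inv x = g" using e pow_eq_of_cong[of e 1 g] ord g by (simp add: cong_def)
        then show ?thesis using generate_commute_of_commute[OF g e(1)] h by (simp add: C_def)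
      qed
      have comm: "a \<otimes> b = b \<otimes> a" if "a \<in> N" "b \<in> N" for a b
        using commute_of_central_index[OF C(1) N p3 _ central that] cN C(2) by simp
      show ?thesis
        by (rule power_good_of_index[OF normal comm fin g, of 2]) (use G cN ord in \<open>auto simp: gcd_non_0_nat\<close>)
    qed
  next
    case 2
    then have "cyclic_normalizer g = carrier G"
      using f ord G subgroup_eq_carrier[OF N(1)] by (simp add: N_def)
    then show ?thesis using power_good_of_normal[OF g, of 6] G ord by (simp add: gcd_non_0_nat)
  qed
qed

text \<open>No proper divisor of 7, 8 or 9 is congruent to that number modulo 5, so the index
  congruence forces normality.\<close>

lemma power_good_order_5:
  assumes g: "g \<in> carrier G" and ord: "ord g = 5" and G: "order G = m * 5" "m \<in> {7, 8, 9}"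
  shows "power_good g"
proof -
  have p5: "prime (5::nat)" by simp
  obtain f where f: "card (cyclic_normalizer g) = f * ord g" "f dvd m" "[f = m] (mod 5)"
    by (rule index_cyclic_normalizer_cong[OF g p5, of 1 m]) (use ord G in auto)
  have "f \<le> 9" using dvd_imp_le[OF f(2)] G(2) by auto
  have "f = m"
  proof (rule ccontr)
    assume "f \<noteq> m"
    then have "f = 2 \<and> m = 7 \<or> f = 3 \<and> m = 8 \<or> f = 4 \<and> m = 9"
      using f(3) G(2) \<open>f \<le> 9\<close> unfolding cong_def by (elim insertE emptyE; simp; presburger)
    then show False using f(2) by auto
  qed
  then have "cyclic_normalizer g = carrier G"
    using f ord G subgroup_eq_carrier[OF subgroup_cyclic_normalizer(1)[OF g]] by simp
  then show ?thesis using power_good_of_normal[OF g, of m] G ord by (auto simp: gcd_non_0_nat)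
qed

text \<open>A subgroup of order \<open>p ^ 2\<close> is abelian, and being of index at most two it
  is normal. This covers the orders 25, 49 and 50 at once.\<close>

lemma power_good_of_sylow_square:
  assumes p: "prime p" and G: "order G = i * p ^ 2" "i \<in> {1, 2}" and g: "g \<in> carrier G"
  shows "power_good g"
proof -
  obtain P where P: "subgroup P G" "card P = p ^ 2"
    using sylow_thm[OF p group_axioms _ fin, of 2 i] G by (auto simp: mult.commute)
  interpret P: finite_group "G\<lparr>carrier := P\<rparr>" using finite_group_subgroup[OF P(1)] .
  have comm: "a \<otimes> b = b \<otimes> a" if "a \<in> P" "b \<in> P" for a b
    using P.commute_of_order_prime_square[OF p, of a b] P(2) that by (simp add: order_def)
  have "P \<lhd> G"
  proof (cases "i = 1")
    case True
    then have "P = carrier G" using subgroup_eq_carrier[OF P(1)] P(2) G by simp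
    then show ?thesis using normal_whole by simp
  next
    case False
    then show ?thesis using normal_of_index_two[OF P(1)] P(2) G by simp
  qed
  moreover have "gcd i (ord g) \<in> {1, 2, 3, 4, 6}"
  proof -
    have i: "i > 0" "i \<le> 2" using G(2) by auto
    then have "gcd i (ord g) \<le> i" by (intro dvd_imp_le) auto
    moreover have "gcd i (ord g) > 0" using i by simp
    ultimately have "gcd i (ord g) \<le> 2" "gcd i (ord g) > 0" using i by linarith+
    then have "gcd i (ord g) = 1 \<or> gcd i (ord g) = 2" by linarith
    then show ?thesis by auto
  qed
  ultimately show ?thesis
    by (intro power_good_of_index[OF _ comm fin g, of P i]) (use G P(2) in auto)
qed

section \<open>Order 48\<close>

text \<open>Elements of \<open>N'\<close> in the same coset of \<open>N\<close> differ by an element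
  of the intersection, so each coset of \<open>N\<close> contains at most
  \<open>card (N \<inter> N')\<close> elements of \<open>N'\<close>.\<close>

lemma card_mult_le_card_Int:
  assumes N: "subgroup N G" and N': "subgroup N' G"
  shows "card N * card N' \<le> order G * card (N \<inter> N')"
proof -
  interpret N: subgroup N G by fact
  interpret N': subgroup N' G by fact
  define F where "F T = {x \<in> N'. N #> x = T}" for T
  have fib: "card (F T) \<le> card (N \<inter> N')" for T
  proof (cases "F T = {}")
    case False
    then obtain x0 where x0: "x0 \<in> N'" "N #> x0 = T" by (auto simp: F_def)
    have "F T \<subseteq> (\<lambda>k. k \<otimes> x0) ` (N \<inter> N')"
    proof
      fix x assume "x \<in> F T"
      then have x: "x \<in> N'" "N #> x = N #> x0" using x0 by (auto simp: F_def)
      have "x \<in> N #> x0" using rcos_self[OF _ N, of x] x N'.subset by auto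
      then obtain k where k: "k \<in> N" "x = k \<otimes> x0" by (auto simp: r_coset_def)
      have "x \<otimes> inv x0 = k" using k x0(1) N.subset N'.subset by (auto simp: m_assoc)
      then have "k \<in> N'" using x x0 by (metis N'.m_closed N'.m_inv_closed)
      then show "x \<in> (\<lambda>k. k \<otimes> x0) ` (N \<inter> N')" using k by blast
    qed
    then show ?thesis
      using surj_card_le[of "N \<inter> N'" "F T" "\<lambda>k. k \<otimes> x0"] finite_subset[OF N.subset fin] by simp
  qed simp
  have "N' = (\<Union>T\<in>rcosets N. F T)" using N'.subset by (auto simp: F_def RCOSETS_def)
  moreover have "finite (rcosets N)" using fin by (simp add: RCOSETS_def)
  ultimately have "card N' \<le> (\<Sum>T\<in>rcosets N. card (F T))" using card_UN_le by metis
  also have "\<dots> \<le> card (rcosets N) * card (N \<inter> N')" using sum_bounded_above[of _ "\<lambda>T. card (F T)"] fib by simp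
  finally have "card N * card N' \<le> card N * (card (rcosets N) * card (N \<inter> N'))" by (rule mult_le_mono2)
  also have "\<dots> = order G * card (N \<inter> N')" using lagrange[OF N] by (simp add: mult.assoc flip: mult.commute)
  finally show ?thesis .
qed

text \<open>The product of \<open>K\<close> with a Sylow 3-subgroup has at most 24 elements and
  order divisible by 8 and by 3. It provides the index two subgroup that multiplication by a central
  involution requires.\<close>

lemma exists_index_two_of_order_48:
  assumes G: "order G = 48" and K: "K \<lhd> G" "card K = 8"
  obtains M where "subgroup M G" "card M = 24" "K \<subseteq> M"
proof -
  have p3: "prime (3::nat)" by simp
  obtain T where T: "subgroup T G" "card T = 3"
    using sylow_thm[OF p3 group_axioms _ fin, of 1 16] G by auto
  have Ks: "subgroup K G" using K(1) normal_imp_subgroup by blast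
  define M where "M = K <#> T"
  have M: "subgroup M G" unfolding M_def by (rule mult_norm_subgroup[OF K(1) T(1)])
  have KM: "K \<subseteq> M" and TM: "T \<subseteq> M"
    using subgroup.one_closed[OF T(1)] subgroup.one_closed[OF Ks] subgroup.subset[OF T(1)] subgroup.subset[OF Ks]
    unfolding M_def set_mult_def by (force, force)
  have "M = (\<lambda>(a, b). a \<otimes> b) ` (K \<times> T)" by (auto simp: M_def set_mult_def)
  moreover have "finite K" "finite T"
    using finite_subset[OF _ fin] subgroup.subset[OF Ks] subgroup.subset[OF T(1)] by auto
  ultimately have "card M \<le> 24" using card_image_le[of "K \<times> T"] K(2) T(2) by (simp add: card_cartesian_product)
  moreover have "8 dvd card M" "3 dvd card M"
    using card_dvd_of_subgroup_le[OF Ks M KM] card_dvd_of_subgroup_le[OF T(1) M TM] K(2) T(2) by auto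
  moreover have "card M > 0" using card_subgroup_pos[OF M] .
  ultimately have "card M = 24" by presburger
  then show ?thesis using that M KM by blast
qed

lemma subgroup_conj_image:
  assumes N: "subgroup N G" and x: "x \<in> carrier G"
  shows "subgroup ((\<lambda>y. x \<otimes> y \<otimes> inv x) ` N) G" "card ((\<lambda>y. x \<otimes> y \<otimes> inv x) ` N) = card N"
proof -
  interpret N: subgroup N G by fact
  show "card ((\<lambda>y. x \<otimes> y \<otimes> inv x) ` N) = card N"
    using conjugation_is_inj[OF x] N.subset by (intro card_image inj_onI) blast
  show "subgroup ((\<lambda>y. x \<otimes> y \<otimes> inv x) ` N) G"
  proof (rule subgroupI_finite)
    show "(\<lambda>y. x \<otimes> y \<otimes> inv x) ` N \<subseteq> carrier G" using N.subset x by auto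
    show "(\<lambda>y. x \<otimes> y \<otimes> inv x) ` N \<noteq> {}" using N.one_closed by blast
    fix a b assume "a \<in> (\<lambda>y. x \<otimes> y \<otimes> inv x) ` N" "b \<in> (\<lambda>y. x \<otimes> y \<otimes> inv x) ` N"
    then obtain c d where cd: "c \<in> N" "d \<in> N" "a = x \<otimes> c \<otimes> inv x" "b = x \<otimes> d \<otimes> inv x" by blast
    then have "a \<otimes> b = x \<otimes> (c \<otimes> d) \<otimes> inv x" using conj_mult[OF x, of c d] N.subset by auto
    then show "a \<otimes> b \<in> (\<lambda>y. x \<otimes> y \<otimes> inv x) ` N" using cd by blast
  qed
qed

text \<open>\<open>N\<close> and a different conjugate \<open>N'\<close> meet in at least 256 / 48
  elements, hence in exactly 8. The intersection has index two in both, so its normaliser contains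
  both; its order is a multiple of 16, larger than 16, and divides 48.\<close>

lemma exists_normal_8_of_order_48:
  assumes G: "order G = 48" and N: "subgroup N G" "card N = 16" and x: "x \<in> carrier G" "h \<in> N" "x \<otimes> h \<otimes> inv x \<notin> N"
  obtains K where "K \<lhd> G" "card K = 8" "K \<subseteq> N"
proof -
  define N' where "N' = (\<lambda>y. x \<otimes> y \<otimes> inv x) ` N"
  have N': "subgroup N' G" "card N' = 16" using subgroup_conj_image[OF N(1) x(1)] N(2) by (simp_all add: N'_def)
  have xN': "x \<otimes> h \<otimes> inv x \<in> N'" using x by (simp add: N'_def)
  define K where "K = N \<inter> N'"
  have K: "subgroup K G" "K \<subseteq> N" "K \<subseteq> N'" using subgroups_Inter_pair[OF N(1) N'(1)] by (simp_all add: K_def)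
  have finN: "finite N" "finite N'" using finite_subset[OF _ fin] subgroup.subset N(1) N'(1) by auto
  have "card K \<noteq> 16"
  proof
    assume "card K = 16"
    then have "K = N'" using card_subset_eq[OF finN(2) K(3)] N'(2) by simp
    then show False using xN' K(2) x(3) by blast
  qed
  moreover have "card K dvd 2 ^ 4" using card_dvd_of_subgroup_le[OF K(1) N(1) K(2)] N(2) by simp
  then obtain i where i: "i \<le> 4" "card K = 2 ^ i" using divides_primepow_nat[OF two_is_prime_nat] by blast
  moreover have "card K \<ge> 6" using card_mult_le_card_Int[OF N(1) N'(1)] N(2) N'(2) G by (simp add: K_def)
  ultimately have cK: "card K = 8"
  proof -
    have "i = 0 \<or> i = 1 \<or> i = 2 \<or> i = 3 \<or> i = 4" using i(1) by linarith
    then show ?thesis using i(2) \<open>card K \<noteq> 16\<close> \<open>card K \<ge> 6\<close> by auto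
  qed
  define Z where "Z = {y \<in> carrier G. \<forall>k\<in>K. y \<otimes> k \<otimes> inv y \<in> K}"
  have Kc: "k \<in> carrier G" if "k \<in> K" for k using that subgroup.subset[OF K(1)] by auto
  have NZ: "N \<subseteq> Z" "N' \<subseteq> Z"
    using conj_mem_of_index_two[OF K(1) N(1) K(2)] conj_mem_of_index_two[OF K(1) N'(1) K(3)] N(2) N'(2) cK
      subgroup.subset[OF N(1)] subgroup.subset[OF N'(1)] by (auto simp: Z_def)
  have Z: "subgroup Z G"
  proof (rule subgroupI_finite)
    show "Z \<noteq> {}" using NZ x by auto
    fix a b assume "a \<in> Z" "b \<in> Z"
    then have ab: "a \<in> carrier G" "b \<in> carrier G" "\<And>k. k \<in> K \<Longrightarrow> a \<otimes> (b \<otimes> k \<otimes> inv b) \<otimes> inv a \<in> K" by (auto simp: Z_def)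
    have "(a \<otimes> b) \<otimes> k \<otimes> inv (a \<otimes> b) \<in> K" if "k \<in> K" for k
      using ab(3)[OF that] ab(1,2) Kc[OF that] by (simp add: m_assoc inv_mult_group)
    then show "a \<otimes> b \<in> Z" using ab by (simp add: Z_def)
  qed (auto simp: Z_def)
  have finZ: "finite Z" using finite_subset[OF subgroup.subset[OF Z] fin] .
  have "16 dvd card Z" using card_dvd_of_subgroup_le[OF N(1) Z NZ(1)] N(2) by simp
  then obtain j where j: "card Z = 16 * j" by blast
  have "card Z dvd 48" using lagrange[OF Z] G by (metis dvd_triv_right)
  then have "j dvd 3" using j by (simp add: dvd_def) presburger
  moreover have "j \<noteq> 1"
  proof
    assume "j = 1"
    then have "N = Z" using card_subset_eq[OF finZ NZ(1)] N(2) j by simp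
    then show False using NZ(2) xN' x(3) by blast
  qed
  ultimately have "j = 3" using prime_nat_iff[of 3] by auto
  then have "Z = carrier G" using subgroup_eq_carrier[OF Z] j G by simp
  then have "K \<lhd> G" using normal_invI[OF K(1)] by (auto simp: Z_def)
  then show ?thesis using that cK K(2) by blast
qed

text \<open>The hard case is a normaliser of order 16 that is not normal. Then g^4 is the square of
  an element of a normal subgroup \<open>K\<close> of order 8 and turns out to be central; an index
  two subgroup above \<open>K\<close> misses \<open>g\<close>, and multiplication by g^4 outside it
  sends \<open>g\<close> to g^5.\<close>

lemma power_good_order_8_of_48:
  assumes g: "g \<in> carrier G" and ord: "ord g = 8" and G: "order G = 48"
  shows "power_good g"
proof -
  define N where "N = cyclic_normalizer g"
  have N: "subgroup N G" "generate G {g} \<subseteq> N" using subgroup_cyclic_normalizer[OF g] by (simp_all add: N_def)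
  have gN: "g \<in> N" using N(2) generate.incl[of g "{g}" G] by auto
  obtain f where f: "card N = f * ord g" "f dvd 6" "[f = 6] (mod 2)"
    by (rule index_cyclic_normalizer_cong[OF g two_is_prime_nat, of 3 6]) (use ord G in \<open>auto simp: N_def\<close>)
  have "f \<noteq> 4" "f \<noteq> 0" using f(2) by (intro notI; simp)+
  moreover have "f \<le> 6" "f mod 2 = 0" using f(2,3) by (auto dest: dvd_imp_le simp: cong_def)
  ultimately have "f = 2 \<or> f = 6" by presburger
  then consider "f = 6" | "f = 2" "N \<lhd> G" | "f = 2" "\<not> N \<lhd> G" by blast
  then show ?thesis
  proof cases
    case 1
    then have "cyclic_normalizer g = carrier G"
      using f ord G subgroup_eq_carrier[OF N(1)] by (simp add: N_def)
    then show ?thesis using power_good_of_normal[OF g, of 6] G ord by (simp add: gcd_non_0_nat)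
  next
    case 2
    then show ?thesis
      using power_good_normal_normalizer_8[OF g ord, of 3] f ord G by (simp add: N_def)
  next
    case 3
    have cN: "card N = 16" using 3 f ord by simp
    obtain x h where "x \<in> carrier G" "h \<in> N" "x \<otimes> h \<otimes> inv x \<notin> N" using 3(2) normal_invI[OF N(1)] by blast
    then obtain K where K: "K \<lhd> G" "card K = 8" "K \<subseteq> N"
      using exists_normal_8_of_order_48[OF G N(1) cN] by blast
    have Ks: "subgroup K G" using K(1) normal_imp_subgroup by blast
    have cNK: "card N = 2 * card K" using cN K(2) by simp
    have "g \<notin> K"
    proof
      assume "g \<in> K"
      then have "generate G {g} \<subseteq> K" using generate_subgroup_incl[OF _ Ks] by simp
      then have "generate G {g} = K"
        using card_subset_eq[OF finite_subset[OF subgroup.subset[OF Ks] fin]] K(2) ord generate_pow_card[OF g] by simp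
      then have "cyclic_normalizer g = carrier G" using K(1) normal_generate_iff[OF g] by simp
      then show False using cN G by (simp add: N_def order_def)
    qed
    define s where "s = g [^] (2::nat)"
    have "ord s = 4" using ord_pow[OF g, of 2] ord by (simp add: s_def)
    moreover have "s \<in> K"
      using square_mem_of_index_two[OF Ks N(1) K(3) cNK gN] g by (simp add: s_def numeral_2_eq_2)
    ultimately have s: "s \<in> carrier G" "s \<in> K" "ord s = 4" using g by (simp_all add: s_def)
    define D where "D = generate G {s}"
    have D: "subgroup D G" "card D = 4" "D \<subseteq> K"
      using subgroup_generate[OF s(1)] generate_pow_card[OF s(1)] s generate_subgroup_incl[OF _ Ks] by (simp_all add: D_def)
    define z where "z = s \<otimes> s"
    have zs: "z = s [^] (2::nat)" using s by (simp add: z_def numeral_2_eq_2)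
    have z: "z \<in> carrier G" "z \<in> K" "z \<otimes> z = \<one>" "z \<noteq> \<one>"
    proof -
      show "z \<in> K" using s(2) Ks by (simp add: z_def subgroup.m_closed)
      have "z \<otimes> z = s [^] (4::nat)" using s(1) unfolding zs by (simp add: nat_pow_mult)
      then show "z \<otimes> z = \<one>" using pow_eq_id[OF s(1)] s(3) by simp
      show "z \<noteq> \<one>" using pow_eq_id[OF s(1), of 2] s(3) by (simp add: zs)
    qed (use s in \<open>simp add: z_def\<close>)
    have zcentral: "z \<otimes> x = x \<otimes> z" if x: "x \<in> carrier G" for x
    proof -
      \<comment> \<open>A conjugate \<open>w\<close> of \<open>s\<close> stays in \<open>K\<close>,
        and its square lies in the index two subgroup \<open>D\<close>. That square has order two,
        so it is \<open>z\<close>, the only involution of the cyclic group \<open>D\<close>.\<close>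
      define w where "w = x \<otimes> s \<otimes> inv x"
      have w: "w \<in> K" "w \<in> carrier G" using normal.inv_op_closed2[OF K(1) x s(2)] x s by (simp_all add: w_def)
      have ww: "w \<otimes> w = x \<otimes> z \<otimes> inv x" using conj_mult[OF x s(1) s(1)] by (simp add: w_def z_def)
      have "w \<otimes> w \<in> D" using square_mem_of_index_two[OF D(1) Ks D(3)] D(2) K(2) w by simp
      then obtain i :: nat where i: "w \<otimes> w = s [^] i" using mem_generate_iff[OF s(1)] by (auto simp: D_def)
      have "s [^] (i + i) = (w \<otimes> w) \<otimes> (w \<otimes> w)" using i s(1) by (simp add: nat_pow_mult)
      also have "\<dots> = \<one>" unfolding ww using conj_mult[OF x z(1) z(1)] x z(3) by simp
      finally have "4 dvd i + i" using pow_eq_id[OF s(1)] s(3) by simp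
      moreover have "\<not> 4 dvd i"
      proof
        assume "4 dvd i"
        then have "w \<otimes> w = \<one>" using i pow_eq_id[OF s(1)] s(3) by simp
        then have "x \<otimes> z \<otimes> inv x = x \<otimes> \<one> \<otimes> inv x" using ww x by simp
        then show False using conjugation_is_inj[OF x z(1) one_closed] z(4) by blast
      qed
      ultimately have "i mod 4 = 2" by presburger
      then have "s [^] i = z" unfolding zs using pow_eq_of_cong[of i 2 s] s by (simp add: cong_def)
      then have "x \<otimes> z \<otimes> inv x = z" using i ww by simp
      then show ?thesis using commute_of_conj[OF x z(1)] by simp
    qed
    obtain M where M: "subgroup M G" "card M = 24" "K \<subseteq> M" using exists_index_two_of_order_48[OF G K(1,2)] by blast
    \<comment> \<open>The order of \<open>M \<inter> N\<close> divides gcd 24 16 = 8, so the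
      intersection is \<open>K\<close>, which does not contain \<open>g\<close>.\<close>
    have "g \<notin> M"
    proof
      assume "g \<in> M"
      have MN: "subgroup (M \<inter> N) G" using subgroups_Inter_pair[OF M(1) N(1)] .
      have "card (M \<inter> N) dvd 24" "card (M \<inter> N) dvd 16"
        using card_dvd_of_subgroup_le[OF MN M(1)] card_dvd_of_subgroup_le[OF MN N(1)] M(2) cN by auto
      then have "card (M \<inter> N) dvd gcd 24 16" by (rule gcd_greatest)
      then have "card (M \<inter> N) \<le> 8" by (auto simp: gcd_non_0_nat dest: dvd_imp_le)
      moreover have "K \<subseteq> M \<inter> N" "finite (M \<inter> N)" using M(3) K(3) finite_subset[OF subgroup.subset[OF MN] fin] by auto
      ultimately have "K = M \<inter> N" using K(2) by (metis card_mono card_subset_eq le_antisym)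
      then show False using \<open>g \<in> M\<close> gN \<open>g \<notin> K\<close> by blast
    qed
    then have "\<exists>\<phi>\<in>auto G. \<phi> g = g \<otimes> z"
      using auto_mult_central_involution[OF M(1) _ _ z(3) zcentral g] G M z(2) by auto
    moreover have "g \<otimes> z = g [^] (5::nat)" using g by (simp add: zs s_def nat_pow_pow nat_pow_mult flip: nat_pow_Suc2)
    ultimately show ?thesis using power_good_order_8[OF g ord, of 5] by simp
  qed
qed

section \<open>Order 48: elements of order 12\<close>

lemma square_mult_central:
  assumes "d \<in> carrier G" "x \<in> carrier G" "d \<otimes> x = x \<otimes> d"
  shows "(d \<otimes> x) \<otimes> (d \<otimes> x) = (d \<otimes> d) \<otimes> (x \<otimes> x)"
proof -
  have "(d \<otimes> x) \<otimes> (d \<otimes> x) = d \<otimes> (x \<otimes> d) \<otimes> x" using assms(1,2) by (simp add: m_assoc)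
  also have "\<dots> = (d \<otimes> d) \<otimes> (x \<otimes> x)" using assms(1,2) unfolding assms(3)[symmetric] by (simp add: m_assoc)
  finally show ?thesis .
qed

lemma square_mult_anticommute:
  assumes c: "z \<in> carrier G" "a \<in> carrier G" "b \<in> carrier G"
    and central: "b \<otimes> z = z \<otimes> b" and anti: "a \<otimes> b = z \<otimes> (b \<otimes> a)"
  shows "(b \<otimes> a) \<otimes> (b \<otimes> a) = z \<otimes> ((b \<otimes> b) \<otimes> (a \<otimes> a))"
proof -
  have "(b \<otimes> a) \<otimes> (b \<otimes> a) = b \<otimes> (a \<otimes> b) \<otimes> a" using c by (simp add: m_assoc)
  also have "\<dots> = (b \<otimes> z) \<otimes> (b \<otimes> a \<otimes> a)" unfolding anti using c by (simp add: m_assoc)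
  also have "\<dots> = z \<otimes> ((b \<otimes> b) \<otimes> (a \<otimes> a))" unfolding central using c by (simp add: m_assoc)
  finally show ?thesis .
qed

text \<open>Here \<open>P\<close> is the central product of a quaternion group with the cyclic group
  generated by \<open>u\<close>. The quaternion factor consists of the elements of square \<open>u\<^sup>2\<close>
  outside the centre together with the squares of the centre.\<close>

lemma exists_quaternion_subgroup:
  assumes P: "P \<lhd> G" "card P = 16" and t: "t \<in> carrier G" "t [^] (3::nat) = \<one>"
    and u: "u \<in> P" "ord u = 4" "\<And>x. x \<in> carrier G \<Longrightarrow> x \<otimes> u = u \<otimes> x"
    and fixed: "\<And>a. a \<in> P \<Longrightarrow> t \<otimes> a = a \<otimes> t \<Longrightarrow> a \<in> generate G {u}"
    and nonab: "\<not> (\<forall>a\<in>P. \<forall>b\<in>P. a \<otimes> b = b \<otimes> a)"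
  obtains K where "K \<lhd> G" "card K = 8"
proof -
  interpret P: normal P G by fact
  have Ps: "subgroup P G" by (rule P.subgroup_axioms)
  have finP: "finite P" using finite_subset[OF P.subset fin] .
  have Pc: "x \<in> carrier G" if "x \<in> P" for x using that P.subset by auto
  have uc: "u \<in> carrier G" using Pc[OF u(1)] .
  define D where "D = generate G {u}"
  have D: "subgroup D G" "card D = 4" "D \<subseteq> P"
    using subgroup_generate[OF uc] generate_pow_card[OF uc] u(2) generate_subgroup_incl[OF _ Ps] u(1) by (simp_all add: D_def)
  interpret D: subgroup D G by fact
  have Dc: "d \<in> carrier G" if "d \<in> D" for d using that D.subset by auto
  have D_iff: "d \<in> D \<longleftrightarrow> (\<exists>i::nat. d = u [^] i)" for d using mem_generate_iff[OF uc] by (simp add: D_def)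
  have central: "d \<otimes> x = x \<otimes> d" if d: "d \<in> D" and x: "x \<in> carrier G" for d x
  proof -
    obtain i :: nat where i: "d = u [^] i" using D_iff[of d] d by blast
    show ?thesis unfolding i using group_commutes_pow[OF _ uc x] u(3)[OF x] by simp
  qed
  define z where "z = u [^] (2::nat)"
  have z: "z \<in> D" "z \<in> carrier G" using uc by (auto simp: z_def D_iff)
  have zz: "z \<otimes> z = \<one>" "z \<noteq> \<one>"
    using pow_eq_id[OF uc, of 4] pow_eq_id[OF uc, of 2] u(2) uc by (simp_all add: z_def nat_pow_mult)
  have zzx: "z \<otimes> (z \<otimes> x) = x" if "x \<in> carrier G" for x using that z(2) zz(1) by (simp flip: m_assoc)
  have Dsq: "d \<otimes> d = \<one> \<or> d \<otimes> d = z" if "d \<in> D" for d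
  proof -
    obtain i :: nat where i: "d = u [^] i" using D_iff[of d] \<open>d \<in> D\<close> by blast
    have "(i + i) mod 4 = 0 \<or> (i + i) mod 4 = 2" by presburger
    then have c: "(i + i) mod 4 = 0 mod 4 \<or> (i + i) mod 4 = 2 mod 4" by auto
    have "[i + i = 0] (mod ord u) \<or> [i + i = 2] (mod ord u)" using c unfolding u(2) cong_def .
    then have "u [^] (i + i) = u [^] (0::nat) \<or> u [^] (i + i) = u [^] (2::nat)"
      using pow_eq_of_cong[of "i + i" 0 u] pow_eq_of_cong[of "i + i" 2 u] uc by blast
    then show ?thesis using i uc by (simp add: z_def nat_pow_mult)
  qed
  have Done: "d = \<one> \<or> d = z" if "d \<in> D" "d \<otimes> d = \<one>" for d
  proof -
    obtain i :: nat where i: "d = u [^] i" using D_iff[of d] \<open>d \<in> D\<close> by blast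
    have "u [^] (i + i) = \<one>" using that(2) i uc by (simp add: nat_pow_mult)
    then have "4 dvd i + i" using pow_eq_id[OF uc] u(2) by simp
    then have "i mod 4 = 0 \<or> i mod 4 = 2" by presburger
    then have c: "i mod 4 = 0 mod 4 \<or> i mod 4 = 2 mod 4" by auto
    have "[i = 0] (mod ord u) \<or> [i = 2] (mod ord u)" using c unfolding u(2) cong_def .
    then have "u [^] i = u [^] (0::nat) \<or> u [^] i = u [^] (2::nat)"
      using pow_eq_of_cong[of i 0 u] pow_eq_of_cong[of i 2 u] uc by blast
    then show ?thesis using i by (simp add: z_def)
  qed
  have D3: "d = \<one>" if d: "d \<in> D" "d [^] (3::nat) = \<one>" for d
  proof -
    have "ord d dvd 3" using pow_eq_id[OF Dc[OF d(1)]] d(2) by blast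
    moreover have "ord d dvd 4"
      using group.ord_dvd_group_order[OF subgroup_imp_group[OF D(1)], of d] d(1) D(2) ord_subgroup[OF D(1) d(1)]
      by (simp add: order_def)
    ultimately have "ord d dvd gcd 3 4" by (rule gcd_greatest)
    then show ?thesis using ord_eq_1[OF Dc[OF d(1)]] by (simp add: gcd_non_0_nat)
  qed

  \<comment> \<open>Modulo the central subgroup \<open>D\<close>, \<open>P\<close> will turn out to
    be a Klein four-group whose three nontrivial cosets are permuted cyclically by \<open>t\<close>;
    for \<open>a\<close> outside \<open>D\<close>, \<open>Z a\<close> is the union of
    \<open>D\<close> and the coset of \<open>a\<close>.\<close>
  define Z where "Z a = {x \<in> P. a \<otimes> x = x \<otimes> a}" for a
  have Z: "subgroup (Z a) G" if a: "a \<in> P" for a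
  proof (rule subgroupI_finite)
    show "Z a \<subseteq> carrier G" using P.subset by (auto simp: Z_def)
    show "Z a \<noteq> {}" using a by (auto simp: Z_def)
    fix x y assume "x \<in> Z a" "y \<in> Z a"
    then have xy: "x \<in> P" "y \<in> P" "a \<otimes> x = x \<otimes> a" "a \<otimes> y = y \<otimes> a" by (auto simp: Z_def)
    have "a \<otimes> (x \<otimes> y) = (a \<otimes> x) \<otimes> y" using Pc a xy(1,2) by (simp add: m_assoc)
    also have "\<dots> = x \<otimes> (a \<otimes> y)" unfolding xy(3) using Pc a xy(1,2) by (simp add: m_assoc)
    also have "\<dots> = (x \<otimes> y) \<otimes> a" unfolding xy(4) using Pc a xy(1,2) by (simp add: m_assoc)
    finally show "x \<otimes> y \<in> Z a" using xy by (simp add: Z_def)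
  qed
  have DZ: "D \<subseteq> Z a" if a: "a \<in> P" for a
  proof
    fix d assume d: "d \<in> D"
    show "d \<in> Z a" using central[OF d Pc[OF a]] d D(3) by (auto simp: Z_def)
  qed
  have card_between: "card H = 8 \<or> H = P" if H: "subgroup H G" "D \<subseteq> H" "H \<subseteq> P" "a \<in> H" "a \<notin> D" for H a
  proof -
    have finH: "finite H" using finite_subset[OF H(3) finP] .
    have d: "4 dvd card H" "card H dvd 16"
      using card_dvd_of_subgroup_le[OF D(1) H(1,2)] card_dvd_of_subgroup_le[OF H(1) Ps H(3)] D(2) P(2) by simp_all
    from d(1) obtain j where j: "card H = 4 * j" by blast
    have "card H \<noteq> 4" using card_subset_eq[OF finH H(2)] D(2) H(4,5) by auto
    moreover have "card H \<le> 16" "card H > 0" using card_mono[OF finP H(3)] P(2) card_subgroup_pos[OF H(1)] by simp_all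
    ultimately have "j = 2 \<or> j = 3 \<or> j = 4" using j by presburger
    then have "card H = 8 \<or> card H = 16" using d(2) j by auto
    then show ?thesis using card_subset_eq[OF finP H(3)] P(2) by auto
  qed
  \<comment> \<open>If all of \<open>P\<close> centralised \<open>a\<close>, the centre
    \<open>H\<close> of \<open>P\<close> would have order at least 8 and \<open>P\<close> would be
    abelian.\<close>
  have cZ: "card (Z a) = 8" if a: "a \<in> P" "a \<notin> D" for a
  proof (rule ccontr)
    assume "card (Z a) \<noteq> 8"
    then have ZP: "Z a = P" using card_between[OF Z[OF a(1)] DZ[OF a(1)], of a] a by (auto simp: Z_def)
    define H where "H = {x \<in> P. \<forall>y\<in>P. x \<otimes> y = y \<otimes> x}"
    have HP: "H \<subseteq> P" unfolding H_def by blast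
    have H: "subgroup H G"
    proof (rule subgroupI_finite)
      show "H \<subseteq> carrier G" using HP P.subset by blast
      have "\<one> \<in> H" unfolding H_def using Pc by simp
      then show "H \<noteq> {}" by blast
      fix x y assume xy: "x \<in> H" "y \<in> H"
      have "(x \<otimes> y) \<otimes> v = v \<otimes> (x \<otimes> y)" if v: "v \<in> P" for v
      proof -
        have c: "x \<in> carrier G" "y \<in> carrier G" "v \<in> carrier G" using xy v HP Pc by auto
        have "(x \<otimes> y) \<otimes> v = x \<otimes> (y \<otimes> v)" using c by (simp add: m_assoc)
        also have "y \<otimes> v = v \<otimes> y" using xy v unfolding H_def by blast
        also have "x \<otimes> (v \<otimes> y) = (x \<otimes> v) \<otimes> y" using c by (simp add: m_assoc)
        also have "x \<otimes> v = v \<otimes> x" using xy v unfolding H_def by blast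
        finally show ?thesis using c by (simp add: m_assoc)
      qed
      moreover have "x \<otimes> y \<in> P" using xy HP by (intro P.m_closed) auto
      ultimately show "x \<otimes> y \<in> H" unfolding H_def by blast
    qed
    have "D \<subseteq> H" unfolding H_def using central D(3) Pc by blast
    moreover have aH: "a \<in> H" unfolding H_def using a(1) ZP[unfolded Z_def] by blast
    ultimately consider "card H = 8" | "H = P" using card_between[OF H _ HP aH a(2)] by blast
    then have "x \<otimes> y = y \<otimes> x" if "x \<in> P" "y \<in> P" for x y
    proof cases
      case 1
      show ?thesis
      proof (rule commute_of_central_index[OF H Ps HP two_is_prime_nat _ _ that])
        show "card P = 2 * card H" using 1 P(2) by simp
        show "h \<otimes> v = v \<otimes> h" if "h \<in> H" "v \<in> P" for h v using that unfolding H_def by blast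
      qed
    next
      case 2
      then show ?thesis using that unfolding H_def by blast
    qed
    then show False using nonab by blast
  qed
  have aZ: "a \<in> Z a" if "a \<in> P" for a using that by (simp add: Z_def)
  have ZP: "Z a \<subseteq> P" for a by (auto simp: Z_def)
  have mult_D: "x \<otimes> y \<in> D" if a: "a \<in> P" "a \<notin> D" and xy: "x \<in> Z a" "x \<notin> D" "y \<in> Z a" "y \<notin> D" for a x y
    using mult_mem_of_index_two[OF D(1) Z[OF a(1)] DZ[OF a(1)] _ xy] cZ[OF a] D(2) by simp
  have mult_Z: "x \<otimes> y \<in> Z a" if a: "a \<in> P" "a \<notin> D" and xy: "x \<in> P" "x \<notin> Z a" "y \<in> P" "y \<notin> Z a" for a x y
    using mult_mem_of_index_two[OF Z[OF a(1)] Ps ZP _ xy] cZ[OF a] P(2) by simp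
  have inv_notin: "inv x \<notin> H" if "subgroup H G" "x \<in> carrier G" "x \<notin> H" for x H
    using that subgroup.m_inv_closed[OF that(1), of "inv x"] by auto
  have coset: "\<exists>d\<in>D. x = d \<otimes> a" if a: "a \<in> P" "a \<notin> D" and x: "x \<in> Z a" "x \<notin> D" for a x
  proof -
    have c: "a \<in> carrier G" "x \<in> carrier G" using a(1) x(1) ZP[of a] Pc by blast+
    have "inv a \<in> Z a" using subgroup.m_inv_closed[OF Z[OF a(1)] aZ[OF a(1)]] .
    then have "x \<otimes> inv a \<in> D" using mult_D[OF a x] inv_notin[OF D(1) c(1) a(2)] by blast
    moreover have "x = (x \<otimes> inv a) \<otimes> a" using c by (simp add: m_assoc)
    ultimately show ?thesis by blast
  qed
  have sqD: "a \<otimes> a \<in> D" if a: "a \<in> P" "a \<notin> D" for a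
    using mult_D[OF a aZ[OF a(1)] a(2) aZ[OF a(1)] a(2)] .
  have conj_notin: "x \<otimes> a \<otimes> inv x \<notin> D" if x: "x \<in> carrier G" and a: "a \<in> carrier G" "a \<notin> D" for x a
  proof
    assume d: "x \<otimes> a \<otimes> inv x \<in> D"
    have "(x \<otimes> a \<otimes> inv x) \<otimes> x = x \<otimes> (x \<otimes> a \<otimes> inv x)" using central[OF d x] .
    then have "x \<otimes> a = x \<otimes> (x \<otimes> a \<otimes> inv x)" using x a by (simp add: m_assoc)
    then have "a = x \<otimes> a \<otimes> inv x" using x a by simp
    then show False using d a by simp
  qed
  have conj_D: "x \<otimes> d \<otimes> inv x = d" if "x \<in> carrier G" "d \<in> D" for x d
    using central[OF that(2,1)] that Dc[OF that(2)] by (simp add: m_assoc flip: central)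
  \<comment> \<open>The conjugate of \<open>a\<close> by \<open>b\<close> is d a with d in
    \<open>D\<close>. Both have the same square, since \<open>a \<otimes> a\<close> is central; so
    d^2 = 1, and d = z because \<open>b\<close> does not commute with \<open>a\<close>.\<close>
  have anti: "b \<otimes> a = z \<otimes> (a \<otimes> b)" if a: "a \<in> P" "a \<notin> D" and b: "b \<in> P" "b \<notin> Z a" for a b
  proof -
    have c: "a \<in> carrier G" "b \<in> carrier G" using a b Pc by auto
    define w where "w = b \<otimes> a \<otimes> inv b"
    have wZ: "w \<in> Z a" unfolding w_def
      using conj_mem_of_index_two[OF Z[OF a(1)] Ps ZP _ b(1) aZ[OF a(1)]] cZ[OF a] P(2) by simp
    have "w \<notin> D" using conj_notin[OF c(2,1) a(2)] by (simp add: w_def)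
    then obtain d where d: "d \<in> D" "w = d \<otimes> a" using coset[OF a wZ] by blast
    have "w \<otimes> w = b \<otimes> (a \<otimes> a) \<otimes> inv b" using conj_mult[OF c(2,1,1)] by (simp add: w_def)
    also have "\<dots> = a \<otimes> a" using conj_D[OF c(2) sqD[OF a]] .
    finally have "(d \<otimes> d) \<otimes> (a \<otimes> a) = a \<otimes> a"
      using square_mult_central[OF Dc[OF d(1)] c(1) central[OF d(1) c(1)]] d(2) by simp
    then have "d \<otimes> d = \<one>" using c Dc[OF d(1)] by simp
    then have "d = \<one> \<or> d = z" using Done d(1) by blast
    moreover have "d \<noteq> \<one>"
    proof
      assume "d = \<one>"
      then have "b \<otimes> a \<otimes> inv b = a" using d c by (simp add: w_def)
      then have "b \<otimes> a = a \<otimes> b" using commute_of_conj c by blast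
      then show False using b by (simp add: Z_def)
    qed
    ultimately have "b \<otimes> a \<otimes> inv b = z \<otimes> a" using d by (simp add: w_def)
    then have "b \<otimes> a \<otimes> inv b \<otimes> b = z \<otimes> a \<otimes> b" by simp
    then show ?thesis using c z by (simp add: m_assoc)
  qed
  \<comment> \<open>\<open>s\<close> is to be \<open>t\<close> or its square. If conjugation by
    \<open>s\<close> only multiplied \<open>a\<close> by d in \<open>D\<close>, three repetitions
    would give d^3 = 1, so d = 1, and \<open>t\<close> would commute with an element outside
    \<open>D\<close>.\<close>
  have moved: "s \<otimes> a \<otimes> inv s \<notin> Z a"
    if a: "a \<in> P" "a \<notin> D" and s: "s \<in> carrier G" "s [^] (3::nat) = \<one>" "s = t \<or> t = s \<otimes> s" for a s
  proof
    assume Za: "s \<otimes> a \<otimes> inv s \<in> Z a"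
    have ac: "a \<in> carrier G" using a Pc by auto
    obtain d where d: "d \<in> D" "s \<otimes> a \<otimes> inv s = d \<otimes> a" using coset[OF a Za conj_notin[OF s(1) ac a(2)]] by blast
    have step: "s \<otimes> (e \<otimes> a) \<otimes> inv s = (e \<otimes> d) \<otimes> a" if e: "e \<in> D" for e
      using conj_mult[OF s(1) Dc[OF e] ac] conj_D[OF s(1) e] d Dc ac e by (simp add: m_assoc)
    have dd: "d \<otimes> d \<in> D" "d \<otimes> d \<otimes> d = d [^] (3::nat)" using d Dc[OF d(1)] by (simp_all add: numeral_eq_Suc)
    have "s [^] (3::nat) \<otimes> a \<otimes> inv (s [^] (3::nat)) = s \<otimes> (s \<otimes> (s \<otimes> a \<otimes> inv s) \<otimes> inv s) \<otimes> inv s"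
      using s(1) ac by (simp add: numeral_eq_Suc m_assoc inv_mult_group)
    also have "\<dots> = d [^] (3::nat) \<otimes> a" unfolding d(2) step[OF d(1)] step[OF dd(1)] dd(2) ..
    finally have "d [^] (3::nat) = \<one>" using s(2) ac Dc[OF d(1)] by simp
    then have "s \<otimes> a \<otimes> inv s = a" using D3[OF d(1)] d(2) ac by simp
    then have sa: "s \<otimes> a = a \<otimes> s" using commute_of_conj s ac by blast
    have "(s \<otimes> s) \<otimes> a = s \<otimes> (a \<otimes> s)" unfolding sa[symmetric] using s(1) ac by (simp add: m_assoc)
    also have "\<dots> = (s \<otimes> a) \<otimes> s" using s(1) ac by (simp add: m_assoc)
    also have "\<dots> = a \<otimes> (s \<otimes> s)" unfolding sa using s(1) ac by (simp add: m_assoc)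
    finally have "t \<otimes> a = a \<otimes> t" using s(3) sa by blast
    then show False using fixed[OF a(1)] a(2) by (simp add: D_def)
  qed
  \<comment> \<open>The conjugates a, b, c under powers of \<open>t\<close> represent the three
    nontrivial cosets of \<open>D\<close>, so c = d b a with d in \<open>D\<close>. They share one
    square; squaring the equation gives a^2 = d^2 z a^4, which determines a^2 up to the factor
    z.\<close>
  have sq: "a \<otimes> a = \<one> \<or> a \<otimes> a = z" if a: "a \<in> P" "a \<notin> D" for a
  proof -
    have ac: "a \<in> carrier G" using a Pc by auto
    define b where "b = t \<otimes> a \<otimes> inv t"
    define c where "c = t \<otimes> b \<otimes> inv t"
    have bP: "b \<in> P" and cP: "c \<in> P" using P.inv_op_closed2 t(1) a(1) by (simp_all add: b_def c_def)
    have bc: "b \<in> carrier G" and cc: "c \<in> carrier G" using bP cP Pc by auto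
    have c2: "c = (t \<otimes> t) \<otimes> a \<otimes> inv (t \<otimes> t)"
      using t ac by (simp add: c_def b_def m_assoc inv_mult_group)
    have t4: "(t \<otimes> t) \<otimes> (t \<otimes> t) = t"
      using t by (simp add: numeral_eq_Suc m_assoc)
    have t23: "(t \<otimes> t) [^] (3::nat) = \<one>"
    proof -
      have "(t \<otimes> t) [^] (3::nat) = t [^] (3::nat) \<otimes> t [^] (3::nat)"
        using t(1) by (intro pow_mult_distrib) auto
      then show ?thesis using t by simp
    qed
    have bZ: "b \<notin> Z a" using moved[OF a t] by (simp add: b_def)
    have cZ': "c \<notin> Z a" using moved[OF a _ t23] t(1) t4 by (simp add: c2)
    have ib: "inv b \<in> P" "inv b \<notin> Z a" using bP bZ inv_notin[OF Z[OF a(1)] bc] by auto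
    have "inv b \<otimes> c \<in> Z a" using mult_Z[OF a ib cP cZ'] .
    moreover have "inv b \<otimes> c \<notin> D"
    proof
      assume d: "inv b \<otimes> c \<in> D"
      have "c = b \<otimes> (inv b \<otimes> c)" using bc cc by simp
      then have "inv t \<otimes> c \<otimes> t = inv t \<otimes> b \<otimes> (inv b \<otimes> c) \<otimes> t" using t bc cc Dc[OF d] by (simp add: m_assoc)
      also have "\<dots> = (inv t \<otimes> b) \<otimes> (t \<otimes> (inv b \<otimes> c))" using central[OF d t(1)] t bc Dc[OF d] by (simp add: m_assoc)
      also have "\<dots> = (inv t \<otimes> b \<otimes> t) \<otimes> (inv b \<otimes> c)" using t bc Dc[OF d] by (simp add: m_assoc)
      also have "inv t \<otimes> b \<otimes> t = a" using t ac by (simp add: b_def m_assoc)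
      also have "inv t \<otimes> c \<otimes> t = b" using t bc by (simp add: c_def m_assoc)
      finally have e: "b = a \<otimes> (inv b \<otimes> c)" .
      have "a \<otimes> (inv b \<otimes> c) \<in> Z a"
        using subgroup.m_closed[OF Z[OF a(1)] aZ[OF a(1)]] DZ[OF a(1)] d by blast
      then have "b \<in> Z a" by (subst e)
      then show False using bZ by simp
    qed
    ultimately obtain d where d: "d \<in> D" "inv b \<otimes> c = d \<otimes> a" using coset[OF a] by blast
    have "c = b \<otimes> (d \<otimes> a)" using bc cc unfolding d(2)[symmetric] by simp
    also have "\<dots> = d \<otimes> (b \<otimes> a)" using central[OF d(1) bc] bc ac Dc[OF d(1)] by (simp flip: m_assoc)
    finally have cd: "c = d \<otimes> (b \<otimes> a)" .
    have ba: "b \<otimes> a = z \<otimes> (a \<otimes> b)" using anti[OF a bP bZ] .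
    then have ab: "a \<otimes> b = z \<otimes> (b \<otimes> a)" using zzx ac bc by simp
    have a2: "a \<otimes> a \<in> D" using sqD[OF a] .
    have b2: "b \<otimes> b = a \<otimes> a" using conj_mult[OF t(1) ac ac] conj_D[OF t(1) a2] by (simp add: b_def)
    have "c \<otimes> c = a \<otimes> a" using conj_mult[OF t(1) bc bc] conj_D[OF t(1) a2] b2 by (simp add: c_def)
    then have "a \<otimes> a = (d \<otimes> d) \<otimes> (z \<otimes> ((a \<otimes> a) \<otimes> (a \<otimes> a)))"
      using square_mult_central[OF Dc[OF d(1)] _ central[OF d(1)], of "b \<otimes> a"]
        square_mult_anticommute[OF z(2) ac bc central[OF z(1) bc, symmetric] ab] ac bc cd b2 by simp
    then have "\<one> \<otimes> (a \<otimes> a) = ((d \<otimes> d) \<otimes> z \<otimes> (a \<otimes> a)) \<otimes> (a \<otimes> a)" using ac z Dc[OF d(1)] by (simp add: m_assoc)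
    then have "((d \<otimes> d) \<otimes> z) \<otimes> (a \<otimes> a) = \<one>" using ac z Dc[OF d(1)] right_cancel[of "a \<otimes> a" "\<one>"] by (metis m_closed one_closed)
    then have "a \<otimes> a = inv ((d \<otimes> d) \<otimes> z)" using ac z Dc[OF d(1)] by (metis inv_equality inv_inv m_closed)
    moreover have "inv z = z" using zz z by (simp add: inv_equality)
    ultimately show ?thesis using Dsq[OF d(1)] zz z by auto
  qed

  define Q where "Q = {v \<in> P. v = \<one> \<or> v = z \<or> (v \<notin> D \<and> v \<otimes> v = z)}"
  have QP: "Q \<subseteq> P" by (auto simp: Q_def)
  have zP: "z \<in> P" using z(1) D(3) by auto
  have DQ: "d = \<one> \<or> d = z" if "d \<in> D" "d \<in> Q" for d using that by (auto simp: Q_def)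
  have notD: "d \<otimes> b \<notin> D" if "d \<in> D" "b \<in> carrier G" "b \<notin> D" for d b
  proof
    assume db: "d \<otimes> b \<in> D"
    have "inv d \<otimes> (d \<otimes> b) \<in> D" using D.m_closed[OF D.m_inv_closed[OF that(1)] db] .
    then show False using that Dc by simp
  qed
  have zQ: "z \<otimes> b \<in> Q" if b: "b \<in> Q" for b
  proof -
    have bc: "b \<in> carrier G" using b QP Pc by auto
    have zbP: "z \<otimes> b \<in> P" using zP b QP by auto
    consider "b = \<one>" | "b = z" | "b \<notin> D" "b \<otimes> b = z" using b by (auto simp: Q_def)
    then show ?thesis
    proof cases
      case 3
      then have "(z \<otimes> b) \<otimes> (z \<otimes> b) = z"
        using square_mult_central[OF z(2) bc central[OF z(1) bc]] zz z by simp
      then show ?thesis using zbP notD[OF z(1) bc 3(1)] by (simp add: Q_def)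
    qed (use zz z zP in \<open>auto simp: Q_def\<close>)
  qed
  have Qs: "subgroup Q G"
  proof (rule subgroupI_finite)
    show "Q \<subseteq> carrier G" using QP P.subset by auto
    show "Q \<noteq> {}" using zP by (auto simp: Q_def)
    fix a b assume ab: "a \<in> Q" "b \<in> Q"
    have aP: "a \<in> P" and bP: "b \<in> P" using ab QP by auto
    have ac: "a \<in> carrier G" and bc: "b \<in> carrier G" using aP bP Pc by auto
    show "a \<otimes> b \<in> Q"
    proof (cases "a \<in> D \<or> b \<in> D")
      case True
      then consider "a = \<one>" | "a = z" | "b = \<one>" | "b = z" using DQ ab by blast
      then show ?thesis
      proof cases
        case 4
        then show ?thesis using zQ[OF ab(1)] central[OF z(1) ac] by simp
      qed (use zQ ab ac bc in auto)
    next
      case False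
      then have nD: "a \<notin> D" "b \<notin> D" by auto
      have sq': "a \<otimes> a = z" "b \<otimes> b = z" using ab nD z(1) by (auto simp: Q_def)
      have abP: "a \<otimes> b \<in> P" using aP bP by simp
      show ?thesis
      proof (cases "b \<in> Z a")
        case True
        then obtain d where d: "d \<in> D" "b = d \<otimes> a" using coset[OF aP nD(1) _ nD(2)] by blast
        then have "(d \<otimes> d) \<otimes> z = z"
          using square_mult_central[OF Dc[OF d(1)] ac central[OF d(1) ac]] sq' by simp
        then have "d \<otimes> d = \<one>" using z Dc[OF d(1)] by simp
        then have "d = \<one> \<or> d = z" using Done d(1) by blast
        moreover have "a \<otimes> b = d \<otimes> z"
          using central[OF d(1) ac] sq'(1) ac Dc[OF d(1)] unfolding d(2) by (metis m_assoc)
        ultimately have "a \<otimes> b = \<one> \<or> a \<otimes> b = z" using zz z by auto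
        then show ?thesis using zP by (auto simp: Q_def)
      next
        case nZ: False
        have "a \<otimes> b \<notin> D"
        proof
          assume d: "a \<otimes> b \<in> D"
          have "inv a \<otimes> (a \<otimes> b) \<in> Z a"
            using subgroup.m_closed[OF Z[OF aP] subgroup.m_inv_closed[OF Z[OF aP] aZ[OF aP]]] d DZ[OF aP] by blast
          then show False using nZ ac bc by simp
        qed
        moreover have "(a \<otimes> b) \<otimes> (a \<otimes> b) = z \<otimes> (z \<otimes> z)"
          using square_mult_anticommute[OF z(2) bc ac central[OF z(1) ac, symmetric] anti[OF aP nD(1) bP nZ]] sq' by simp
        ultimately show ?thesis using abP zz z by (simp add: Q_def)
      qed
    qed
  qed
  have "Q \<lhd> G"
  proof (rule normal_invI[OF Qs])
    fix x v assume x: "x \<in> carrier G" and v: "v \<in> Q"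
    have vc: "v \<in> carrier G" using v QP Pc by auto
    have vP: "x \<otimes> v \<otimes> inv x \<in> P" using P.inv_op_closed2[OF x] v QP by auto
    consider "v \<in> D" | "v \<notin> D" "v \<otimes> v = z" using v D.one_closed z(1) by (auto simp: Q_def)
    then show "x \<otimes> v \<otimes> inv x \<in> Q"
    proof cases
      case 1
      then show ?thesis using conj_D[OF x] v by simp
    next
      case 2
      have "(x \<otimes> v \<otimes> inv x) \<otimes> (x \<otimes> v \<otimes> inv x) = z"
        using conj_mult[OF x vc vc] 2(2) conj_D[OF x z(1)] by simp
      then show ?thesis using vP conj_notin[OF x vc 2(1)] by (simp add: Q_def)
    qed
  qed
  moreover have "card Q = 8"
  proof -
    have uD: "u \<in> D" by (simp add: D_def generate.incl)
    have "u \<noteq> \<one>" using u(2) ord_eq_1[OF uc] by auto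
    moreover have "u \<noteq> z"
    proof
      assume "u = z"
      then have "u = u \<otimes> u" using uc by (simp add: z_def numeral_2_eq_2)
      then show False using uc \<open>u \<noteq> \<one>\<close> l_cancel_one'[of u u] by blast
    qed
    ultimately have uQ: "u \<notin> Q" using DQ uD by blast
    have u2: "u \<otimes> u = z" using uc by (simp add: z_def numeral_2_eq_2)
    \<comment> \<open>Multiplication by \<open>u\<close> changes squares by u^2 = z, so it exchanges
      \<open>Q\<close> with its complement in \<open>P\<close>; hence \<open>Q\<close> is half of
      \<open>P\<close>.\<close>
    have cov: "v \<in> (\<lambda>q. u \<otimes> q) ` Q" if v: "v \<in> P" "v \<notin> Q" for v
    proof -
      have vc: "v \<in> carrier G" using v Pc by auto
      define w where "w = inv u \<otimes> v"
      have wP: "w \<in> P" using u(1) v(1) by (simp add: w_def)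
      have wc: "w \<in> carrier G" using wP Pc by auto
      have vw: "v = u \<otimes> w" using uc vc by (simp add: w_def)
      have vv: "v \<otimes> v = z \<otimes> (w \<otimes> w)"
        unfolding vw using square_mult_central[OF uc wc central[OF uD wc]] u2 by simp
      have "w \<in> Q"
      proof (cases "v \<in> D")
        case True
        then have "v \<otimes> v \<noteq> \<one>" using Done v by (auto simp: Q_def)
        then have "z \<otimes> (w \<otimes> w) = z \<otimes> \<one>" using Dsq[OF True] vv z by auto
        then have "w \<otimes> w = \<one>" using zzx[of "w \<otimes> w"] zzx[of \<one>] wc z by simp
        moreover have "w \<in> D" using True uD by (simp add: w_def)
        ultimately have "w = \<one> \<or> w = z" using Done by blast
        then show ?thesis using zP by (auto simp: Q_def)
      next
        case False
        then have "v \<otimes> v \<noteq> z" using v by (auto simp: Q_def)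
        then have "z \<otimes> (w \<otimes> w) = \<one>" using sq[OF v(1) False] vv by auto
        then have "w \<otimes> w = z" using zzx[of "w \<otimes> w"] wc z by simp
        moreover have "w \<notin> D" using False vw uD by auto
        ultimately show ?thesis using wP by (simp add: Q_def)
      qed
      then show ?thesis using vw by blast
    qed
    have "P - Q = (\<lambda>q. u \<otimes> q) ` Q"
    proof
      show "(\<lambda>q. u \<otimes> q) ` Q \<subseteq> P - Q"
      proof
        fix v assume "v \<in> (\<lambda>q. u \<otimes> q) ` Q"
        then obtain q where q: "q \<in> Q" "v = u \<otimes> q" by blast
        have qc: "q \<in> carrier G" using q QP Pc by auto
        have "v \<notin> Q"
        proof
          assume "v \<in> Q"
          then have "v \<otimes> inv q \<in> Q" using q Qs by (simp add: subgroup.m_closed subgroup.m_inv_closed)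
          then show False using uQ q qc uc by (simp add: m_assoc)
        qed
        then show "v \<in> P - Q" using q QP u(1) by auto
      qed
    qed (use cov in blast)
    moreover have "card ((\<lambda>q. u \<otimes> q) ` Q) = card Q"
      using uc QP P.subset by (intro card_image inj_onI) (auto simp: subset_iff)
    moreover have "card (P - Q) = 16 - card Q" using P(2) QP finP by (simp add: card_Diff_subset finite_subset)
    moreover have "card Q \<le> 16" using card_mono[OF finP QP] P(2) by simp
    ultimately show ?thesis by simp
  qed
  ultimately show ?thesis using that by blast
qed

lemma pow_index_mem:
  assumes P: "P \<lhd> G" and m: "order G = m * card P" and x: "x \<in> carrier G"
  shows "x [^] m \<in> P"
proof -
  interpret P: normal P G by fact
  have Ps: "subgroup P G" by (rule P.subgroup_axioms)
  have "card (rcosets P) = m" using lagrange[OF Ps] m card_subgroup_pos[OF Ps] by simp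
  then have "order (G Mod P) = m" by (simp add: order_def carrier_FactGroup FactGroup_def)
  moreover have "P #> x \<in> carrier (G Mod P)" using x by (auto simp: FactGroup_def RCOSETS_def)
  ultimately have "(P #> x) [^]\<^bsub>G Mod P\<^esub> m = \<one>\<^bsub>G Mod P\<^esub>"
    using group.pow_order_eq_1[OF P.factorgroup_is_group] by metis
  then have "P #> x [^] m = P" using P.FactGroup_pow[OF x] by (simp add: FactGroup_def)
  then show ?thesis using rcos_self[OF _ Ps, of "x [^] m"] x by simp
qed

text \<open>Let t = g^4 and u = g^3. The normaliser of the group of t has order 48, and then that
  group serves as A, or it is C. In the latter case u is central and no subgroup of order 24
  contains g, so any such subgroup gives g |-> g u^2 = g^7. It is obtained from a normal subgroup of
  order 8, found by cases on a Sylow 2-subgroup \<open>P\<close>, unless \<open>P\<close> is normal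
  and abelian and serves as A.\<close>

lemma power_good_order_12_of_48:
  assumes g: "g \<in> carrier G" and ord: "ord g = 12" and G: "order G = 48"
  shows "power_good g"
proof -
  have p3: "prime (3::nat)" by simp
  define C where "C = generate G {g}"
  have C: "subgroup C G" "card C = 12" using subgroup_generate[OF g] generate_pow_card[OF g] ord by (simp_all add: C_def)
  have C_iff: "x \<in> C \<longleftrightarrow> (\<exists>i::nat. x = g [^] i)" for x using mem_generate_iff[OF g] by (simp add: C_def)
  have gC: "g [^] (i::nat) \<in> C" for i using C_iff by blast
  have Cc: "x \<in> carrier G" if "x \<in> C" for x using that subgroup.subset[OF C(1)] by blast
  define t where "t = g [^] (4::nat)"
  define u where "u = g [^] (3::nat)"
  have tu: "t \<in> carrier G" "u \<in> carrier G" "t \<in> C" "u \<in> C" using g gC by (simp_all add: t_def u_def)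
  have ot: "ord t = 3" "ord u = 4" using ord_pow[OF g, of 4] ord_pow[OF g, of 3] ord by (simp_all add: t_def u_def)
  have t3: "t [^] (3::nat) = \<one>" using pow_eq_id[OF tu(1)] ot by simp
  define N where "N = cyclic_normalizer t"
  have N: "subgroup N G" using subgroup_cyclic_normalizer(1)[OF tu(1)] by (simp add: N_def)
  have CN: "C \<subseteq> N"
  proof
    fix x assume x: "x \<in> C"
    have "x \<otimes> t = t \<otimes> x" using generate_comm[OF g, of x t] x tu(3) by (simp add: C_def)
    then have "x \<otimes> t \<otimes> inv x = t" using Cc[OF x] tu by (simp add: m_assoc)
    then show "x \<in> N" using Cc[OF x] by (simp add: N_def cyclic_normalizer_def generate.incl)
  qed
  obtain f where f: "card N = f * ord t" "f dvd 16" "[f = 16] (mod 3)"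
    by (rule index_cyclic_normalizer_cong[OF tu(1) p3, of 1 16]) (use ot G in \<open>auto simp: N_def\<close>)
  have "f dvd 2 ^ 4" using f(2) by simp
  then obtain i where i: "i \<le> 4" "f = 2 ^ i" using divides_primepow_nat[OF two_is_prime_nat] by blast
  have "12 dvd f * 3" using card_dvd_of_subgroup_le[OF C(1) N CN] C(2) f(1) ot by simp
  moreover have "f mod 3 = 1" using f(3) by (simp add: cong_def)
  moreover have "i = 0 \<or> i = 1 \<or> i = 2 \<or> i = 3 \<or> i = 4" using i(1) by presburger
  ultimately have "f = 4 \<or> f = 16" using i(2) by auto
  then show ?thesis
  proof
    assume "f = 16"
    then have "cyclic_normalizer t = carrier G" using f(1) ot G subgroup_eq_carrier[OF N] by (simp add: N_def)
    then have "generate G {t} \<lhd> G" using normal_generate_iff[OF tu(1)] by simp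
    then show ?thesis
      by (rule power_good_of_index[OF _ _ fin g, of _ 16])
        (use generate_comm[OF tu(1)] generate_pow_card[OF tu(1)] ot G ord in \<open>auto simp: gcd_non_0_nat\<close>)
  next
    assume f4: "f = 4"
    have finN: "finite N" using finite_subset[OF subgroup.subset[OF N] fin] .
    have NC: "N = C" using card_subset_eq[OF finN CN] f(1) f4 ot C(2) by simp
    \<comment> \<open>The elements of \<open>C\<close> with cube 1 are powers of \<open>t\<close>,
      so \<open>x\<close> normalises the group of \<open>t\<close>, whose normaliser is
      \<open>C\<close>.\<close>
    have conj_t: "x \<in> C" if x: "x \<in> carrier G" and "x \<otimes> t \<otimes> inv x \<in> C" for x
    proof -
      obtain i :: nat where i: "x \<otimes> t \<otimes> inv x = g [^] i"
        using C_iff[of "x \<otimes> t \<otimes> inv x"] \<open>x \<otimes> t \<otimes> inv x \<in> C\<close> by blast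
      have "(g [^] i) [^] (3::nat) = x \<otimes> t [^] (3::nat) \<otimes> inv x" unfolding i[symmetric] using conj_pow[OF x tu(1)] by simp
      also have "\<dots> = \<one>" using t3 x by simp
      finally have "12 dvd i * 3" using pow_eq_id[OF g] ord g by (simp add: nat_pow_pow)
      then have "4 dvd i" by presburger
      then obtain j where "i = 4 * j" by blast
      then have "x \<otimes> t \<otimes> inv x = t [^] j" using i g by (simp add: t_def nat_pow_pow)
      then have "x \<otimes> t \<otimes> inv x \<in> generate G {t}" using mem_generate_iff[OF tu(1)] by blast
      then show ?thesis using x NC by (auto simp: N_def cyclic_normalizer_def)
    qed
    have conj_u: "inv x \<otimes> u \<otimes> x \<in> C" if x: "x \<in> carrier G" for x
    proof (cases "x \<in> C")
      case True
      then have "inv x \<otimes> u = u \<otimes> inv x"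
        using generate_comm[OF g, of "inv x" u] tu(4) subgroup.m_inv_closed[OF C(1) True] by (simp add: C_def)
      then have "inv x \<otimes> u \<otimes> x = u" using x tu by (simp add: m_assoc)
      then show ?thesis using tu(4) by simp
    next
      case False
      obtain r :: nat where r: "r \<in> {1..<4}" "inv x \<otimes> g [^] r \<otimes> x \<in> C"
        using exists_conj_pow_mem[OF g x, of 4] G ord unfolding C_def by auto
      have pow: "inv x \<otimes> g [^] (r * k) \<otimes> x \<in> C" for k
      proof -
        have "inv x \<otimes> g [^] (r * k) \<otimes> x = (inv x \<otimes> g [^] r \<otimes> x) [^] k"
          using conj_pow[of "inv x" "g [^] r" k] x g by (simp add: nat_pow_pow)
        then show ?thesis using generate_pow_closed[OF g r(2)[unfolded C_def]] by (simp add: C_def)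
      qed
      \<comment> \<open>Exponent 1 or 2 would put the corresponding conjugate of t = g^4 into
        \<open>C\<close>, and \<open>x\<close> with it.\<close>
      have "r = 3"
      proof (rule ccontr)
        assume "r \<noteq> 3"
        then have "r = 1 \<or> r = 2" using r(1) by auto
        then have "inv x \<otimes> t \<otimes> x \<in> C" using pow[of 4] pow[of 2] by (auto simp: t_def)
        then have "inv x \<in> C" using conj_t[of "inv x"] x by simp
        then show False using False x subgroup.m_inv_closed[OF C(1)] inv_inv by metis
      qed
      then show ?thesis using r(2) by (simp add: u_def)
    qed
    define D where "D = generate G {u}"
    have D: "D \<lhd> G" "card D = 4"
      using normal_generate_pow[OF g, of 3] conj_u ord by (simp_all add: D_def u_def C_def)
    have DC: "D \<subseteq> C" using generate_subgroup_incl[OF _ C(1)] tu(4) by (simp add: D_def)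
    \<comment> \<open>Inside \<open>M\<close> the normaliser of the group of \<open>t\<close> would
      still be \<open>C\<close>, of index 4 over that group, while the congruence asks for 8 modulo
      3.\<close>
    have no24: False if M: "subgroup M G" "card M = 24" "g \<in> M" for M
    proof -
      have CM: "C \<subseteq> M" using generate_subgroup_incl[OF _ M(1)] M(3) by (simp add: C_def)
      obtain f' where f': "card (cyclic_normalizer t \<inter> M) = f' * ord t" "f' dvd 8" "[f' = 8] (mod 3)"
        by (rule index_cyclic_normalizer_Int_cong[OF M(1) _ p3, of t 1 8]) (use M CM tu ot in auto)
      moreover have "cyclic_normalizer t \<inter> M = C" using CM NC by (auto simp: N_def)
      ultimately have "f' = 4" using C(2) ot by simp
      then show False using f'(3) by (simp add: cong_def)
    qed
    have ucentral: "x \<otimes> u = u \<otimes> x" if x: "x \<in> carrier G" for x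
    proof -
      define Z where "Z = {x \<in> carrier G. x \<otimes> u = u \<otimes> x}"
      have Z: "subgroup Z G"
      proof (rule subgroupI_finite)
        show "Z \<subseteq> carrier G" by (auto simp: Z_def)
        show "Z \<noteq> {}" using tu by (auto simp: Z_def)
        fix a b assume ab: "a \<in> Z" "b \<in> Z"
        then have c: "a \<in> carrier G" "b \<in> carrier G" by (auto simp: Z_def)
        have "(a \<otimes> b) \<otimes> u = a \<otimes> (b \<otimes> u)" using c tu by (simp add: m_assoc)
        also have "b \<otimes> u = u \<otimes> b" using ab by (simp add: Z_def)
        also have "a \<otimes> (u \<otimes> b) = (a \<otimes> u) \<otimes> b" using c tu by (simp add: m_assoc)
        also have "a \<otimes> u = u \<otimes> a" using ab by (simp add: Z_def)
        finally show "a \<otimes> b \<in> Z" using c tu by (simp add: Z_def m_assoc)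
      qed
      have CZ: "C \<subseteq> Z"
      proof
        fix x assume "x \<in> C"
        then show "x \<in> Z" using generate_comm[OF g, of x u] tu(4) Cc by (simp add: Z_def C_def)
      qed
      \<comment> \<open>Conjugated back by \<open>y\<close>, the claim is that \<open>t\<close>
        commutes with a conjugate of \<open>u\<close>; both lie in the abelian group
        \<open>C\<close>.\<close>
      have tZ: "y \<otimes> t \<otimes> inv y \<in> Z" if y: "y \<in> carrier G" for y
      proof -
        define v where "v = inv y \<otimes> u \<otimes> y"
        have vC: "v \<in> C" using conj_u[OF y] by (simp add: v_def)
        have vt: "t \<otimes> v = v \<otimes> t" using generate_comm[OF g, of t v] vC tu(3) by (simp add: C_def)
        have vc: "v \<in> carrier G" using Cc[OF vC] .
        have uv: "u = y \<otimes> v \<otimes> inv y" using y tu by (simp add: v_def m_assoc)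
        have "(y \<otimes> t \<otimes> inv y) \<otimes> (y \<otimes> v \<otimes> inv y) = (y \<otimes> v \<otimes> inv y) \<otimes> (y \<otimes> t \<otimes> inv y)"
          using conj_mult[OF y tu(1) vc] conj_mult[OF y vc tu(1)] vt by simp
        then show ?thesis using y tu unfolding Z_def uv[symmetric] by simp
      qed
      have "12 dvd card Z" "card Z dvd 48"
        using card_dvd_of_subgroup_le[OF C(1) Z CZ] C(2) lagrange[OF Z] G by (simp, metis dvd_triv_right)
      then obtain j where j: "card Z = 12 * j" by blast
      have "12 * j dvd 12 * 4" using \<open>card Z dvd 48\<close> j by simp
      then have "j dvd 4" unfolding nat_mult_dvd_cancel_disj by simp
      moreover have "j \<noteq> 0" "j \<noteq> 3" using \<open>j dvd 4\<close> by (intro notI; simp)+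
      ultimately have "j \<noteq> 0" "j \<noteq> 3" "j \<le> 4" using dvd_imp_le[of j 4] by simp_all
      then have "j = 1 \<or> j = 2 \<or> j = 4" by presburger
      \<comment> \<open>j = 1 would put every conjugate of \<open>t\<close> into \<open>C\<close>,
        and then all of the group; j = 2 is excluded by \<open>no24\<close>.\<close>
      then have "Z = carrier G"
      proof (elim disjE)
        assume "j = 1"
        then have "C = Z" using card_subset_eq[OF _ CZ] finite_subset[OF subgroup.subset[OF Z] fin] j C(2) by simp
        then have "carrier G \<subseteq> C" using conj_t tZ by blast
        then show ?thesis using \<open>C = Z\<close> by (auto simp: Z_def)
      next
        assume "j = 2"
        then show ?thesis using no24[OF Z] j CZ gC[of 1] g by auto
      next
        assume "j = 4"
        then show ?thesis using subgroup_eq_carrier[OF Z] j G by simp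
      qed
      then show ?thesis using x by (auto simp: Z_def)
    qed
    have good24: "power_good g" if M: "subgroup M G" "card M = 24" for M
    proof -
      have gM: "g \<notin> M" using no24[OF M] by blast
      define z where "z = u \<otimes> u"
      have zM: "z \<in> M"
        using square_mem_of_index_two[OF M(1) subgroup_self subgroup.subset[OF M(1)] _ tu(2)] M(2) G
        by (simp add: z_def order_def)
      have z6: "z = g [^] (6::nat)" using g by (simp add: z_def u_def nat_pow_mult)
      have zz: "z \<otimes> z = \<one>" using pow_eq_id[OF g, of 12] ord g by (simp add: z6 nat_pow_mult)
      have zx: "z \<otimes> x = x \<otimes> z" if x: "x \<in> carrier G" for x
      proof -
        have "z \<otimes> x = u \<otimes> (x \<otimes> u)" using x tu unfolding ucentral[OF x] by (simp add: z_def m_assoc)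
        also have "\<dots> = (x \<otimes> u) \<otimes> u" using ucentral[of "x \<otimes> u"] x tu by simp
        finally show ?thesis using x tu by (simp add: z_def m_assoc)
      qed
      have "\<exists>\<phi>\<in>auto G. \<phi> g = g \<otimes> z"
        by (rule auto_mult_central_involution[OF M(1) _ zM zz zx g gM]) (use M G in simp_all)
      moreover have "g \<otimes> z = g [^] (7::nat)"
        using nat_pow_mult[OF g, of 1 6] g by (simp add: z6)
      ultimately show ?thesis using power_good_order_12[OF g ord] by simp
    qed
    have good8: "power_good g" if K: "K \<lhd> G" "card K = 8" for K
      using exists_index_two_of_order_48[OF G K] good24 by metis
    obtain P where P: "subgroup P G" "card P = 16"
      using sylow_thm[OF two_is_prime_nat group_axioms _ fin, of 4 3] G by auto
    show ?thesis
    proof (cases "P \<lhd> G")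
      case False
      then obtain x h where "x \<in> carrier G" "h \<in> P" "x \<otimes> h \<otimes> inv x \<notin> P" using normal_invI[OF P(1)] by blast
      then obtain K where "K \<lhd> G" "card K = 8" "K \<subseteq> P"
        by (rule exists_normal_8_of_order_48[OF G P])
      then show ?thesis using good8 by blast
    next
      case PG: True
      show ?thesis
      proof (cases "\<forall>a\<in>P. \<forall>b\<in>P. a \<otimes> b = b \<otimes> a")
        case True
        have idx: "gcd 3 (ord g) \<in> {1, 2, 3, 4, 6}" using ord by (simp add: gcd_non_0_nat)
        have "order G = 3 * card P" using G P(2) by simp
        from power_good_of_index[OF PG _ fin g this idx] show ?thesis using True by blast
      next
        case False
        \<comment> \<open>\<open>P\<close> has index three, so u^3 lies in \<open>P\<close>; since
          \<open>u\<close> has order 4, u = u^9 is a power of it.\<close>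
        have "u [^] (3::nat) \<in> P" using pow_index_mem[OF PG, of 3] tu(2) G P(2) by simp
        then have "(u [^] (3::nat)) [^] (3::int) \<in> P" using subgroup_int_pow_closed[OF P(1)] by blast
        moreover have "(u [^] (3::nat)) [^] (3::int) = u"
        proof -
          have "(u [^] (3::nat)) [^] int 3 = (u [^] (3::nat)) [^] (3::nat)" by (rule int_pow_int)
          also have "\<dots> = u [^] (9::nat)" using tu(2) by (simp add: nat_pow_pow)
          also have "\<dots> = u [^] (1::nat)" using tu(2) ot by (intro pow_eq_of_cong) (simp_all add: cong_def)
          finally show ?thesis using tu(2) by simp
        qed
        ultimately have uP: "u \<in> P" by simp
        \<comment> \<open>An element of \<open>P\<close> that commutes with \<open>t\<close> lies in
          \<open>C\<close>, and its 2-power order makes it a power of g^3.\<close>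
        have fixed: "a \<in> generate G {u}" if a: "a \<in> P" and ta: "t \<otimes> a = a \<otimes> t" for a
        proof -
          have ac: "a \<in> carrier G" using a subgroup.subset[OF P(1)] by blast
          have "a \<otimes> t \<otimes> inv a = t" using ta[symmetric] ac tu by (simp add: m_assoc)
          then have "a \<in> C" using conj_t[OF ac] tu(3) by simp
          then obtain i :: nat where i: "a = g [^] i" using C_iff by blast
          have "ord a dvd 16"
            using group.ord_dvd_group_order[OF subgroup_imp_group[OF P(1)], of a] a P(2) ord_subgroup[OF P(1) a]
            by (simp add: order_def)
          then have "a [^] (16::nat) = \<one>" using pow_eq_id[OF ac] by blast
          then have "12 dvd i * 16" using i g pow_eq_id[OF g] ord by (simp add: nat_pow_pow)
          then have "3 dvd i" by presburger
          then obtain j where "i = 3 * j" by blast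
          then have "a = u [^] j" using i g by (simp add: u_def nat_pow_pow)
          then show ?thesis using mem_generate_iff[OF tu(2)] by blast
        qed
        obtain K where "K \<lhd> G" "card K = 8"
          by (rule exists_quaternion_subgroup[OF PG P(2) tu(1) t3 uP ot(2) ucentral fixed False])
        then show ?thesis using good8 by blast
      qed
    qed
  qed
qed

section \<open>Order 30: elements of order 5\<close>

text \<open>A self-normalising group of prime order has \<open>m\<close> conjugates. Distinct ones
  meet trivially, because any nontrivial element generates its conjugate, so each contributes p - 1
  new elements. Cosets of C index the conjugates.\<close>

lemma card_elements_of_prime_order:
  assumes g: "g \<in> carrier G" and p: "prime p" "ord g = p" and m: "order G = m * p"
    and N: "cyclic_normalizer g = generate G {g}"
  shows "m * (p - 1) \<le> card {x \<in> carrier G. x \<noteq> \<one> \<and> x [^] p = \<one>}"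
proof -
  define C where "C = generate G {g}"
  have C: "subgroup C G" "card C = p" using subgroup_generate[OF g] generate_pow_card[OF g] p by (simp_all add: C_def)
  have Cc: "x \<in> carrier G" if "x \<in> C" for x using that subgroup.subset[OF C(1)] by blast
  have finC: "finite C" using finite_subset[OF subgroup.subset[OF C(1)] fin] .
  define S where "S = rcosets C"
  have cS: "card S = m" using lagrange[OF C(1)] m C(2) prime_gt_0_nat[OF p(1)] by (simp add: S_def)
  define \<sigma> where "\<sigma> T = (SOME x. x \<in> T)" for T :: "'a set"
  have \<sigma>: "\<sigma> T \<in> carrier G" "T = C #> \<sigma> T" if T: "T \<in> S" for T
  proof -
    have "\<sigma> T \<in> T"
      unfolding \<sigma>_def using subgroup.rcosets_non_empty[OF C(1)] T by (metis S_def some_in_eq)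
    moreover obtain y where "y \<in> carrier G" "T = C #> y" using T by (auto simp: S_def RCOSETS_def)
    ultimately show "\<sigma> T \<in> carrier G" "T = C #> \<sigma> T"
      using repr_independence[OF _ _ C(1), of "\<sigma> T" y] r_coset_subset_G[OF subgroup.subset[OF C(1)], of y] by auto
  qed
  define h where "h = (\<lambda>(T, c). inv (\<sigma> T) \<otimes> c \<otimes> \<sigma> T)"
  \<comment> \<open>A nontrivial \<open>c\<close> generates \<open>C\<close>, so conjugating
    \<open>c\<close> into \<open>C\<close> already normalises \<open>C\<close>.\<close>
  have conj_in: "x \<in> C" if x: "x \<in> carrier G" and c: "c \<in> C" "c \<noteq> \<one>" and "x \<otimes> c \<otimes> inv x \<in> C" for x c
  proof -
    obtain i :: nat where i: "c = g [^] i" using c(1) mem_generate_iff[OF g] by (auto simp: C_def)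
    have "\<not> p dvd i" using c(2) i pow_eq_id[OF g] p(2) by simp
    then have "coprime i p" using p(1) by (metis coprime_commute prime_imp_coprime)
    then obtain j where "[i * j = 1] (mod p)" using cong_solve_coprime_nat by auto
    then have "g = c [^] j" using pow_eq_of_cong[of "i * j" 1 g] i g p(2) by (simp add: nat_pow_pow)
    then have "x \<otimes> g \<otimes> inv x = (x \<otimes> c \<otimes> inv x) [^] j" using conj_pow[OF x Cc[OF c(1)]] by simp
    then have "x \<otimes> g \<otimes> inv x \<in> generate G {g}"
      using generate_pow_closed[OF g] that(4) by (simp add: C_def)
    then have "x \<in> cyclic_normalizer g" using x by (simp add: cyclic_normalizer_def)
    then show ?thesis using N by (simp add: C_def)
  qed
  have "inj_on h (S \<times> (C - {\<one>}))"
  proof (rule inj_onI)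
    fix v w assume vw: "v \<in> S \<times> (C - {\<one>})" "w \<in> S \<times> (C - {\<one>})" "h v = h w"
    obtain T c T' c' where v: "v = (T, c)" and w: "w = (T', c')" by (metis surj_pair)
    have T: "T \<in> S" "T' \<in> S" and c: "c \<in> C" "c \<noteq> \<one>" "c' \<in> C" "c' \<noteq> \<one>"
      and eq: "inv (\<sigma> T) \<otimes> c \<otimes> \<sigma> T = inv (\<sigma> T') \<otimes> c' \<otimes> \<sigma> T'"
      using vw unfolding v w h_def by auto
    note car = \<sigma>(1)[OF T(1)] \<sigma>(1)[OF T(2)] Cc[OF c(1)] Cc[OF c(3)]
    define x where "x = \<sigma> T' \<otimes> inv (\<sigma> T)"
    have "x \<otimes> c \<otimes> inv x = \<sigma> T' \<otimes> (inv (\<sigma> T) \<otimes> c \<otimes> \<sigma> T) \<otimes> inv (\<sigma> T')"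
      using car by (simp add: x_def m_assoc inv_mult_group)
    also have "\<dots> = c'" unfolding eq using car by (simp add: m_assoc)
    finally have "x \<in> C" using conj_in[of x c] c car by (simp add: x_def)
    then have "\<sigma> T' \<in> C #> \<sigma> T" using car unfolding r_coset_def x_def
      by (auto intro!: bexI[of _ "\<sigma> T' \<otimes> inv (\<sigma> T)"] simp: m_assoc)
    then have "C #> \<sigma> T = C #> \<sigma> T'" using repr_independence[OF _ car(1) C(1)] by blast
    then have TT: "T = T'" using \<sigma>(2) T by metis
    then show "v = w" using eq car v w by simp
  qed
  then have "card (h ` (S \<times> (C - {\<one>}))) = m * (p - 1)"
    using cS C finC subgroup.one_closed[OF C(1)] by (simp add: card_image card_cartesian_product)
  moreover have "h ` (S \<times> (C - {\<one>})) \<subseteq> {x \<in> carrier G. x \<noteq> \<one> \<and> x [^] p = \<one>}"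
  proof
    fix v assume "v \<in> h ` (S \<times> (C - {\<one>}))"
    then obtain T c where T: "T \<in> S" and c: "c \<in> C" "c \<noteq> \<one>" and v: "v = inv (\<sigma> T) \<otimes> c \<otimes> \<sigma> T"
      unfolding h_def by auto
    note car = \<sigma>(1)[OF T] Cc[OF c(1)]
    have "c [^] p = \<one>" using c(1) g pow_eq_id[OF g] p(2) mem_generate_iff[OF g] by (auto simp: C_def nat_pow_pow)
    then have "(inv (\<sigma> T) \<otimes> c \<otimes> \<sigma> T) [^] p = \<one>"
      using conj_pow[of "inv (\<sigma> T)" c p] car by simp
    moreover have "inv (\<sigma> T) \<otimes> c \<otimes> \<sigma> T \<noteq> \<one>"
    proof
      assume "inv (\<sigma> T) \<otimes> c \<otimes> \<sigma> T = \<one>"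
      then have "inv (\<sigma> T) \<otimes> c \<otimes> inv (inv (\<sigma> T)) = inv (\<sigma> T) \<otimes> \<one> \<otimes> inv (inv (\<sigma> T))" using car by simp
      then show False using conjugation_is_inj[OF _ car(2) one_closed, of "inv (\<sigma> T)"] car c by simp
    qed
    ultimately show "v \<in> {x \<in> carrier G. x \<noteq> \<one> \<and> x [^] p = \<one>}" using car v by simp
  qed
  moreover have "finite {x \<in> carrier G. x \<noteq> \<one> \<and> x [^] p = \<one>}" using fin by simp
  ultimately show ?thesis by (metis (no_types, lifting) card_mono)
qed

lemma cyclic_normalizer_eq_generate:
  assumes g: "g \<in> carrier G" and "card (cyclic_normalizer g) = ord g"
  shows "cyclic_normalizer g = generate G {g}"
  using card_subset_eq[OF finite_subset[OF subgroup.subset[OF subgroup_cyclic_normalizer(1)[OF g]] fin]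
      subgroup_cyclic_normalizer(2)[OF g]] assms(2) generate_pow_card[OF g] by simp

text \<open>The congruence leaves f = 1 or 6. For f = 1 take t of order 3. If the group of t is
  normal, g centralises it, because 2^5 is not 1 modulo 3, and t would lie in the group of g.
  Otherwise both groups are self-normalising and supply 24 + 20 elements, more than 30.\<close>

lemma power_good_order_5_of_30:
  assumes g: "g \<in> carrier G" and ord: "ord g = 5" and G: "order G = 30"
  shows "power_good g"
proof -
  have p3: "prime (3::nat)" and p5: "prime (5::nat)" by simp_all
  obtain f where f: "card (cyclic_normalizer g) = f * ord g" "f dvd 6" "[f = 6] (mod 5)"
    by (rule index_cyclic_normalizer_cong[OF g p5, of 1 6]) (use ord G in auto)
  have "f \<le> 6" using dvd_imp_le[OF f(2)] by simp
  moreover have "f mod 5 = 1" using f(3) by (simp add: cong_def)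
  ultimately have "f = 1 \<or> f = 6" by presburger
  then have "f = 6"
  proof
    assume "f = 1"
    then have Ng: "cyclic_normalizer g = generate G {g}" using cyclic_normalizer_eq_generate[OF g] f by simp
    obtain T where T: "subgroup T G" "card T = 3"
      using sylow_thm[OF p3 group_axioms _ fin, of 1 10] G by auto
    have "T \<noteq> {\<one>}" using T(2) by auto
    then obtain t where t: "t \<in> T" "t \<noteq> \<one>" using subgroup.one_closed[OF T(1)] by blast
    have tc: "t \<in> carrier G" using t subgroup.subset[OF T(1)] by blast
    have "ord t dvd 3"
      using group.ord_dvd_group_order[OF subgroup_imp_group[OF T(1)], of t] t T(2) ord_subgroup[OF T(1) t(1)]
      by (simp add: order_def)
    moreover have "ord t \<noteq> 1" using t ord_eq_1[OF tc] by simp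
    ultimately have ot: "ord t = 3" using p3 prime_nat_iff by blast
    obtain k where k: "card (cyclic_normalizer t) = k * ord t" "k dvd 10" "[k = 10] (mod 3)"
      by (rule index_cyclic_normalizer_cong[OF tc p3, of 1 10]) (use ot G in auto)
    have "k \<le> 10" using dvd_imp_le[OF k(2)] by simp
    moreover have "k mod 3 = 1" using k(3) by (simp add: cong_def)
    moreover have "k \<noteq> 4" "k \<noteq> 7" using k(2) by (intro notI; simp)+
    ultimately have "k = 1 \<or> k = 10" by presburger
    then show ?thesis
    proof
      assume "k = 10"
      then have "cyclic_normalizer t = carrier G"
        using k ot G subgroup_eq_carrier[OF subgroup_cyclic_normalizer(1)[OF tc]] by simp
      then obtain e :: nat where e: "g \<otimes> t \<otimes> inv g = t [^] e"
        using cyclic_normalizer_exponent[OF tc, of g] g by auto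
      have "g [^] (5::nat) = \<one>" using pow_eq_id[OF g] ord by simp
      then have "[e ^ 5 = 1] (mod 3)" using conj_exponent_cong[OF g tc e, of 5] ot tc by simp
      then have "((e mod 3) ^ 5) mod 3 = 1" by (simp add: cong_def power_mod)
      moreover have "e mod 3 = 0 \<or> e mod 3 = 1 \<or> e mod 3 = 2" by presburger
      ultimately have "e mod 3 = 1" by auto
      then have "g \<otimes> t \<otimes> inv g = t" using e pow_eq_of_cong[of e 1 t] ot tc by (simp add: cong_def)
      then have "t \<otimes> g = g \<otimes> t" using commute_of_conj[OF g tc] by simp
      then have "t \<otimes> g \<otimes> inv t = g" using g tc by (simp add: m_assoc)
      then have "t \<in> cyclic_normalizer g" using tc by (simp add: cyclic_normalizer_def generate.incl)
      then have tC: "t \<in> generate G {g}" using Ng by simp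
      have "ord t dvd 5"
        using group.ord_dvd_group_order[OF subgroup_imp_group[OF subgroup_generate[OF g]], of t] tC
          ord_subgroup[OF subgroup_generate[OF g] tC] generate_pow_card[OF g] ord by (simp add: order_def)
      then show ?thesis using ot by simp
    next
      assume "k = 1"
      then have Nt: "cyclic_normalizer t = generate G {t}" using cyclic_normalizer_eq_generate[OF tc] k by simp
      define E where "E p = {x \<in> carrier G. x \<noteq> \<one> \<and> x [^] p = \<one>}" for p :: nat
      have "24 \<le> card (E 5)" "20 \<le> card (E 3)"
        using card_elements_of_prime_order[OF g p5 ord, of 6] card_elements_of_prime_order[OF tc p3 ot, of 10] G Ng Nt
        by (simp_all add: E_def)
      moreover have "E 5 \<inter> E 3 = {}"
      proof -
        have "x = \<one>" if x: "x \<in> carrier G" "x [^] (5::nat) = \<one>" "x [^] (3::nat) = \<one>" for x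
        proof -
          have "ord x dvd gcd 5 3" using x pow_eq_id[OF x(1)] by (intro gcd_greatest) auto
          then show ?thesis using ord_eq_1[OF x(1)] by (simp add: gcd_non_0_nat)
        qed
        then show ?thesis by (auto simp: E_def)
      qed
      moreover have "finite (E 5)" "finite (E 3)" using fin by (simp_all add: E_def)
      moreover have "card (E 5 \<union> E 3) \<le> order G"
        unfolding order_def by (intro card_mono fin) (auto simp: E_def)
      ultimately show ?thesis using G by (simp add: card_Un_disjoint)
    qed
  qed
  then have "cyclic_normalizer g = carrier G"
    using f ord G subgroup_eq_carrier[OF subgroup_cyclic_normalizer(1)[OF g]] by simp
  then show ?thesis using power_good_of_normal[OF g, of 6] G ord by (simp add: gcd_non_0_nat)
qed

section \<open>Assembly: all pairs of element order and index\<close>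

text \<open>For m = 3, 4, 5, 6 the pigeonhole criterion is applied with L = 2, 6, 12, 60, the least
  common multiple of 1, ..., m - 1, and the pairs that escape it go to the lemmas on exceptional
  orders. For m at least 7 the bound leaves only n = 5 and, if m = 7, n = 7.\<close>

lemma power_good_order_le_54:
  assumes g: "g \<in> carrier G" and G: "order G \<le> 54"
  shows "power_good g"
proof -
  define n where "n = ord g"
  obtain m where "order G = n * m" using ord_dvd_group_order[OF g] unfolding n_def by blast
  then have m: "order G = m * n" by simp
  have n0: "n > 0" using ord_pos[OF g] by (simp add: n_def)
  have m0: "m > 0" using m fin by (metis gr0I mult_0 order_gt_0_iff_finite less_irrefl)
  have mn: "m * n \<le> 54" using G m by simp
  have mg: "order G = m * ord g" using m by (simp add: n_def)
  have lcm: "power_good g" if "m > 1" "\<And>r. r \<in> {1..<m} \<Longrightarrow> r dvd L" "gcd (m * gcd L n) n \<in> {1, 2, 3, 4, 6}" for L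
    using power_good_of_lcm[OF g mg that(1,2)] that(3) by (simp add: n_def)
  consider "n \<in> {1, 2, 3, 4, 6}" | "m = 1" | "m = 2" | "m \<ge> 3" "n \<ge> 5" "n \<noteq> 6"
    using n0 m0 by (simp; linarith)
  then show ?thesis
  proof cases
    case 1
    \<comment> \<open>When the only units modulo \<open>n\<close> are 1 and -1, the trivial subgroup
      can serve as A.\<close>
    have "gcd (order G) (ord g) = n" using m by (simp add: n_def)
    then show ?thesis
      using 1 power_good_of_index[OF one_is_normal _ fin g, of "order G"] by simp
  next
    case 2
    then have "generate G {g} = carrier G"
      using subgroup_eq_carrier[OF subgroup_generate[OF g]] generate_pow_card[OF g] mg by simp
    then have "cyclic_normalizer g = carrier G"
      using subgroup_cyclic_normalizer[OF g] subgroup.subset by blast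
    then show ?thesis using power_good_of_normal[OF g mg] 2 by simp
  next
    case 3
    have "generate G {g} \<lhd> G"
      using normal_of_index_two[OF subgroup_generate[OF g]] generate_pow_card[OF g] mg 3 by simp
    moreover have "gcd 2 n = 1 \<or> gcd 2 n = 2"
      using gcd_le1_nat[of 2 n] gcd_pos_nat[of 2 n] by linarith
    ultimately show ?thesis
      using power_good_of_normal[OF g mg] normal_generate_iff[OF g] 3 by (auto simp: n_def)
  next
    case 4
    have "m * 5 \<le> m * n" using 4 by simp
    then have "m \<le> 10" using mn by linarith
    then consider "m = 3" | "m = 4" | "m = 5" | "m = 6" | "m = 7" | "m = 8" | "m = 9" | "m = 10"
      using 4 by linarith
    then show ?thesis
    proof cases
      case 1
      then have "n \<le> 18" using mn by simp
      then have "n = 5 \<or> n = 7 \<or> n = 8 \<or> n = 9 \<or> n = 10 \<or> n = 11 \<or> n = 12 \<or> n = 13 \<or> n = 14 \<or> n = 15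
          \<or> n = 16 \<or> n = 17 \<or> n = 18" using 4 by presburger
      then have idx: "gcd (m * gcd 2 n) n \<in> {1, 2, 3, 4, 6}" using 1 by (elim disjE) (simp_all add: gcd_non_0_nat)
      have L: "r dvd 2" if "r \<in> {1..<m}" for r
      proof -
        have "r = 1 \<or> r = 2" using that 1 by auto
        then show ?thesis by auto
      qed
      show ?thesis by (rule lcm[OF _ L idx]) (use 1 in simp)
    next
      case 2
      then have "n \<le> 13" using mn by simp
      then have "n = 8 \<or> n = 12 \<or> n = 5 \<or> n = 7 \<or> n = 9 \<or> n = 10 \<or> n = 11 \<or> n = 13" using 4 by presburger
      then consider "n = 8" | "n = 12" | "gcd (m * gcd 6 n) n \<in> {1, 2, 3, 4, 6}"
        using 2 by (elim disjE) (simp_all add: gcd_non_0_nat)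
      then show ?thesis
      proof cases
        case 3
        have L: "r dvd 6" if "r \<in> {1..<m}" for r
        proof -
          have "r = 1 \<or> r = 2 \<or> r = 3" using that 2 by auto
          then show ?thesis by auto
        qed
        show ?thesis by (rule lcm[OF _ L 3]) (use 2 in simp)
      qed (use power_good_order_8_of_32[OF g] power_good_order_12_of_48[OF g] m 2 in \<open>simp_all add: n_def\<close>)
    next
      case 3
      then have "n \<le> 10" using mn by simp
      then have "n = 5 \<or> n = 10 \<or> n = 7 \<or> n = 8 \<or> n = 9" using 4 by presburger
      then consider "n = 5 \<or> n = 10" | "gcd (m * gcd 12 n) n \<in> {1, 2, 3, 4, 6}"
        using 3 by (elim disjE) (simp_all add: gcd_non_0_nat)
      then show ?thesis
      proof cases
        case 1
        then show ?thesis
          using power_good_of_sylow_square[of 5 1 g] power_good_of_sylow_square[of 5 2 g] g m 3 by auto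
      next
        case 2
        have L: "r dvd 12" if "r \<in> {1..<m}" for r
        proof -
          have "r = 1 \<or> r = 2 \<or> r = 3 \<or> r = 4" using that 3 by auto
          then show ?thesis by auto
        qed
        show ?thesis by (rule lcm[OF _ L 2]) (use 3 in simp)
      qed
    next
      case 4
      then have "n \<le> 9" using mn by simp
      then have "n = 5 \<or> n = 8 \<or> n = 9 \<or> n = 7" using \<open>n \<ge> 5\<close> \<open>n \<noteq> 6\<close> by presburger
      then consider "n = 5" | "n = 8" | "n = 9" | "gcd (m * gcd 60 n) n \<in> {1, 2, 3, 4, 6}"
        using 4 by (elim disjE) (simp_all add: gcd_non_0_nat)
      then show ?thesis
      proof cases
        case last: 4
        have L: "r dvd 60" if "r \<in> {1..<m}" for r
        proof -
          have "r = 1 \<or> r = 2 \<or> r = 3 \<or> r = 4 \<or> r = 5" using that \<open>m = 6\<close> by auto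
          then show ?thesis by auto
        qed
        show ?thesis by (rule lcm[OF _ L last]) (use \<open>m = 6\<close> in simp)
      qed (use power_good_order_5_of_30[OF g] power_good_order_8_of_48[OF g] power_good_order_9_of_54[OF g] m \<open>m = 6\<close>
          in \<open>simp_all add: n_def\<close>)
    next
      case 5
      then have "n \<le> 7" using mn by simp
      then have "n = 5 \<or> n = 7" using \<open>n \<ge> 5\<close> \<open>n \<noteq> 6\<close> by presburger
      then show ?thesis
        using power_good_of_sylow_square[of 7 1 g] power_good_order_5[OF g, of 7] g m 5 by (auto simp: n_def)
    next
      case 6
      then have "n = 5" using mn \<open>n \<ge> 5\<close> \<open>n \<noteq> 6\<close> by simp
      then show ?thesis using power_good_order_5[OF g, of 8] m 6 by (simp add: n_def)
    next
      case 7
      then have "n = 5" using mn \<open>n \<ge> 5\<close> \<open>n \<noteq> 6\<close> by simp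
      then show ?thesis using power_good_order_5[OF g, of 9] m 7 by (simp add: n_def)
    next
      case 8
      then have "n = 5" using mn \<open>n \<ge> 5\<close> by simp
      then show ?thesis using power_good_of_sylow_square[of 5 2 g] g m 8 by simp
    qed
  qed
qed

end

theorem mainTheorem3:
  fixes G :: "('a, 'b) monoid_scheme"
  assumes "group G" and "finite (carrier G)" and "order G \<le> 54"
  shows "Aut_class_defect G = 0"
proof -
  interpret group G by fact
  interpret finite_group G by unfold_locales fact
  show ?thesis using Aut_class_defect_zeroI[OF assms(2)] power_good_order_le_54 assms(3) by blast
qed

end
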